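(* Let $G$ be a finite group, let $p$ be a prime number that divides $|G|$, and let $G$ act trivially on $\mathbb{F}_p$. Then the cohomology ring $H^*(G,\mathbb{F}_p)$ is generated in degree one if and only if $p=2$ and the Sylow $2$-subgroup of $G$ is a nontrivial elementary $2$-abelian group that admits a normal complement in $G$.
   Context: $H^*(G,\mathbb{F}_p)=\bigoplus_{m\ge 0}H^m(G,\mathbb{F}_p)$ is the group cohomology ring under cup product, a graded-commutative $\mathbb{F}_p$-algebra. It is generated in degree one if it is generated as an $\mathbb{F}_p$-algebra by $H^1(G,\mathbb{F}_p)$. An elementary $2$-abelian group is an abelian group in which every element has order dividing $2$. A normal complement of a subgroup $S\le G$ is a normal subgroup $N$ of $G$ with $N\cap S=1$ and $NS=G$. *)

theory Defs
  imports
    "HOL-Algebra.Product_Groups"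
    "HOL-Algebra.QuotRing"
    "HOL-Algebra.Generated_Rings"
    "HOL-Algebra.Multiplicative_Group"
    "HOL-Number_Theory.Residues"
begin

section \<open>Inhomogeneous cochains with trivial coefficients\<close>

text \<open>
  An element of \<open>G\<^sup>n\<close> is a list of length \<open>n\<close> over \<^term>\<open>carrier G\<close>. The coefficients
  are a ring \<open>R\<close>, on which \<open>G\<close> acts trivially.
\<close>

definition tuples :: "('a, 'm) monoid_scheme \<Rightarrow> nat \<Rightarrow> 'a list set" where
  "tuples G n = {xs. length xs = n \<and> set xs \<subseteq> carrier G}"

definition cochain_group ::
  "('a, 'm) monoid_scheme \<Rightarrow> ('b, 'n) ring_scheme \<Rightarrow> nat \<Rightarrow> ('a list \<Rightarrow> 'b) monoid" where
  "cochain_group G R n = product_group (tuples G n) (\<lambda>_. add_monoid R)"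

text \<open>
  The differential of the (unnormalized) bar complex: \<open>(\<delta> f)(g\<^sub>1, \<dots>, g\<^bsub>n+1\<^esub>)\<close> is
  \<open>f(g\<^sub>2, \<dots>, g\<^bsub>n+1\<^esub>) + (\<Sum>i=1..n. (-1)\<^sup>i f(g\<^sub>1, \<dots>, g\<^sub>i g\<^bsub>i+1\<^esub>, \<dots>, g\<^bsub>n+1\<^esub>)) + (-1)\<^bsup>n+1\<^esup> f(g\<^sub>1, \<dots>, g\<^sub>n)\<close>.
  By triviality of the action, the first term is not multiplied by \<open>g\<^sub>1\<close>. Lists are indexed
  from 0, hence the summation index below is \<open>i - 1\<close>.
\<close>

definition coboundary ::
  "('a, 'm) monoid_scheme \<Rightarrow> ('b, 'n) ring_scheme \<Rightarrow> nat \<Rightarrow> ('a list \<Rightarrow> 'b) \<Rightarrow> 'a list \<Rightarrow> 'b" where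
  "coboundary G R n f = (\<lambda>xs \<in> tuples G (Suc n).
     f (tl xs)
     \<oplus>\<^bsub>R\<^esub> (\<Oplus>\<^bsub>R\<^esub>i \<in> {..<n}. ((\<ominus>\<^bsub>R\<^esub> \<one>\<^bsub>R\<^esub>) [^]\<^bsub>R\<^esub> Suc i) \<otimes>\<^bsub>R\<^esub>
            f (take i xs @ (xs ! i \<otimes>\<^bsub>G\<^esub> xs ! Suc i) # drop (i + 2) xs))
     \<oplus>\<^bsub>R\<^esub> ((\<ominus>\<^bsub>R\<^esub> \<one>\<^bsub>R\<^esub>) [^]\<^bsub>R\<^esub> Suc n) \<otimes>\<^bsub>R\<^esub> f (butlast xs))"

definition cocycles ::
  "('a, 'm) monoid_scheme \<Rightarrow> ('b, 'n) ring_scheme \<Rightarrow> nat \<Rightarrow> ('a list \<Rightarrow> 'b) set" where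
  "cocycles G R n = kernel (cochain_group G R n) (cochain_group G R (Suc n)) (coboundary G R n)"

definition coboundaries ::
  "('a, 'm) monoid_scheme \<Rightarrow> ('b, 'n) ring_scheme \<Rightarrow> nat \<Rightarrow> ('a list \<Rightarrow> 'b) set" where
  "coboundaries G R n = (case n of
      0 \<Rightarrow> {\<one>\<^bsub>cochain_group G R 0\<^esub>}
    | Suc k \<Rightarrow> coboundary G R k ` carrier (cochain_group G R k))"

definition cohomology ::
  "('a, 'm) monoid_scheme \<Rightarrow> ('b, 'n) ring_scheme \<Rightarrow> nat \<Rightarrow> ('a list \<Rightarrow> 'b) set monoid" where
  "cohomology G R n =
     (cochain_group G R n)\<lparr>carrier := cocycles G R n\<rparr> Mod coboundaries G R n"


section \<open>The cup product and the cohomology ring\<close>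

definition cochain_cup ::
  "('a, 'm) monoid_scheme \<Rightarrow> ('b, 'n) ring_scheme \<Rightarrow> nat \<Rightarrow> nat
     \<Rightarrow> ('a list \<Rightarrow> 'b) \<Rightarrow> ('a list \<Rightarrow> 'b) \<Rightarrow> 'a list \<Rightarrow> 'b" where
  "cochain_cup G R m n f h =
     (\<lambda>xs \<in> tuples G (m + n). f (take m xs) \<otimes>\<^bsub>R\<^esub> h (drop m xs))"

definition cohomology_class ::
  "('a, 'm) monoid_scheme \<Rightarrow> ('b, 'n) ring_scheme \<Rightarrow> nat \<Rightarrow> ('a list \<Rightarrow> 'b) \<Rightarrow> ('a list \<Rightarrow> 'b) set"
where
  "cohomology_class G R n f = coboundaries G R n #>\<^bsub>cochain_group G R n\<^esub> f"

text \<open>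
  The product of classes is the union over all representatives, as in \<^const>\<open>rcoset_mult\<close>;
  by the Leibniz rule all members of this union are the same class.
\<close>

definition cup ::
  "('a, 'm) monoid_scheme \<Rightarrow> ('b, 'n) ring_scheme \<Rightarrow> nat \<Rightarrow> nat
     \<Rightarrow> ('a list \<Rightarrow> 'b) set \<Rightarrow> ('a list \<Rightarrow> 'b) set \<Rightarrow> ('a list \<Rightarrow> 'b) set" where
  "cup G R m n A B = (\<Union>f \<in> A. \<Union>h \<in> B. cohomology_class G R (m + n) (cochain_cup G R m n f h))"

definition homogeneous ::
  "('a, 'm) monoid_scheme \<Rightarrow> ('b, 'n) ring_scheme \<Rightarrow> nat \<Rightarrow> ('a list \<Rightarrow> 'b) set
     \<Rightarrow> nat \<Rightarrow> ('a list \<Rightarrow> 'b) set" where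
  "homogeneous G R n A = (\<lambda>m. if m = n then A else \<one>\<^bsub>cohomology G R m\<^esub>)"

definition scalar ::
  "('a, 'm) monoid_scheme \<Rightarrow> ('b, 'n) ring_scheme \<Rightarrow> 'b \<Rightarrow> nat \<Rightarrow> ('a list \<Rightarrow> 'b) set" where
  "scalar G R a = homogeneous G R 0 (cohomology_class G R 0 (\<lambda>xs \<in> tuples G 0. a))"

text \<open>
  \<open>H\<^sup>*(G, R)\<close> is the direct sum of the \<open>H\<^sup>m(G, R)\<close>: its elements are the families
  \<open>x\<close> with \<open>x m \<in> H\<^sup>m(G, R)\<close>, trivial for almost all \<open>m\<close>. As the group law of
  \<^const>\<open>cohomology\<close> is written multiplicatively, the sum over \<open>i + j = m\<close> of the products
  \<open>x i \<union> y j\<close> is a \<^const>\<open>finprod\<close>.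
\<close>

definition cohomology_ring ::
  "('a, 'm) monoid_scheme \<Rightarrow> ('b, 'n) ring_scheme \<Rightarrow> (nat \<Rightarrow> ('a list \<Rightarrow> 'b) set) ring" where
  "cohomology_ring G R =
     \<lparr>carrier = carrier (sum_group UNIV (cohomology G R)),
      monoid.mult = (\<lambda>x y m. finprod (cohomology G R m) (\<lambda>i. cup G R i (m - i) (x i) (y (m - i))) {..m}),
      monoid.one = scalar G R \<one>\<^bsub>R\<^esub>,
      ring.zero = \<one>\<^bsub>sum_group UNIV (cohomology G R)\<^esub>,
      ring.add = monoid.mult (sum_group UNIV (cohomology G R))\<rparr>"

text \<open>
  The \<open>R\<close>-subalgebra generated by a set is the subring generated by it and the scalars.
\<close>

definition generated_in_degree_one ::
  "('a, 'm) monoid_scheme \<Rightarrow> ('b, 'n) ring_scheme \<Rightarrow> bool" where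
  "generated_in_degree_one G R \<longleftrightarrow>
     generate_ring (cohomology_ring G R)
       (scalar G R ` carrier R \<union> homogeneous G R 1 ` carrier (cohomology G R 1))
     = carrier (cohomology_ring G R)"


section \<open>Sylow subgroups, elementary abelian groups, and normal complements\<close>

definition sylow_subgroup :: "nat \<Rightarrow> 'a set \<Rightarrow> ('a, 'm) monoid_scheme \<Rightarrow> bool" where
  "sylow_subgroup p S G \<longleftrightarrow> subgroup S G \<and> card S = p ^ multiplicity p (order G)"

definition elementary_2_abelian :: "('a, 'm) monoid_scheme \<Rightarrow> bool" where
  "elementary_2_abelian G \<longleftrightarrow> comm_group G \<and> (\<forall>x \<in> carrier G. group.ord G x dvd 2)"

definition normal_complement :: "'a set \<Rightarrow> 'a set \<Rightarrow> ('a, 'm) monoid_scheme \<Rightarrow> bool" where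
  "normal_complement N S G \<longleftrightarrow> N \<lhd> G \<and> N \<inter> S = {\<one>\<^bsub>G\<^esub>} \<and> N <#>\<^bsub>G\<^esub> S = carrier G"

end

theory Submission
  imports Defs "HOL-Algebra.Sylow" "HOL-Algebra.Zassenhaus"
begin

text \<open>
  Both directions work with homogeneous cochains: functions \<open>F\<close> of \<open>n + 1\<close> group elements
  that are invariant under simultaneous left translation modulo \<open>p\<close>, with the alternating
  sum over deletions as differential. In this language, being generated in degree one means that
  every cocycle lies in the inductively defined set \<open>gen1\<close>: the closure of the constants
  under cup products with homomorphisms \<open>G \<rightarrow> \<int>/p\<close> from the left, sums, and changes by
  coboundaries (\<open>generated_in_degree_one_iff\<close>).

  Let the cohomology be generated in degree one, and let \<open>c\<close> have prime order \<open>p\<close>, with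
  \<open>C = \<langle>c\<rangle>\<close>. The heart of the proof is a class of positive degree on \<open>G\<close> whose restriction
  to \<open>C\<close> is nonzero, and more precisely one that is not accounted for by degree one. Consider
  the nonempty subsets of \<open>G\<close> that contain no left coset of \<open>C\<close>. They are the faces of a
  join of boundaries of simplices, one for each coset, that is, of a sphere of dimension
  \<open>D - 1\<close>, where \<open>D\<close> is \<open>card G\<close> minus the number of cosets. The group \<open>G\<close> acts on it by
  left translation and \<open>C\<close> acts freely by right translation. The Euler class of the action of
  \<open>G \<times> C\<close> lies in \<open>H\<^sup>D(G \<times> C)\<close> and decomposes into components \<open>a\<^sub>i\<close> in
  \<open>H\<^sup>i(G) \<otimes> H\<^bsup>D-i\<^esup>(C)\<close>, analogues of Chern classes; \<open>a\<^sub>0 = 1\<close> because \<open>C\<close> acts freely.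
  The vertex \<open>{1}\<close> satisfies \<open>c {1} = {1} c\<close>, so it is fixed by a diagonal copy of \<open>C\<close>, on
  which the Euler class therefore vanishes. If all \<open>a\<^sub>i\<close> with \<open>i > 0\<close> died on \<open>C\<close>, the
  restriction to the diagonal would be the generator \<open>a\<^sub>0\<close> of \<open>H\<^sup>D(C)\<close>, a contradiction.
  These statements are carried out with explicit cochains in \<open>cohomology_of_faces\<close>,
  \<open>chern_classes\<close>, \<open>chern_classes_not_all_trivial\<close> and
  \<open>positive_degree_restriction_nontrivial\<close>.

  If \<open>p\<close> is odd, a product of two classes of degree one restricts to zero on \<open>C\<close>, since
  these restrictions are proportional to one class, whose square vanishes; and a class of degree
  one can be absorbed in the argument above, because the values of a homomorphism on \<open>C\<close> add up
  to \<open>0\<close>. So \<open>p = 2\<close>, and moreover every element of order \<open>2\<close> is detected by a homomorphism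
  to \<open>\<int>/2\<close> (\<open>gen1_all_imp_hom\<close>). Hence the common kernel \<open>N\<close> of these homomorphisms has odd
  order. As \<open>G/N\<close> is an elementary abelian \<open>2\<close>-group, \<open>N\<close> is a normal complement of the
  Sylow \<open>2\<close>-subgroup \<open>S\<close>, and \<open>S \<cong> G/N\<close> is elementary abelian
  (\<open>elementary_normal_complement\<close>).

  Conversely, the cohomology of an elementary abelian \<open>2\<close>-group is generated in degree one by
  induction on the order: for a subgroup \<open>H\<close> of index two, complemented by \<open>\<langle>\<tau>\<rangle>\<close>, every
  cocycle is cohomologous to the pullback of its restriction to \<open>H\<close> plus a cup product with the
  homomorphism that has kernel \<open>H\<close> (\<open>gen1_index_two\<close>). A normal complement \<open>N\<close> of odd order
  adds nothing: averaging over \<open>N\<close> shows that every cocycle is cohomologous to its pullback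
  along the retraction \<open>G \<rightarrow> S\<close> (\<open>gen1_normal_complement\<close>).
\<close>

section \<open>Cochains on lists, prisms and Mayer--Vietoris\<close>

text \<open>
  An integer-valued function on lists of length \<open>n + 1\<close> is a cochain of degree \<open>n\<close>; congruences
  replace coefficients in \<open>\<int>/m\<close>. The differential is augmented: \<open>[]\<close> is the simplex of
  dimension \<open>- 1\<close>. Repeated entries are allowed, so that cones and prisms need no case distinction.
\<close>

fun sd :: "('x list \<Rightarrow> int) \<Rightarrow> 'x list \<Rightarrow> int" where
  "sd f [] = 0"
| "sd f (x # xs) = f xs - sd (\<lambda>ys. f (x # ys)) xs"

lemma sd_add: "sd (\<lambda>ys. f ys + g ys) xs = sd f xs + sd g xs"
  by (induction xs arbitrary: f g) auto

lemma sd_diff: "sd (\<lambda>ys. f ys - g ys) xs = sd f xs - sd g xs"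
  by (induction xs arbitrary: f g) auto

lemma sd_uminus: "sd (\<lambda>ys. - f ys) xs = - sd f xs"
  by (induction xs arbitrary: f) auto

lemma sd_mult: "sd (\<lambda>ys. a * f ys) xs = a * sd f xs"
  by (induction xs arbitrary: f) (auto simp: algebra_simps)

lemma sd_zero: "sd (\<lambda>ys. 0) xs = 0"
  by (induction xs) auto

lemma sd_sum: "sd (\<lambda>ys. \<Sum>i\<in>I. f i ys) xs = (\<Sum>i\<in>I. sd (f i) xs)"
  by (induction I rule: infinite_finite_induct) (auto simp: sd_zero sd_add)

lemmas sd_linear = sd_add sd_diff sd_uminus sd_mult sd_zero sd_sum

lemma sd_map: "sd (\<lambda>ys. f (map \<phi> ys)) xs = sd f (map \<phi> xs)"
  by (induction xs arbitrary: f) auto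

lemma sd_sd: "sd (\<lambda>ys. sd f ys) xs = 0"
  by (induction xs arbitrary: f) (auto simp: sd_linear)

lemma sd_cong_mod:
  assumes "\<And>as b bs. xs = as @ b # bs \<Longrightarrow> [f (as @ bs) = g (as @ bs)] (mod m)"
  shows "[sd f xs = sd g xs] (mod m)"
  using assms
proof (induction xs arbitrary: f g)
  case (Cons x xs)
  have "[f xs = g xs] (mod m)"
    using Cons.prems[of "[]"] by simp
  moreover have "[sd (\<lambda>ys. f (x # ys)) xs = sd (\<lambda>ys. g (x # ys)) xs] (mod m)"
    using Cons.prems[of "x # _"] by (intro Cons.IH) auto
  ultimately show ?case
    by (auto intro: cong_diff)
qed simp

lemma sd_cong_zero:
  assumes "\<And>as b bs. xs = as @ b # bs \<Longrightarrow> [f (as @ bs) = 0] (mod m)"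
  shows "[sd f xs = 0] (mod m)"
  using sd_cong_mod[of xs f "\<lambda>_. 0" m] assms by (simp add: sd_zero)

lemma sd_cong:
  assumes "\<And>as b bs. xs = as @ b # bs \<Longrightarrow> f (as @ bs) = g (as @ bs)"
  shows "sd f xs = sd g xs"
  using sd_cong_mod[of xs f g 0] assms by (simp add: cong_0)

text \<open>
  The homotopy between the identity and the pullback along \<open>\<phi>\<close>: the alternating sum over the
  simplices \<open>x\<^sub>0, \<dots>, x\<^sub>i, \<phi> x\<^sub>i, \<dots>, \<phi> x\<^sub>n\<close> of the prism.
\<close>

fun prism :: "('x \<Rightarrow> 'x) \<Rightarrow> ('x list \<Rightarrow> int) \<Rightarrow> 'x list \<Rightarrow> int" where
  "prism \<phi> f [] = 0"
| "prism \<phi> f (x # xs) = f (x # \<phi> x # map \<phi> xs) - prism \<phi> (\<lambda>ys. f (x # ys)) xs"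

lemma prism_diff: "prism \<phi> (\<lambda>ys. f ys - g ys) xs = prism \<phi> f xs - prism \<phi> g xs"
  by (induction xs arbitrary: f g) auto

lemma prism_homotopy:
  "sd (prism \<phi> f) xs + prism \<phi> (sd f) xs = f (map \<phi> xs) - f xs"
proof (induction xs arbitrary: f)
  case (Cons x xs)
  have "sd (\<lambda>ys. f (x # \<phi> x # map \<phi> ys)) xs = sd (\<lambda>ys. f (x # \<phi> x # ys)) (map \<phi> xs)"
    by (rule sd_map)
  then show ?case
    using Cons[of "\<lambda>ys. f (x # ys)"] by (simp add: sd_linear prism_diff)
qed simp

lemma prism_cong_zero:
  assumes "\<And>as b bs. xs = as @ b # bs \<Longrightarrow> [f (as @ b # map \<phi> (b # bs)) = 0] (mod m)"
  shows "[prism \<phi> f xs = 0] (mod m)"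
  using assms
proof (induction xs arbitrary: f)
  case (Cons x xs)
  have "[f (x # \<phi> x # map \<phi> xs) = 0] (mod m)"
    using Cons.prems[of "[]"] by simp
  moreover have "[prism \<phi> (\<lambda>ys. f (x # ys)) xs = 0] (mod m)"
    using Cons.prems[of "x # _"] by (intro Cons.IH) auto
  ultimately show ?case
    using cong_diff[of _ 0 m _ 0] by simp
qed simp

definition face_closed :: "'x list set \<Rightarrow> bool" where
  "face_closed K \<longleftrightarrow> (\<forall>as b bs. as @ b # bs \<in> K \<longrightarrow> as @ bs \<in> K)"

text \<open>
  Lists of length \<open>q\<close> are simplices of dimension \<open>q - 1\<close>, so the index \<open>q\<close> belongs to the reduced
  cohomology in degree \<open>q - 1\<close>.
\<close>

definition acyclic_in :: "int \<Rightarrow> 'x list set \<Rightarrow> nat \<Rightarrow> bool" where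
  "acyclic_in m K q \<longleftrightarrow>
     (\<forall>f. (\<forall>xs\<in>K. length xs = Suc q \<longrightarrow> [sd f xs = 0] (mod m)) \<longrightarrow>
       (\<exists>w. \<forall>xs\<in>K. length xs = q \<longrightarrow> [f xs = sd w xs] (mod m)))"

text \<open>
  For prime \<open>m\<close>: a cohomology group over \<open>\<int>/m\<close> has dimension at most one, expressed without
  mention of the group: any two cocycles satisfy a nontrivial linear relation up to coboundaries.
\<close>

definition rank_le_one_in :: "int \<Rightarrow> 'x list set \<Rightarrow> nat \<Rightarrow> bool" where
  "rank_le_one_in m K q \<longleftrightarrow>
     (\<forall>f f'. (\<forall>xs\<in>K. length xs = Suc q \<longrightarrow> [sd f xs = 0] (mod m)) \<longrightarrow>
        (\<forall>xs\<in>K. length xs = Suc q \<longrightarrow> [sd f' xs = 0] (mod m)) \<longrightarrow>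
       (\<exists>a b w. \<not> (m dvd a \<and> m dvd b) \<and>
          (\<forall>xs\<in>K. length xs = q \<longrightarrow> [a * f xs + b * f' xs = sd w xs] (mod m))))"

text \<open>
  The gluing step of the Mayer--Vietoris sequence: two local primitives whose difference on the
  intersection is \<open>sd u\<close> agree there after the first one is corrected by \<open>sd u\<close>, which does not
  change its own differential.
\<close>

lemma mv_glue:
  assumes K: "face_closed K1" "face_closed K2"
    and f1: "\<forall>xs\<in>K1. length xs = Suc q \<longrightarrow> [f xs = sd w1 xs] (mod m)"
    and f2: "\<forall>xs\<in>K2. length xs = Suc q \<longrightarrow> [f xs = sd w2 xs] (mod m)"
    and u: "\<forall>xs\<in>K1 \<inter> K2. length xs = q \<longrightarrow> [w1 xs - w2 xs = sd u xs] (mod m)"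
  shows "\<exists>w. \<forall>xs\<in>K1 \<union> K2. length xs = Suc q \<longrightarrow> [f xs = sd w xs] (mod m)"
proof -
  define w where "w = (\<lambda>xs. if xs \<in> K1 then w1 xs - sd u xs else w2 xs)"
  have "[f xs = sd w xs] (mod m)" if xs: "xs \<in> K1 \<union> K2" "length xs = Suc q" for xs
  proof (cases "xs \<in> K1")
    case True
    have "[sd w xs = sd (\<lambda>xs. w1 xs - sd u xs) xs] (mod m)"
      using K(1) True by (intro sd_cong_mod) (auto simp: w_def face_closed_def)
    then have "[sd w xs = sd w1 xs] (mod m)"
      by (simp add: sd_diff sd_sd)
    then show ?thesis
      using f1 True xs(2) by (meson cong_sym cong_trans)
  next
    case False
    then have xs2: "xs \<in> K2"
      using xs by blast
    have "[sd w xs = sd w2 xs] (mod m)"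
    proof (intro sd_cong_mod)
      fix as b bs assume e: "xs = as @ b # bs"
      have in2: "as @ bs \<in> K2"
        using K(2) xs2 e by (auto simp: face_closed_def)
      have "[w1 (as @ bs) - sd u (as @ bs) = w2 (as @ bs)] (mod m)" if "as @ bs \<in> K1"
      proof -
        have "[w1 (as @ bs) - w2 (as @ bs) = sd u (as @ bs)] (mod m)"
          using u in2 that e xs(2) by simp
        then show ?thesis
          by (simp add: cong_iff_dvd_diff algebra_simps)
      qed
      then show "[w (as @ bs) = w2 (as @ bs)] (mod m)"
        by (simp add: w_def)
    qed
    then show ?thesis
      using f2 xs2 xs(2) by (meson cong_sym cong_trans)
  qed
  then show ?thesis
    by blast
qed

lemma mv_cocycle:
  assumes K: "face_closed K1" "face_closed K2"
    and f1: "\<forall>xs\<in>K1. length xs = Suc q \<longrightarrow> [f xs = sd w1 xs] (mod m)"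
    and f2: "\<forall>xs\<in>K2. length xs = Suc q \<longrightarrow> [f xs = sd w2 xs] (mod m)"
  shows "\<forall>xs\<in>K1 \<inter> K2. length xs = Suc q \<longrightarrow> [sd (\<lambda>ys. w1 ys - w2 ys) xs = 0] (mod m)"
proof (intro ballI impI)
  fix xs assume xs: "xs \<in> K1 \<inter> K2" "length xs = Suc q"
  have "[f xs = sd w1 xs] (mod m)"
    using f1 xs by blast
  moreover have "[f xs = sd w2 xs] (mod m)"
    using f2 xs by blast
  ultimately have "[sd w1 xs - sd w2 xs = f xs - f xs] (mod m)"
    by (rule cong_diff[OF cong_sym cong_sym])
  then show "[sd (\<lambda>ys. w1 ys - w2 ys) xs = 0] (mod m)"
    by (simp add: sd_diff)
qed

lemma acyclic_in_Un:
  assumes K: "face_closed K1" "face_closed K2"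
    and "acyclic_in m K1 (Suc q)" "acyclic_in m K2 (Suc q)" "acyclic_in m (K1 \<inter> K2) q"
  shows "acyclic_in m (K1 \<union> K2) (Suc q)"
  unfolding acyclic_in_def
proof (intro allI impI)
  fix f :: "'a list \<Rightarrow> int"
  assume f: "\<forall>xs\<in>K1 \<union> K2. length xs = Suc (Suc q) \<longrightarrow> [sd f xs = 0] (mod m)"
  obtain w1 where w1: "\<forall>xs\<in>K1. length xs = Suc q \<longrightarrow> [f xs = sd w1 xs] (mod m)"
    using assms(3) f unfolding acyclic_in_def by blast
  obtain w2 where w2: "\<forall>xs\<in>K2. length xs = Suc q \<longrightarrow> [f xs = sd w2 xs] (mod m)"
    using assms(4) f unfolding acyclic_in_def by blast
  obtain u where "\<forall>xs\<in>K1 \<inter> K2. length xs = q \<longrightarrow> [w1 xs - w2 xs = sd u xs] (mod m)"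
    using assms(5) mv_cocycle[OF K w1 w2] unfolding acyclic_in_def by blast
  then show "\<exists>w. \<forall>xs\<in>K1 \<union> K2. length xs = Suc q \<longrightarrow> [f xs = sd w xs] (mod m)"
    by (rule mv_glue[OF K w1 w2])
qed

lemma rank_le_one_in_Un:
  assumes K: "face_closed K1" "face_closed K2"
    and "acyclic_in m K1 (Suc q)" "acyclic_in m K2 (Suc q)" "rank_le_one_in m (K1 \<inter> K2) q"
  shows "rank_le_one_in m (K1 \<union> K2) (Suc q)"
  unfolding rank_le_one_in_def
proof (intro allI impI)
  fix f f' :: "'a list \<Rightarrow> int"
  assume f: "\<forall>xs\<in>K1 \<union> K2. length xs = Suc (Suc q) \<longrightarrow> [sd f xs = 0] (mod m)"
    and f': "\<forall>xs\<in>K1 \<union> K2. length xs = Suc (Suc q) \<longrightarrow> [sd f' xs = 0] (mod m)"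
  obtain w1 where w1: "\<forall>xs\<in>K1. length xs = Suc q \<longrightarrow> [f xs = sd w1 xs] (mod m)"
    using assms(3) f unfolding acyclic_in_def by blast
  obtain w2 where w2: "\<forall>xs\<in>K2. length xs = Suc q \<longrightarrow> [f xs = sd w2 xs] (mod m)"
    using assms(4) f unfolding acyclic_in_def by blast
  obtain w1' where w1': "\<forall>xs\<in>K1. length xs = Suc q \<longrightarrow> [f' xs = sd w1' xs] (mod m)"
    using assms(3) f' unfolding acyclic_in_def by blast
  obtain w2' where w2': "\<forall>xs\<in>K2. length xs = Suc q \<longrightarrow> [f' xs = sd w2' xs] (mod m)"
    using assms(4) f' unfolding acyclic_in_def by blast
  note assms(5)[unfolded rank_le_one_in_def, THEN spec, THEN spec, THEN mp, THEN mp,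
      OF mv_cocycle[OF K w1 w2] mv_cocycle[OF K w1' w2']]
  then obtain a b u where ab: "\<not> (m dvd a \<and> m dvd b)" and u:
      "\<forall>xs\<in>K1 \<inter> K2. length xs = q \<longrightarrow>
         [a * (w1 xs - w2 xs) + b * (w1' xs - w2' xs) = sd u xs] (mod m)"
    by blast
  have comb: "[a * f xs + b * f' xs = sd (\<lambda>ys. a * w ys + b * w' ys) xs] (mod m)"
    if "[f xs = sd w xs] (mod m)" "[f' xs = sd w' xs] (mod m)" for w w' xs
    unfolding sd_add sd_mult using that by (intro cong_add cong_scalar_left)
  have "\<exists>w. \<forall>xs\<in>K1 \<union> K2. length xs = Suc q \<longrightarrow> [a * f xs + b * f' xs = sd w xs] (mod m)"
  proof (rule mv_glue[OF K])
    show "\<forall>xs\<in>K1. length xs = Suc q \<longrightarrow>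
        [a * f xs + b * f' xs = sd (\<lambda>ys. a * w1 ys + b * w1' ys) xs] (mod m)"
      using w1 w1' comb by blast
    show "\<forall>xs\<in>K2. length xs = Suc q \<longrightarrow>
        [a * f xs + b * f' xs = sd (\<lambda>ys. a * w2 ys + b * w2' ys) xs] (mod m)"
      using w2 w2' comb by blast
    have "a * w1 xs + b * w1' xs - (a * w2 xs + b * w2' xs)
        = a * (w1 xs - w2 xs) + b * (w1' xs - w2' xs)" for xs
      by (simp add: right_diff_distrib)
    then show "\<forall>xs\<in>K1 \<inter> K2. length xs = q \<longrightarrow>
        [a * w1 xs + b * w1' xs - (a * w2 xs + b * w2' xs) = sd u xs] (mod m)"
      using u by simp
  qed
  then obtain w where "\<forall>xs\<in>K1 \<union> K2. length xs = Suc q \<longrightarrow> [a * f xs + b * f' xs = sd w xs] (mod m)" ..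
  then show "\<exists>a b w. \<not> (m dvd a \<and> m dvd b) \<and>
      (\<forall>xs\<in>K1 \<union> K2. length xs = Suc q \<longrightarrow> [a * f xs + b * f' xs = sd w xs] (mod m))"
    by (intro exI conjI) (use ab in assumption)+
qed

text \<open>
  The order complex of the poset \<open>X\<close>, with degenerate simplices: chains may repeat members, so
  monotone maps of posets send chains to chains.
\<close>

definition chains :: "'a set set \<Rightarrow> 'a set list set" where
  "chains X = {xs. sorted_wrt (\<subseteq>) xs \<and> set xs \<subseteq> X}"

lemma face_closed_chains: "face_closed (chains X)"
  by (auto simp: face_closed_def chains_def sorted_wrt_append)

lemma chains_map:
  assumes "xs \<in> chains X" "\<And>\<sigma>. \<sigma> \<in> X \<Longrightarrow> \<phi> \<sigma> \<in> Y" "\<And>\<sigma> \<tau>. \<sigma> \<subseteq> \<tau> \<Longrightarrow> \<phi> \<sigma> \<subseteq> \<phi> \<tau>"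
  shows "map \<phi> xs \<in> chains Y"
proof -
  have "sorted_wrt (\<lambda>x y. \<phi> x \<subseteq> \<phi> y) xs"
    by (rule sorted_wrt_mono_rel[of xs "(\<subseteq>)"]) (use assms in \<open>auto simp: chains_def\<close>)
  then show ?thesis
    using assms(1,2) by (auto simp: chains_def sorted_wrt_map)
qed

lemma chains_append:
  "xs @ ys \<in> chains X \<longleftrightarrow> xs \<in> chains X \<and> ys \<in> chains X \<and> (\<forall>x\<in>set xs. \<forall>y\<in>set ys. x \<subseteq> y)"
  by (auto simp: chains_def sorted_wrt_append)

lemma chains_Cons: "x # xs \<in> chains X \<longleftrightarrow> x \<in> X \<and> xs \<in> chains X \<and> (\<forall>y\<in>set xs. x \<subseteq> y)"
  by (auto simp: chains_def)

text \<open>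
  The inclusions \<open>\<sigma> \<subseteq> insert a \<sigma> \<supseteq> {a}\<close> contract the poset: the prism over \<open>insert a\<close> moves every
  chain into the star of \<open>{a}\<close>, where the cone with apex \<open>{a}\<close> provides primitives.
\<close>

lemma acyclic_in_cone:
  assumes a: "{a} \<in> X" and X: "\<And>\<sigma>. \<sigma> \<in> X \<Longrightarrow> insert a \<sigma> \<in> X"
  shows "acyclic_in m (chains X) q"
  unfolding acyclic_in_def
proof (intro allI impI)
  fix f :: "'a set list \<Rightarrow> int"
  assume f: "\<forall>xs\<in>chains X. length xs = Suc q \<longrightarrow> [sd f xs = 0] (mod m)"
  define k where "k = (\<lambda>xs. f ({a} # map (insert a) xs))"
  have "[f xs = sd (\<lambda>ys. k ys - prism (insert a) f ys) xs] (mod m)"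
    if xs: "xs \<in> chains X" "length xs = q" for xs
  proof -
    have map_chain: "map (insert a) ys \<in> chains X" if "ys \<in> chains X" for ys
      using that by (rule chains_map) (use X in auto)
    have "{a} # map (insert a) xs \<in> chains X"
      using map_chain[OF xs(1)] a by (auto simp: chains_Cons)
    then have 1: "[sd f ({a} # map (insert a) xs) = 0] (mod m)"
      using f xs(2) by (simp del: sd.simps)
    have 2: "sd k xs = f (map (insert a) xs) - sd f ({a} # map (insert a) xs)"
      unfolding k_def using sd_map[of "\<lambda>ys. f ({a} # ys)" "insert a" xs] by simp
    have 3: "[prism (insert a) (sd f) xs = 0] (mod m)"
    proof (rule prism_cong_zero)
      fix as b bs assume e: "xs = as @ b # bs"
      have ch: "as \<in> chains X" "b \<in> X" "b # bs \<in> chains X" "\<forall>x\<in>set as. \<forall>y\<in>set (b # bs). x \<subseteq> y"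
          "\<forall>y\<in>set bs. b \<subseteq> y"
        using xs(1) unfolding e chains_append by (auto simp: chains_Cons)
      have "as @ b # map (insert a) (b # bs) \<in> chains X"
        unfolding chains_append chains_Cons
        using ch map_chain[OF ch(3)] by auto
      then show "[sd f (as @ b # map (insert a) (b # bs)) = 0] (mod m)"
        using f xs(2) e by simp
    qed
    have "f xs - sd (\<lambda>ys. k ys - prism (insert a) f ys) xs
        = sd f ({a} # map (insert a) xs) - prism (insert a) (sd f) xs"
      using prism_homotopy[of "insert a" f xs] 2 by (simp add: sd_diff)
    then show ?thesis
      using cong_diff[OF 1 3] by (simp only: cong_iff_dvd_diff diff_zero)
  qed
  then show "\<exists>w. \<forall>xs\<in>chains X. length xs = q \<longrightarrow> [f xs = sd w xs] (mod m)"
    by blast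
qed

section \<open>Spheres as posets of faces\<close>

text \<open>
  The proper faces of the join, over all fibres of \<open>\<pi>\<close>, of the boundaries of the simplices that
  the fibres span. The join is a sphere of dimension \<open>card V - card (\<pi> ` V) - 1\<close>.
\<close>

definition faces :: "('a \<Rightarrow> 'b) \<Rightarrow> 'a set \<Rightarrow> 'a set set" where
  "faces \<pi> V = {\<sigma>. \<sigma> \<subseteq> V \<and> \<sigma> \<noteq> {} \<and> (\<forall>v\<in>V. \<exists>u\<in>V. \<pi> u = \<pi> v \<and> u \<notin> \<sigma>)}"

lemma chains_le_last:
  assumes "xs \<in> chains X" "\<sigma> \<in> set xs"
  shows "\<sigma> \<subseteq> last xs"
proof -
  have "xs \<noteq> []"
    using assms(2) by auto
  then have "butlast xs @ [last xs] \<in> chains X"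
    using assms(1) by simp
  then have "\<forall>x\<in>set (butlast xs). x \<subseteq> last xs"
    unfolding chains_append by simp
  moreover have "set xs = insert (last xs) (set (butlast xs))"
    using arg_cong[OF append_butlast_last_id[OF \<open>xs \<noteq> []\<close>], of set] by simp
  ultimately show ?thesis
    using assms(2) by auto
qed

text \<open>
  Deleting \<open>b\<close> from \<open>V\<close> desuspends the sphere. The faces without \<open>b\<close> form a cone with apex \<open>a\<close>,
  and the faces to which \<open>b\<close> can be added form a cone with apex \<open>b\<close>; both cones together cover all
  chains and meet in the sphere of \<open>V - {b}\<close>.
\<close>

lemma faces_decompose:
  assumes ab: "a \<in> V" "b \<in> V" "a \<noteq> b" "\<pi> a = \<pi> b"
  obtains K1 K2 where "face_closed K1" "face_closed K2"
    "chains (faces \<pi> V) = K1 \<union> K2" "chains (faces \<pi> (V - {b})) = K1 \<inter> K2"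
    "\<And>m q. acyclic_in m K1 q" "\<And>m q. acyclic_in m K2 q"
proof -
  define Y where "Y = {\<sigma> \<in> faces \<pi> V. b \<notin> \<sigma>}"
  define Z where "Z = {\<sigma>. \<sigma> \<subseteq> V \<and> \<sigma> \<noteq> {} \<and> (\<forall>v\<in>V - {b}. \<exists>u\<in>V - {b}. \<pi> u = \<pi> v \<and> u \<notin> \<sigma>)}"
  have ZF: "Z \<subseteq> faces \<pi> V"
  proof
    fix \<sigma> assume s: "\<sigma> \<in> Z"
    have "\<exists>u\<in>V. \<pi> u = \<pi> v \<and> u \<notin> \<sigma>" if "v \<in> V" for v
    proof (cases "v = b")
      case True
      have "\<exists>u\<in>V - {b}. \<pi> u = \<pi> a \<and> u \<notin> \<sigma>"
        using s ab(1,3) unfolding Z_def by blast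
      then show ?thesis
        using True ab(4) by auto
    next
      case False
      then have "\<exists>u\<in>V - {b}. \<pi> u = \<pi> v \<and> u \<notin> \<sigma>"
        using s that unfolding Z_def by blast
      then show ?thesis
        by blast
    qed
    then show "\<sigma> \<in> faces \<pi> V"
      using s by (simp add: Z_def faces_def)
  qed
  have YZ: "Y \<inter> Z = faces \<pi> (V - {b})"
  proof (intro equalityI subsetI)
    fix \<sigma> assume "\<sigma> \<in> Y \<inter> Z"
    then show "\<sigma> \<in> faces \<pi> (V - {b})"
      unfolding Y_def Z_def faces_def by blast
  next
    fix \<sigma> assume s: "\<sigma> \<in> faces \<pi> (V - {b})"
    then have "\<sigma> \<in> Z"
      unfolding Z_def faces_def by blast
    moreover have "b \<notin> \<sigma>"
      using s unfolding faces_def by blast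
    ultimately show "\<sigma> \<in> Y \<inter> Z"
      using ZF unfolding Y_def by blast
  qed
  have "chains (faces \<pi> V) = chains Y \<union> chains Z"
  proof (intro equalityI subsetI)
    fix xs assume xs: "xs \<in> chains (faces \<pi> V)"
    \<comment> \<open>If some member contains \<open>b\<close>, the largest one does, so the point of a fibre that the
      largest one misses is never \<open>b\<close>; it serves for all smaller members too.\<close>
    show "xs \<in> chains Y \<union> chains Z"
    proof (cases "\<exists>\<sigma>\<in>set xs. b \<in> \<sigma>")
      case False
      then show ?thesis
        using xs by (auto simp: chains_def Y_def)
    next
      case True
      then have bl: "b \<in> last xs"
        using chains_le_last[OF xs] by blast
      have "last xs \<in> faces \<pi> V"
      proof -
        have "xs \<noteq> []"
          using True by auto
        then have "last xs \<in> set xs"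
          by simp
        then show ?thesis
          using xs by (auto simp: chains_def)
      qed
      then have L: "\<exists>u\<in>V - {b}. \<pi> u = \<pi> v \<and> u \<notin> last xs" if "v \<in> V" for v
        using that bl unfolding faces_def by blast
      have "\<sigma> \<in> Z" if "\<sigma> \<in> set xs" for \<sigma>
      proof -
        have "\<sigma> \<in> faces \<pi> V"
          using xs that by (auto simp: chains_def)
        then show ?thesis
          using L chains_le_last[OF xs that] unfolding Z_def faces_def by blast
      qed
      then show ?thesis
        using xs by (auto simp: chains_def)
    qed
  next
    fix xs assume "xs \<in> chains Y \<union> chains Z"
    then show "xs \<in> chains (faces \<pi> V)"
      using ZF by (auto simp: chains_def Y_def)
  qed
  moreover have "chains Y \<inter> chains Z = chains (faces \<pi> (V - {b}))"
    unfolding YZ[symmetric] by (auto simp: chains_def)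
  moreover have "acyclic_in m (chains Y) q" for m q
  proof (rule acyclic_in_cone)
    have "\<exists>u\<in>V. \<pi> u = \<pi> v \<and> u \<notin> {a}" if "v \<in> V" for v
      using that ab by (cases "v = a") auto
    then show "{a} \<in> Y"
      using ab by (auto simp: Y_def faces_def)
    fix \<sigma> assume s: "\<sigma> \<in> Y"
    have "\<exists>u\<in>V. \<pi> u = \<pi> v \<and> u \<notin> insert a \<sigma>" if "v \<in> V" for v
    proof (cases "\<pi> v = \<pi> a")
      case True
      then show ?thesis
        using ab s by (intro bexI[of _ b]) (auto simp: Y_def)
    next
      case False
      moreover obtain u where "u \<in> V" "\<pi> u = \<pi> v" "u \<notin> \<sigma>"
        using s \<open>v \<in> V\<close> unfolding Y_def faces_def by blast
      ultimately show ?thesis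
        by (intro bexI[of _ u]) auto
    qed
    then show "insert a \<sigma> \<in> Y"
      using s ab by (auto simp: Y_def faces_def)
  qed
  moreover have "acyclic_in m (chains Z) q" for m q
  proof (rule acyclic_in_cone)
    show "{b} \<in> Z"
      using ab by (auto simp: Z_def)
    fix \<sigma> assume s: "\<sigma> \<in> Z"
    then have "\<exists>u\<in>V - {b}. \<pi> u = \<pi> v \<and> u \<notin> insert b \<sigma>" if "v \<in> V - {b}" for v
      using that unfolding Z_def by blast
    then show "insert b \<sigma> \<in> Z"
      using s ab(2) unfolding Z_def by blast
  qed
  ultimately show ?thesis
    using that[of "chains Y" "chains Z"] by (simp add: face_closed_chains)
qed

text \<open>
  By induction on \<open>V\<close>: each point that shares its fibre with another one contributes a suspension,
  which shifts the cohomology by one. When no two points share a fibre there are no faces, and the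
  only chain is \<open>[]\<close>: the empty complex is the sphere of dimension \<open>- 1\<close>.
\<close>

theorem cohomology_of_faces:
  fixes V :: "'a set"
  assumes "finite V" and m: "\<not> m dvd 1"
  shows "(\<forall>q < card V - card (\<pi> ` V). acyclic_in m (chains (faces \<pi> V)) q)
    \<and> rank_le_one_in m (chains (faces \<pi> V)) (card V - card (\<pi> ` V))"
  using assms(1)
proof (induction "card V" arbitrary: V rule: less_induct)
  case less
  show ?case
  proof (cases "inj_on \<pi> V")
    case True
    have "faces \<pi> V = {}"
      using True unfolding faces_def inj_on_def by blast
    then have K: "chains (faces \<pi> V) = {[]}"
      by (auto simp: chains_def)
    have "rank_le_one_in m ({[]} :: 'a set list set) 0"
      unfolding rank_le_one_in_def
    proof (intro allI impI)
      fix f f' :: "'a set list \<Rightarrow> int"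
      show "\<exists>a b w. \<not> (m dvd a \<and> m dvd b) \<and>
          (\<forall>xs\<in>{[]}. length xs = 0 \<longrightarrow> [a * f xs + b * f' xs = sd w xs] (mod m))"
      proof (cases "m dvd f []")
        case True
        then show ?thesis
          using m by (intro exI[of _ 1] exI[of _ 0]) (simp add: cong_0_iff)
      next
        case False
        then show ?thesis
          by (intro exI[of _ "f' []"] exI[of _ "- f []"]) (simp add: mult.commute)
      qed
    qed
    then show ?thesis
      using K card_image[OF True] by simp
  next
    case False
    then obtain a b where ab: "a \<in> V" "b \<in> V" "a \<noteq> b" "\<pi> a = \<pi> b"
      unfolding inj_on_def by blast
    define D where "D = card (V - {b}) - card (\<pi> ` (V - {b}))"
    have im: "\<pi> ` (V - {b}) = \<pi> ` V"
      using ab by (auto simp: image_iff) (metis DiffI singletonD)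
    have c: "card V = Suc (card (V - {b}))"
      using less.prems ab(2) by (metis card_Suc_Diff1)
    have "card (\<pi> ` V) \<le> card (V - {b})"
      using im less.prems by (metis card_image_le finite_Diff)
    then have D: "card V - card (\<pi> ` V) = Suc D"
      using c im by (simp add: D_def)
    obtain K1 K2 where K: "face_closed K1" "face_closed K2"
        "chains (faces \<pi> V) = K1 \<union> K2" "chains (faces \<pi> (V - {b})) = K1 \<inter> K2"
        and ac: "\<And>q. acyclic_in m K1 q" "\<And>q. acyclic_in m K2 q"
      using faces_decompose[OF ab] by metis
    have IH: "\<forall>q < D. acyclic_in m (K1 \<inter> K2) q" "rank_le_one_in m (K1 \<inter> K2) D"
      using less.hyps[of "V - {b}"] less.prems c K(4) by (auto simp: D_def)
    have "acyclic_in m (K1 \<union> K2) q" if "q < Suc D" for q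
    proof (cases q)
      case 0
      have "{a} \<in> faces \<pi> V"
      proof -
        have "\<exists>u\<in>V. \<pi> u = \<pi> v \<and> u \<notin> {a}" if "v \<in> V" for v
          using that ab by (cases "v = a") auto
        then show ?thesis
          using ab by (auto simp: faces_def)
      qed
      then have "[{a}] \<in> K1 \<union> K2"
        unfolding K(3)[symmetric] by (simp add: chains_def)
      then show ?thesis
        unfolding acyclic_in_def 0 by (force simp: cong_0_iff)
    next
      case (Suc r)
      then show ?thesis
        using IH that ac K by (simp add: acyclic_in_Un)
    qed
    moreover have "rank_le_one_in m (K1 \<union> K2) (Suc D)"
      using IH ac K by (simp add: rank_le_one_in_Un)
    ultimately show ?thesis
      using D K(3) by simp
  qed
qed

lemma card_face_le:
  assumes "finite V" "\<sigma> \<in> faces \<pi> V"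
  shows "card \<sigma> \<le> card V - card (\<pi> ` V)"
proof -
  have sub: "\<sigma> \<subseteq> V" and "finite \<sigma>"
    using assms finite_subset by (auto simp: faces_def)
  have "\<pi> ` V \<subseteq> \<pi> ` (V - \<sigma>)"
  proof
    fix x assume "x \<in> \<pi> ` V"
    then obtain v where "v \<in> V" "x = \<pi> v"
      by blast
    moreover have "\<forall>v\<in>V. \<exists>u\<in>V. \<pi> u = \<pi> v \<and> u \<notin> \<sigma>"
      using assms(2) by (simp add: faces_def)
    ultimately obtain u where "u \<in> V" "\<pi> u = x" "u \<notin> \<sigma>"
      by blast
    then show "x \<in> \<pi> ` (V - \<sigma>)"
      by blast
  qed
  then have "card (\<pi> ` V) \<le> card (\<pi> ` (V - \<sigma>))"
    using assms(1) by (intro card_mono) auto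
  also have "\<dots> \<le> card (V - \<sigma>)"
    using assms(1) by (intro card_image_le) auto
  also have "\<dots> = card V - card \<sigma>"
    using sub \<open>finite \<sigma>\<close> by (rule card_Diff_subset[rotated])
  finally show ?thesis
    using card_mono[OF assms(1) sub] by linarith
qed

text \<open>
  The dimension of the sphere bounds the length of strictly increasing chains. Cochains that vanish
  on lists with two equal neighbours therefore vanish on all chains that are longer than the bound.
\<close>

lemma chain_repeats:
  assumes "xs \<in> chains (faces \<pi> V)" "finite V" "card V - card (\<pi> ` V) < length xs"
  shows "\<exists>as b bs. xs = as @ b # b # bs"
proof (rule ccontr)
  assume no: "\<not> ?thesis"
  have "i < length xs \<Longrightarrow> i < card (xs ! i)" for i
  proof (induction i)
    case 0
    then have "xs ! 0 \<in> faces \<pi> V"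
      using assms(1) nth_mem[of 0 xs] by (auto simp: chains_def)
    then show ?case
      using assms(2) by (auto simp: faces_def card_gt_0_iff finite_subset)
  next
    case (Suc i)
    have "xs = take i xs @ xs ! i # xs ! Suc i # drop (Suc (Suc i)) xs"
      using Suc.prems by (simp add: Cons_nth_drop_Suc)
    then have "xs ! i \<noteq> xs ! Suc i"
      using no by metis
    moreover have "xs ! i \<subseteq> xs ! Suc i"
      using assms(1) Suc.prems by (auto simp: chains_def sorted_wrt_iff_nth_less)
    moreover have "finite (xs ! Suc i)"
    proof -
      have "xs ! Suc i \<in> faces \<pi> V"
        using assms(1) Suc.prems nth_mem[of "Suc i" xs] by (auto simp: chains_def)
      then show ?thesis
        using assms(2) by (auto simp: faces_def finite_subset)
    qed
    ultimately have "card (xs ! i) < card (xs ! Suc i)"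
      by (intro psubset_card_mono) auto
    then show ?case
      using Suc by simp
  qed
  then have "length xs - 1 < card (xs ! (length xs - 1))"
    using assms(3) by simp
  moreover have "xs ! (length xs - 1) \<in> faces \<pi> V"
    using assms(1,3) nth_mem[of "length xs - 1" xs] by (auto simp: chains_def)
  ultimately show False
    using card_face_le[OF assms(2), of "xs ! (length xs - 1)" \<pi>] assms(3) by linarith
qed

section \<open>The double complex of a free cyclic action\<close>

lemma sd_swap: "sd (\<lambda>ys. sd (\<lambda>hs. F hs ys) gs) xs = sd (\<lambda>hs. sd (F hs) xs) gs"
proof (induction xs arbitrary: F)
  case (Cons x xs)
  then show ?case
    by (simp add: sd_diff)
qed (simp add: sd_zero)

text \<open>
  The two alternating maps of the periodic resolution of the cyclic group generated by \<open>s\<close>: the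
  norm \<open>1 + s + \<dots> + s\<^bsup>p-1\<^esup>\<close> for odd \<open>k\<close> and \<open>1 - s\<close> for even \<open>k\<close>.
\<close>

definition Eop :: "nat \<Rightarrow> ('x \<Rightarrow> 'x) \<Rightarrow> nat \<Rightarrow> ('x list \<Rightarrow> int) \<Rightarrow> 'x list \<Rightarrow> int" where
  "Eop p s k f xs = (if odd k then (\<Sum>i<p. f (map (s ^^ i) xs)) else f xs - f (map s xs))"

lemma Eop_cong_mod:
  assumes "\<And>i. [f (map (s ^^ i) xs) = g (map (s ^^ i) xs)] (mod m)"
  shows "[Eop p s k f xs = Eop p s k g xs] (mod m)"
proof (cases "odd k")
  case True
  then show ?thesis
    using assms by (auto simp: Eop_def intro: cong_sum)
next
  case False
  then show ?thesis
    using assms[of 0] assms[of 1] by (auto simp: Eop_def intro!: cong_diff)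
qed

lemma Eop_cong:
  assumes "\<And>i. f (map (s ^^ i) xs) = g (map (s ^^ i) xs)"
  shows "Eop p s k f xs = Eop p s k g xs"
  using Eop_cong_mod[of f s xs g 0 p k] assms by (simp add: cong_0)

lemma Eop_zero: "Eop p s k (\<lambda>_. 0) xs = 0"
  by (simp add: Eop_def)

lemma Eop_cong_zero:
  assumes "\<And>i. [f (map (s ^^ i) xs) = 0] (mod m)"
  shows "[Eop p s k f xs = 0] (mod m)"
  using Eop_cong_mod[of f s xs "\<lambda>_. 0" m p k] assms by (simp add: Eop_zero)

lemma Eop_add: "Eop p s k (\<lambda>ys. f ys + g ys) xs = Eop p s k f xs + Eop p s k g xs"
  by (simp add: Eop_def sum.distrib)

lemma Eop_diff: "Eop p s k (\<lambda>ys. f ys - g ys) xs = Eop p s k f xs - Eop p s k g xs"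
  by (simp add: Eop_def sum_subtractf)

lemma Eop_uminus: "Eop p s k (\<lambda>ys. - f ys) xs = - Eop p s k f xs"
  by (simp add: Eop_def sum_negf)

lemma Eop_mult: "Eop p s k (\<lambda>ys. a * f ys) xs = a * Eop p s k f xs"
  by (simp add: Eop_def sum_distrib_left right_diff_distrib)

lemmas Eop_linear = Eop_add Eop_diff Eop_uminus Eop_mult Eop_zero

lemma Eop_swap: "Eop p s k (\<lambda>ys. sd (\<lambda>hs. F hs ys) gs) xs = sd (\<lambda>hs. Eop p s k (F hs) xs) gs"
  by (simp add: Eop_def sd_sum sd_diff)

lemma sd_Eop: "sd (Eop p s k f) xs = Eop p s k (sd f) xs"
  unfolding Eop_def[abs_def] by (cases "odd k") (simp_all add: sd_sum sd_diff sd_map)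

lemma Eop_Suc_Suc: "Eop p s (Suc (Suc k)) = Eop p s k"
  by (simp add: Eop_def fun_eq_iff)

lemma Eop_Eop:
  assumes "\<And>y. y \<in> set xs \<Longrightarrow> (s ^^ p) y = y"
  shows "Eop p s (Suc k) (Eop p s k f) xs = 0"
proof -
  have tel: "(\<Sum>i<p. f (map (s ^^ Suc i) xs) - f (map (s ^^ i) xs)) = 0"
  proof -
    have "map (s ^^ p) xs = xs"
      using assms by (simp add: map_idI)
    then show ?thesis
      using sum_lessThan_telescope[of "\<lambda>i. f (map (s ^^ i) xs)" p] by simp
  qed
  show ?thesis
  proof (cases "odd k")
    case True
    have "map (s ^^ i) (map s xs) = map (s ^^ Suc i) xs" for i
      by (simp add: funpow_swap1)
    then have "(\<Sum>i<p. f (map (s ^^ i) (map s xs))) = (\<Sum>i<p. f (map (s ^^ Suc i) xs))"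
      by (simp only:)
    then show ?thesis
      using True tel by (simp add: Eop_def sum_subtractf del: map_map funpow.simps)
  next
    case False
    have "map s (map (s ^^ i) xs) = map (s ^^ Suc i) xs" for i
      by simp
    then have "(\<Sum>i<p. f (map s (map (s ^^ i) xs))) = (\<Sum>i<p. f (map (s ^^ Suc i) xs))"
      by (simp only:)
    then show ?thesis
      using False tel by (simp add: Eop_def sum_subtractf del: map_map funpow.simps)
  qed
qed

lemma Eop_Eop':
  assumes "\<And>y. y \<in> set xs \<Longrightarrow> (s ^^ p) y = y"
  shows "Eop p s k (Eop p s (Suc k) f) xs = 0"
  using Eop_Eop[where k = "Suc k" and f = f, OF assms] by (simp add: Eop_Suc_Suc)

text \<open>
  Cochains on lists of length \<open>l\<close>, placed at position \<open>k\<close> of the periodic resolution, form a double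
  complex with differentials \<open>sd\<close> (raising \<open>l\<close>) and \<open>Eop\<close> (lowering \<open>k\<close>). Both lower the level
  \<open>i = k - l\<close> by one. An element of level \<open>i\<close> is a function of lists of all lengths, and \<open>Dh\<close> at
  \<open>i\<close> is the total differential from level \<open>i\<close> to level \<open>i - 1\<close>.
\<close>

definition Dh :: "nat \<Rightarrow> ('x \<Rightarrow> 'x) \<Rightarrow> nat \<Rightarrow> ('x list \<Rightarrow> int) \<Rightarrow> 'x list \<Rightarrow> int" where
  "Dh p s i x xs = sd x xs + (- 1) ^ length xs * Eop p s (i + length xs) x xs"

lemma Dh_add: "Dh p s i (\<lambda>ys. f ys + g ys) xs = Dh p s i f xs + Dh p s i g xs"
  by (simp add: Dh_def sd_add Eop_add algebra_simps)

lemma Dh_diff: "Dh p s i (\<lambda>ys. f ys - g ys) xs = Dh p s i f xs - Dh p s i g xs"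
  by (simp add: Dh_def sd_diff Eop_diff algebra_simps)

lemma Dh_mult: "Dh p s i (\<lambda>ys. a * f ys) xs = a * Dh p s i f xs"
  by (simp add: Dh_def sd_mult Eop_mult algebra_simps)

lemma Dh_zero: "Dh p s i (\<lambda>_. 0) xs = 0"
  by (simp add: Dh_def sd_zero Eop_zero)

lemma Dh_swap: "Dh p s i (\<lambda>ys. sd (\<lambda>hs. F hs ys) gs) xs = sd (\<lambda>hs. Dh p s i (F hs) xs) gs"
  unfolding Dh_def sd_add sd_mult Eop_swap using sd_swap[of F gs xs] by simp

lemma Dh_Dh:
  assumes "\<And>y. y \<in> set xs \<Longrightarrow> (s ^^ p) y = y"
  shows "Dh p s i (Dh p s (Suc i) x) xs = 0"
proof -
  define l where "l = length xs"
  have 1: "sd (Dh p s (Suc i) x) xs = - ((- 1) ^ l * sd (Eop p s (i + l) x) xs)"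
  proof -
    have "sd (Dh p s (Suc i) x) xs
        = sd (\<lambda>ys. sd x ys + (- 1) ^ (l - 1) * Eop p s (i + l) x ys) xs"
      by (intro sd_cong) (auto simp: Dh_def l_def)
    then show ?thesis
      by (cases xs) (auto simp: sd_add sd_mult sd_sd l_def simp del: sd.simps(2))
  qed
  have 2: "Eop p s (i + l) (Dh p s (Suc i) x) xs = Eop p s (i + l) (sd x) xs"
  proof -
    have "Eop p s (i + l) (Dh p s (Suc i) x) xs
        = Eop p s (i + l) (\<lambda>ys. sd x ys + (- 1) ^ l * Eop p s (Suc (i + l)) x ys) xs"
      by (intro Eop_cong) (auto simp: Dh_def l_def)
    then show ?thesis
      using Eop_Eop'[where k = "i + l" and f = x, OF assms] by (simp add: Eop_linear)
  qed
  show ?thesis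
    unfolding Dh_def[of p s i "Dh p s (Suc i) x"] l_def[symmetric] 1 2 sd_Eop by simp
qed

lemma (in group) tuples_face: "as @ b # bs \<in> tuples G (Suc n) \<Longrightarrow> as @ bs \<in> tuples G n"
  by (auto simp: tuples_def)

lemma (in group) tuples_translate: "g \<in> carrier G \<Longrightarrow> gs \<in> tuples G n \<Longrightarrow> map ((\<otimes>) g) gs \<in> tuples G n"
  by (auto simp: tuples_def)

text \<open>
  A complex \<open>K\<close> with at most the reduced cohomology of a sphere of dimension \<open>D - 1\<close> modulo \<open>p\<close>, with
  an action of \<open>G\<close> and a commuting free action of the cyclic group of order \<open>p\<close> generated by \<open>s\<close>.
  Freeness is expressed by an equivariant label \<open>idx\<close> with values in \<open>\<int>/p\<close>: it marks one member of each orbit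
  as the origin, which makes the primitives below explicit.
\<close>

locale free_sphere_action = group G for G (structure) +
  fixes p D :: nat and X :: "'v set" and K :: "'v list set"
    and s :: "'v \<Rightarrow> 'v" and idx :: "'v \<Rightarrow> nat" and act :: "'a \<Rightarrow> 'v \<Rightarrow> 'v"
  assumes prime_p: "prime p"
    and K_sub: "\<And>xs. xs \<in> K \<Longrightarrow> set xs \<subseteq> X"
    and Nil_K: "[] \<in> K"
    and K_closed: "face_closed K"
    and s_K: "\<And>xs. xs \<in> K \<Longrightarrow> map s xs \<in> K"
    and s_X: "\<And>x. x \<in> X \<Longrightarrow> s x \<in> X"
    and s_p: "\<And>x. x \<in> X \<Longrightarrow> (s ^^ p) x = x"
    and idx: "\<And>x. x \<in> X \<Longrightarrow> idx x < p"
    and idx_s: "\<And>x. x \<in> X \<Longrightarrow> idx (s x) = Suc (idx x) mod p"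
    and act_K: "\<And>g xs. g \<in> carrier G \<Longrightarrow> xs \<in> K \<Longrightarrow> map (act g) xs \<in> K"
    and act_X: "\<And>g x. g \<in> carrier G \<Longrightarrow> x \<in> X \<Longrightarrow> act g x \<in> X"
    and act_one: "\<And>x. x \<in> X \<Longrightarrow> act \<one> x = x"
    and act_mult: "\<And>g h x. g \<in> carrier G \<Longrightarrow> h \<in> carrier G \<Longrightarrow> x \<in> X \<Longrightarrow> act (g \<otimes> h) x = act g (act h x)"
    and act_s: "\<And>g x. g \<in> carrier G \<Longrightarrow> x \<in> X \<Longrightarrow> act g (s x) = s (act g x)"
    and acyc: "\<And>q. q < D \<Longrightarrow> acyclic_in (int p) K q"
    and rank: "rank_le_one_in (int p) K D"
    and repeats: "\<And>xs. xs \<in> K \<Longrightarrow> D < length xs \<Longrightarrow> \<exists>as b bs. xs = as @ b # b # bs"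
begin

lemma s_pow_K: "xs \<in> K \<Longrightarrow> map (s ^^ i) xs \<in> K"
proof (induction i)
  case (Suc i)
  then have "map s (map (s ^^ i) xs) \<in> K"
    by (intro s_K)
  then show ?case
    by (simp add: comp_def)
qed simp

lemma s_p_K: "xs \<in> K \<Longrightarrow> y \<in> set xs \<Longrightarrow> (s ^^ p) y = y"
  using K_sub s_p by blast

lemma K_face: "as @ b # bs \<in> K \<Longrightarrow> as @ bs \<in> K"
  using K_closed unfolding face_closed_def by blast

lemma idx_pow: "x \<in> X \<Longrightarrow> (s ^^ i) x \<in> X \<and> idx ((s ^^ i) x) = (idx x + i) mod p"
proof (induction i)
  case (Suc i)
  then show ?case
    using idx_s[of "(s ^^ i) x"] s_X by (simp add: mod_Suc_eq)
qed (use idx in auto)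

text \<open>
  The columns of the double complex are exact in positive length, because the cochains are
  coinduced from the trivial group. A primitive for the norm is obtained by restricting to lists
  whose head has label \<open>0\<close>, a primitive for \<open>1 - s\<close> by summing along the orbit from the head with
  label \<open>0\<close> to the given one. Both constructions keep the normalisation.
\<close>

lemma Eop_exact:
  assumes h: "\<And>xs. xs \<in> K \<Longrightarrow> length xs = Suc n \<Longrightarrow> Eop p s n h xs = 0"
    and norm: "\<And>as b bs. h (as @ b # b # bs) = 0"
  shows "\<exists>g. (\<forall>xs\<in>K. length xs = Suc n \<longrightarrow> Eop p s (Suc n) g xs = h xs)
    \<and> (\<forall>as b bs. g (as @ b # b # bs) = 0)"
proof (cases "even n")
  case True
  define g where "g = (\<lambda>xs. if idx (hd xs) = 0 then h xs else 0)"
  have "Eop p s (Suc n) g xs = h xs" if xs: "xs \<in> K" "length xs = Suc n" for xs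
  proof -
    have hdX: "hd xs \<in> X" and ne: "xs \<noteq> []"
      using K_sub[OF xs(1)] xs(2) by (cases xs; auto)+
    define r where "r = idx (hd xs)"
    define j where "j = (p - r) mod p"
    have rp: "r < p" "0 < p"
      using idx[OF hdX] prime_p by (auto simp: r_def prime_gt_0_nat)
    have inv: "h (map (s ^^ i) xs) = h xs" for i
    proof (induction i)
      case (Suc i)
      have "Eop p s n h (map (s ^^ i) xs) = 0"
        using s_pow_K[OF xs(1)] xs(2) h by simp
      then show ?case
        using Suc True by (simp add: Eop_def comp_def)
    qed simp
    have "(r + i) mod p = 0 \<longleftrightarrow> i = j" if "i < p" for i
    proof (cases "r = 0")
      case False
      then have j: "j = p - r"
        using rp by (simp add: j_def)
      show ?thesis
      proof (cases "r + i < p")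
        case True
        then show ?thesis using False j by auto
      next
        case le: False
        then have "(r + i) mod p = r + i - p"
          using that rp by (simp add: mod_if)
        then show ?thesis using le j rp by auto
      qed
    qed (use that j_def in auto)
    moreover have "hd (map (s ^^ i) xs) = (s ^^ i) (hd xs)" for i
      using ne by (simp add: hd_map)
    ultimately have "(\<Sum>i<p. g (map (s ^^ i) xs)) = (\<Sum>i<p. if i = j then h xs else 0)"
      using idx_pow[OF hdX] inv by (intro sum.cong) (auto simp: g_def r_def)
    also have "\<dots> = h xs"
      using rp by (simp add: j_def)
    finally show ?thesis
      using True by (simp add: Eop_def)
  qed
  moreover have "g (as @ b # b # bs) = 0" for as b bs
    using norm by (simp add: g_def)
  ultimately show ?thesis
    by blast
next
  case False
  define g where "g = (\<lambda>xs. - (\<Sum>i<idx (hd xs). h (map (s ^^ (p - idx (hd xs) + i)) xs)))"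
  have "Eop p s (Suc n) g xs = h xs" if xs: "xs \<in> K" "length xs = Suc n" for xs
  proof -
    have hdX: "hd xs \<in> X" and ne: "xs \<noteq> []"
      using K_sub[OF xs(1)] xs(2) by (cases xs; auto)+
    define r where "r = idx (hd xs)"
    have rp: "r < p"
      using idx[OF hdX] by (simp add: r_def)
    have shift: "map (s ^^ i) (map s xs) = map (s ^^ Suc i) xs" for i
      by (simp add: funpow_swap1)
    have per: "map (s ^^ p) xs = xs"
      using s_p_K[OF xs(1)] by (simp add: map_idI)
    have hds: "hd (map s xs) = s (hd xs)"
      using ne by (simp add: hd_map)
    have idxs: "idx (hd (map s xs)) = Suc r mod p"
      using idx_s[OF hdX] hds by (simp add: r_def)
    have gx: "g xs = - (\<Sum>i<r. h (map (s ^^ (p - r + i)) xs))"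
      by (simp add: g_def r_def)
    have "g xs - g (map s xs) = h xs"
    proof (cases "Suc r < p")
      case True
      then have "g (map s xs) = - (\<Sum>i<Suc r. h (map (s ^^ (p - Suc r + i)) (map s xs)))"
        using idxs by (simp add: g_def)
      also have "\<dots> = - (\<Sum>i<Suc r. h (map (s ^^ (p - r + i)) xs))"
        using True by (simp only: shift) (simp add: Suc_diff_Suc)
      finally show ?thesis
        using gx rp per by simp
    next
      case False
      then have r: "Suc r = p"
        using rp by simp
      then have "g (map s xs) = 0"
        using idxs by (simp add: g_def)
      moreover have "(\<Sum>i<p. h (map (s ^^ i) xs)) = 0"
        using h[OF xs] \<open>odd n\<close> by (simp add: Eop_def)
      then have "h xs + (\<Sum>i<r. h (map (s ^^ Suc i) xs)) = 0"
        unfolding r[symmetric] by (subst (asm) sum.lessThan_Suc_shift) simp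
      moreover have "p - r + i = Suc i" for i
        using r by simp
      then have "g xs = - (\<Sum>i<r. h (map (s ^^ Suc i) xs))"
        unfolding gx by (simp only:)
      ultimately show ?thesis
        by simp
    qed
    then show ?thesis
      using False by (simp add: Eop_def)
  qed
  moreover have "g (as @ b # b # bs) = 0" for as b bs
    using norm[of "map _ as" "_ b" "map _ bs"] by (simp add: g_def)
  ultimately show ?thesis
    by blast
qed

lemma sd_repeat:
  assumes "\<And>as b bs. h (as @ b # b # bs) = 0"
  shows "sd h (as @ b # b # bs) = 0"
  using assms
proof (induction as arbitrary: h)
  case Nil
  have "sd (\<lambda>ys. h (b # b # ys)) bs = 0"
    using Nil[of "[]"] by (simp add: sd_zero)
  then show ?case
    by simp
next
  case (Cons a as)
  have "sd (\<lambda>ys. h (a # ys)) (as @ b # b # bs) = 0"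
    using Cons.prems[of "a # _"] by (intro Cons.IH) simp
  then show ?case
    using Cons.prems by simp
qed

text \<open>
  The zigzag that represents the Euler class of the free action: the constant \<open>1\<close> on \<open>[]\<close> is
  extended upwards in the length of the lists, at each step with a primitive for \<open>Eop\<close> of the
  differential of the previous component. Normalisation makes it stop at length \<open>D\<close>.
\<close>

lemma fundamental_element:
  "\<exists>e. e [] = 1 \<and> (\<forall>xs. D < length xs \<longrightarrow> e xs = 0) \<and> (\<forall>xs\<in>K. Dh p s 0 e xs = 0)"
proof -
  have "\<exists>e. e [] = 1 \<and> (\<forall>xs. n < length xs \<longrightarrow> e xs = 0) \<and> (\<forall>as b bs. e (as @ b # b # bs) = 0)
      \<and> (\<forall>xs\<in>K. length xs \<le> n \<longrightarrow> Dh p s 0 e xs = 0)" for n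
  proof (induction n)
    case 0
    show ?case
      by (rule exI[of _ "\<lambda>xs. if xs = [] then 1 else 0"]) (simp add: Dh_def Eop_def)
  next
    case (Suc n)
    then obtain e where e: "e [] = 1" "\<And>xs. n < length xs \<Longrightarrow> e xs = 0"
        "\<And>as b bs. e (as @ b # b # bs) = 0"
        "\<And>xs. xs \<in> K \<Longrightarrow> length xs \<le> n \<Longrightarrow> Dh p s 0 e xs = 0"
      by blast
    \<comment> \<open>the obstruction to \<open>Dh e = 0\<close> at length \<open>n + 1\<close>; it is a cycle for \<open>Eop\<close>\<close>
    define h where "h = (\<lambda>xs. (- 1) ^ n * sd e xs)"
    have "Eop p s n h xs = 0" if xs: "xs \<in> K" "length xs = Suc n" for xs
    proof -
      have "sd (Eop p s n e) xs = sd (\<lambda>ys. - ((- 1) ^ n * sd e ys)) xs"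
      proof (rule sd_cong)
        fix as b bs assume eq: "xs = as @ b # bs"
        then have l: "length (as @ bs) = n"
          using xs(2) by simp
        have "Dh p s 0 e (as @ bs) = 0"
          using xs(1) eq l by (intro e(4)) (auto intro: K_face)
        then have "sd e (as @ bs) = - ((- 1) ^ n * Eop p s n e (as @ bs))"
          unfolding Dh_def l by simp
        then show "Eop p s n e (as @ bs) = - ((- 1) ^ n * sd e (as @ bs))"
          by simp
      qed
      then show ?thesis
        unfolding h_def Eop_mult sd_Eop[symmetric] by (simp add: sd_uminus sd_mult sd_sd)
    qed
    moreover have "h (as @ b # b # bs) = 0" for as b bs
      using sd_repeat[of e, OF e(3)] by (simp add: h_def)
    ultimately obtain g where g: "\<And>xs. xs \<in> K \<Longrightarrow> length xs = Suc n \<Longrightarrow> Eop p s (Suc n) g xs = h xs"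
        "\<And>as b bs. g (as @ b # b # bs) = 0"
      using Eop_exact[of n h] by blast
    define e' where "e' = (\<lambda>xs. if length xs = Suc n then g xs else e xs)"
    have low: "Dh p s 0 e' xs = Dh p s 0 e xs" if "length xs \<le> n" for xs
    proof -
      have "sd e' xs = sd e xs"
        using that by (intro sd_cong) (auto simp: e'_def)
      moreover have "Eop p s (0 + length xs) e' xs = Eop p s (0 + length xs) e xs"
        using that by (intro Eop_cong) (auto simp: e'_def)
      ultimately show ?thesis
        by (simp add: Dh_def)
    qed
    have "Dh p s 0 e' xs = 0" if xs: "xs \<in> K" "length xs = Suc n" for xs
    proof -
      have "sd e' xs = sd e xs"
        using xs(2) by (intro sd_cong) (auto simp: e'_def)
      moreover have "Eop p s (Suc n) e' xs = Eop p s (Suc n) g xs"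
        using xs(2) by (intro Eop_cong) (auto simp: e'_def)
      ultimately show ?thesis
        using g(1)[OF xs] xs(2) by (simp add: Dh_def h_def flip: mult.assoc power_add)
    qed
    then have "\<forall>xs\<in>K. length xs \<le> Suc n \<longrightarrow> Dh p s 0 e' xs = 0"
      using low e(4) by (metis le_Suc_eq)
    moreover have "e' [] = 1" "\<forall>xs. Suc n < length xs \<longrightarrow> e' xs = 0"
        "\<forall>as b bs. e' (as @ b # b # bs) = 0"
      using e g(2) by (auto simp: e'_def)
    ultimately show ?case
      by blast
  qed
  from this[of D] obtain e where e: "e [] = 1" "\<And>xs. D < length xs \<Longrightarrow> e xs = 0"
      "\<And>as b bs. e (as @ b # b # bs) = 0"
      "\<And>xs. xs \<in> K \<Longrightarrow> length xs \<le> D \<Longrightarrow> Dh p s 0 e xs = 0"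
    by blast
  have "Dh p s 0 e xs = 0" if xs: "xs \<in> K" for xs
  proof (cases "length xs \<le> D")
    case False
    then obtain as b bs where "xs = as @ b # b # bs"
      using repeats xs by force
    then have "sd e xs = 0"
      using sd_repeat[of e, OF e(3)] by simp
    moreover have "Eop p s (0 + length xs) e xs = Eop p s (0 + length xs) (\<lambda>_. 0) xs"
      using False e(2) by (intro Eop_cong) auto
    ultimately show ?thesis
      by (simp add: Dh_def Eop_zero)
  qed (use e xs in blast)
  then show ?thesis
    using e by blast
qed

text \<open>
  The rows of the double complex are exact below length \<open>D\<close>. So a cocycle that vanishes above length
  \<open>D - i\<close> is a boundary: its components are removed one after the other, from the longest lists
  downwards. The only component in the critical length \<open>D\<close> occurs at level \<open>0\<close>, where a primitive
  has to be supplied.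
\<close>

lemma Dh_exact:
  assumes supp: "\<And>xs. D < i + length xs \<Longrightarrow> z xs = 0"
    and cocycle: "\<And>xs. xs \<in> K \<Longrightarrow> [Dh p s i z xs = 0] (mod int p)"
    and top: "\<And>xs. i = 0 \<Longrightarrow> xs \<in> K \<Longrightarrow> length xs = D \<Longrightarrow> [z xs = sd w0 xs] (mod int p)"
  shows "\<exists>y. (\<forall>xs. D < Suc i + length xs \<longrightarrow> y xs = 0) \<and>
    (\<forall>xs\<in>K. [z xs = Dh p s (Suc i) y xs] (mod int p))"
proof -
  have "\<exists>y. (\<forall>xs. D < Suc i + length xs \<longrightarrow> y xs = 0) \<and>
    (\<forall>xs\<in>K. D < i + length xs + n \<longrightarrow> [z xs = Dh p s (Suc i) y xs] (mod int p))" for n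
  proof (induction n)
    case 0
    show ?case
      by (rule exI[of _ "\<lambda>_. 0"]) (auto simp: Dh_zero supp)
  next
    case (Suc n)
    then obtain y where y: "\<And>xs. D < Suc i + length xs \<Longrightarrow> y xs = 0"
        "\<And>xs. xs \<in> K \<Longrightarrow> D < i + length xs + n \<Longrightarrow> [z xs = Dh p s (Suc i) y xs] (mod int p)"
      by blast
    show ?case
    proof (cases "i + n \<le> D")
      case False
      then show ?thesis
        using y by (intro exI[of _ y]) auto
    next
      case True
      \<comment> \<open>\<open>l\<close> is the length of the next component to be removed; \<open>n\<close> components are done\<close>
      define l where "l = D - i - n"
      have l: "i + l + n = D"
        using True by (simp add: l_def)
      define z' where "z' = (\<lambda>xs. z xs - Dh p s (Suc i) y xs)"
      have high: "[z' xs = 0] (mod int p)" if "xs \<in> K" "l < length xs" for xs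
        using y(2)[OF that(1)] that(2) l unfolding z'_def by (simp add: cong_diff_iff_cong_0)
      have coc: "[sd z' xs = 0] (mod int p)" if xs: "xs \<in> K" "length xs = Suc l" for xs
      proof -
        have "[Dh p s i z' xs = 0] (mod int p)"
          using cocycle[OF xs(1)] Dh_Dh[where i = i and x = y, OF s_p_K[OF xs(1)]]
          by (simp add: z'_def Dh_diff)
        moreover have "[Eop p s (i + length xs) z' xs = 0] (mod int p)"
          using high s_pow_K[OF xs(1)] xs(2) by (intro Eop_cong_zero) simp
        then have "[(- 1) ^ length xs * Eop p s (i + length xs) z' xs = 0] (mod int p)"
          by (simp add: cong_0_iff)
        ultimately have "[sd z' xs + 0 = 0] (mod int p)"
          unfolding Dh_def by (metis cong_add_lcancel cong_sym cong_trans)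
        then show ?thesis
          by simp
      qed
      have "\<exists>w. \<forall>xs\<in>K. length xs = l \<longrightarrow> [z' xs = sd w xs] (mod int p)"
      proof (cases "n = 0 \<and> i = 0")
        case False
        show ?thesis
        proof (cases "l < D")
          case True
          then show ?thesis
            using acyc coc unfolding acyclic_in_def by blast
        next
          case False
          then show ?thesis
            using \<open>\<not> (n = 0 \<and> i = 0)\<close> l by simp
        qed
      next
        case True
        have "[z' xs = sd (\<lambda>ys. w0 ys - y ys) xs] (mod int p)" if xs: "xs \<in> K" "length xs = l" for xs
        proof -
          have "Eop p s (Suc i + length xs) y xs = Eop p s (Suc i + length xs) (\<lambda>_. 0) xs"
            using y(1) xs(2) l True by (intro Eop_cong) auto
          then have "Dh p s (Suc i) y xs = sd y xs"
            by (simp add: Dh_def Eop_zero)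
          then show ?thesis
            using top[OF _ xs(1)] xs(2) l True by (simp add: z'_def sd_diff cong_diff)
        qed
        then show ?thesis
          by blast
      qed
      then obtain w where w: "\<And>xs. xs \<in> K \<Longrightarrow> length xs = l \<Longrightarrow> [z' xs = sd w xs] (mod int p)"
        by blast
      define y' where "y' = (\<lambda>xs. if Suc (length xs) = l then y xs + w xs else y xs)"
      have "[z xs = Dh p s (Suc i) y' xs] (mod int p)" if xs: "xs \<in> K" "l \<le> length xs" for xs
      proof -
        have E: "Eop p s (Suc i + length xs) y' xs = Eop p s (Suc i + length xs) y xs"
          using xs(2) by (intro Eop_cong) (auto simp: y'_def)
        show ?thesis
        proof (cases "length xs = l")
          case True
          have "sd y' xs = sd (\<lambda>ys. y ys + w ys) xs"
            using True by (intro sd_cong) (auto simp: y'_def)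
          then have "Dh p s (Suc i) y' xs = Dh p s (Suc i) y xs + sd w xs"
            unfolding Dh_def E by (simp add: sd_add)
          moreover have "[z xs - Dh p s (Suc i) y xs = sd w xs] (mod int p)"
            using w[OF xs(1) True] by (simp add: z'_def)
          ultimately show ?thesis
            by (simp add: cong_iff_dvd_diff algebra_simps)
        next
          case False
          have "sd y' xs = sd y xs"
            using False xs(2) by (intro sd_cong) (auto simp: y'_def)
          then have "Dh p s (Suc i) y' xs = Dh p s (Suc i) y xs"
            unfolding Dh_def E by simp
          moreover have "[z xs = Dh p s (Suc i) y xs] (mod int p)"
            using False xs l by (intro y(2)) auto
          ultimately show ?thesis
            by simp
        qed
      qed
      moreover have "y' xs = 0" if "D < Suc i + length xs" for xs
        using y(1)[OF that] that l by (auto simp: y'_def)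
      ultimately show ?thesis
        using l by (intro exI[of _ y']) auto
    qed
  qed
  from this[of "Suc D"] show ?thesis
    by auto
qed

section \<open>Chern classes of an action on a sphere\<close>

definition equivariant :: "nat \<Rightarrow> ('a list \<Rightarrow> 'v list \<Rightarrow> int) \<Rightarrow> bool" where
  "equivariant i F \<longleftrightarrow> (\<forall>g\<in>carrier G. \<forall>gs\<in>tuples G (Suc i). \<forall>xs\<in>K.
     F (map ((\<otimes>) g) gs) (map (act g) xs) = F gs xs)"

definition supported :: "nat \<Rightarrow> ('a list \<Rightarrow> 'v list \<Rightarrow> int) \<Rightarrow> bool" where
  "supported i F \<longleftrightarrow> (\<forall>gs xs. D < i + length xs \<longrightarrow> F gs xs = 0)"

text \<open>
  One step in the comparison of the resolution of \<open>G\<close> by lists of group elements with the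
  exact sequence of levels: \<open>F'\<close> is a primitive, at the next level, of the coboundary of \<open>F\<close>.
\<close>

definition lifts :: "nat \<Rightarrow> ('a list \<Rightarrow> 'v list \<Rightarrow> int) \<Rightarrow> ('a list \<Rightarrow> 'v list \<Rightarrow> int) \<Rightarrow> bool" where
  "lifts i F F' \<longleftrightarrow> (\<forall>gs\<in>tuples G (Suc (Suc i)). \<forall>xs\<in>K.
     [sd (\<lambda>hs. F hs xs) gs = Dh p s (Suc i) (F' gs) xs] (mod int p))"

lemma Nil_level_one: "[Dh p s (Suc 0) y [] = 0] (mod int p)"
  by (simp add: Dh_def Eop_def cong_0_iff)

text \<open>
  At level \<open>0\<close>, the cohomology in the critical length \<open>D\<close> is at most one-dimensional, so some
  combination of \<open>z\<close> with the fundamental element \<open>e\<close> is a boundary. Boundaries vanish on \<open>[]\<close>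
  modulo \<open>p\<close> and \<open>e [] = 1\<close>, so the coefficient of \<open>e\<close> is zero if \<open>z\<close> vanishes on \<open>[]\<close>.
\<close>

lemma Dh_exact_zero:
  assumes supp: "\<And>xs. D < length xs \<Longrightarrow> z xs = 0"
    and cocycle: "\<And>xs. xs \<in> K \<Longrightarrow> [Dh p s 0 z xs = 0] (mod int p)"
    and Nil: "[z [] = 0] (mod int p)"
  shows "\<exists>y. (\<forall>xs. D < Suc 0 + length xs \<longrightarrow> y xs = 0) \<and>
    (\<forall>xs\<in>K. [z xs = Dh p s (Suc 0) y xs] (mod int p))"
proof -
  obtain e where e: "e [] = 1" "\<And>xs. D < length xs \<Longrightarrow> e xs = 0"
      "\<And>xs. xs \<in> K \<Longrightarrow> Dh p s 0 e xs = 0"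
    using fundamental_element by blast
  have top: "[sd x xs = 0] (mod int p)"
    if "\<And>xs. D < length xs \<Longrightarrow> x xs = 0" "[Dh p s 0 x xs = 0] (mod int p)" "length xs = Suc D" for x xs
  proof -
    have "Eop p s (0 + length xs) x xs = Eop p s (0 + length xs) (\<lambda>_. 0) xs"
      using that by (intro Eop_cong) auto
    then show ?thesis
      using that(2) by (simp add: Dh_def Eop_zero)
  qed
  have z0: "\<forall>xs\<in>K. length xs = Suc D \<longrightarrow> [sd z xs = 0] (mod int p)"
    using top[of z] supp cocycle by blast
  have e0: "\<forall>xs\<in>K. length xs = Suc D \<longrightarrow> [sd e xs = 0] (mod int p)"
    using top[of e] e by simp
  note rank[unfolded rank_le_one_in_def, THEN spec, THEN spec, THEN mp, THEN mp, OF z0 e0]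
  then obtain a b w where ab: "\<not> (int p dvd a \<and> int p dvd b)" and
      w: "\<And>xs. xs \<in> K \<Longrightarrow> length xs = D \<Longrightarrow> [a * z xs + b * e xs = sd w xs] (mod int p)"
    by blast
  obtain y where y: "\<And>xs. D < Suc 0 + length xs \<Longrightarrow> y xs = 0"
      "\<And>xs. xs \<in> K \<Longrightarrow> [a * z xs + b * e xs = Dh p s (Suc 0) y xs] (mod int p)"
  proof -
    have "\<exists>y. (\<forall>xs. D < Suc 0 + length xs \<longrightarrow> y xs = 0) \<and>
      (\<forall>xs\<in>K. [a * z xs + b * e xs = Dh p s (Suc 0) y xs] (mod int p))"
    proof (rule Dh_exact[of 0 _ w])
      show "a * z xs + b * e xs = 0" if "D < 0 + length xs" for xs
        using that supp e(2) by simp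
      show "[Dh p s 0 (\<lambda>xs. a * z xs + b * e xs) xs = 0] (mod int p)" if "xs \<in> K" for xs
        using cocycle[OF that] e(3)[OF that] by (simp add: Dh_add Dh_mult cong_0_iff)
      show "[a * z xs + b * e xs = sd w xs] (mod int p)" if "xs \<in> K" "length xs = D" for xs
        using w that by simp
    qed
    then show ?thesis
      using that by blast
  qed
  have "[a * z [] + b * e [] = 0] (mod int p)"
    using y(2)[OF Nil_K] Nil_level_one cong_trans by blast
  then have b: "int p dvd b"
    using Nil e(1) by (simp add: cong_0_iff dvd_add_right_iff)
  then have "\<not> int p dvd a"
    using ab by blast
  moreover have "prime (int p)"
    using prime_p by simp
  ultimately have "coprime (int p) a"
    by (intro prime_imp_coprime)
  then have "coprime a (int p)"
    by (subst coprime_commute)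
  then obtain a' where "[a * a' = 1] (mod int p)"
    using cong_solve_coprime_int by blast
  then have a': "[a' * a = 1] (mod int p)"
    by (simp add: mult.commute)
  have "[z xs = Dh p s (Suc 0) (\<lambda>ys. a' * y ys) xs] (mod int p)" if xs: "xs \<in> K" for xs
  proof -
    have "[a' * Dh p s (Suc 0) y xs = a' * (a * z xs + b * e xs)] (mod int p)"
      using y(2)[OF xs] by (intro cong_scalar_left) (rule cong_sym)
    also have "[a' * (a * z xs + b * e xs) = (a' * a) * z xs] (mod int p)"
      using b by (simp add: cong_iff_dvd_diff algebra_simps)
    also have "[(a' * a) * z xs = 1 * z xs] (mod int p)"
      using a' by (rule cong_scalar_right)
    finally show ?thesis
      by (simp add: Dh_mult cong_sym)
  qed
  then show ?thesis
    using y(1) by (intro exI[of _ "\<lambda>ys. a' * y ys"]) simp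
qed

text \<open>
  At level \<open>0\<close> the system starts with translates of the fundamental element. The values on
  \<open>[]\<close> are the components \<open>a\<^sub>i\<close> of the Euler class in the cohomology of \<open>G\<close>.
\<close>

definition chern_system :: "nat \<Rightarrow> ('a list \<Rightarrow> 'v list \<Rightarrow> int) \<Rightarrow> bool" where
  "chern_system i F \<longleftrightarrow> equivariant i F \<and> supported i F \<and>
     (\<forall>gs\<in>tuples G (Suc (Suc i)). \<forall>xs\<in>K. [Dh p s i (\<lambda>ys. sd (\<lambda>hs. F hs ys) gs) xs = 0] (mod int p)) \<and>
     (i = 0 \<longrightarrow> (\<forall>gs\<in>tuples G 1. F gs [] = 1 \<and> (\<forall>xs\<in>K. Dh p s 0 (F gs) xs = 0)))"

lemma act_s_pow: "g \<in> carrier G \<Longrightarrow> x \<in> X \<Longrightarrow> act g ((s ^^ j) x) = (s ^^ j) (act g x)"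
  by (induction j) (use idx_pow act_s in auto)

lemma Dh_act:
  assumes "g \<in> carrier G" "xs \<in> K"
  shows "Dh p s i (\<lambda>ys. f (map (act g) ys)) xs = Dh p s i f (map (act g) xs)"
proof -
  have a: "map (act g) (map (s ^^ j) xs) = map (s ^^ j) (map (act g) xs)" for j
    using act_s_pow[OF assms(1)] K_sub[OF assms(2)] by auto
  have "map (act g) (map s xs) = map s (map (act g) xs)"
    using act_s[OF assms(1)] K_sub[OF assms(2)] by auto
  then show ?thesis
    by (simp add: Dh_def sd_map Eop_def a del: map_map)
qed

text \<open>
  The fundamental element is translated by the first group element, which makes it equivariant.
\<close>

lemma chern_system_base: "\<exists>F. chern_system 0 F"
proof -
  obtain e where e: "e [] = 1" "\<And>xs. D < length xs \<Longrightarrow> e xs = 0"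
      "\<And>xs. xs \<in> K \<Longrightarrow> Dh p s 0 e xs = 0"
    using fundamental_element by blast
  define F where "F = (\<lambda>gs xs. e (map (act (inv (hd gs))) xs))"
  have F0: "F gs [] = 1" for gs
    by (simp add: F_def e)
  have FD: "Dh p s 0 (F gs) xs = 0" if "gs \<in> tuples G 1" "xs \<in> K" for gs xs
  proof -
    have "inv (hd gs) \<in> carrier G"
      using that(1) by (cases gs) (auto simp: tuples_def)
    then show ?thesis
      unfolding F_def using that(2) e(3) act_K by (simp add: Dh_act)
  qed
  have "equivariant 0 F"
    unfolding equivariant_def
  proof (intro ballI)
    fix g gs xs assume g: "g \<in> carrier G" and gs: "gs \<in> tuples G (Suc 0)" and xs: "xs \<in> K"
    obtain h where h: "gs = [h]" "h \<in> carrier G"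
      using gs by (auto simp: tuples_def length_Suc_conv)
    have "map (act (inv (g \<otimes> h))) (map (act g) xs) = map (act (inv h)) xs"
    proof -
      have "act (inv (g \<otimes> h)) (act g x) = act (inv h) x" if "x \<in> X" for x
        using g h(2) that act_mult[of "inv (g \<otimes> h)" g x] by (simp add: inv_mult_group m_assoc)
      then show ?thesis
        using K_sub[OF xs] by auto
    qed
    then show "F (map ((\<otimes>) g) gs) (map (act g) xs) = F gs xs"
      by (simp add: F_def h del: map_map)
  qed
  moreover have "supported 0 F"
    by (simp add: supported_def F_def e)
  moreover have "[Dh p s 0 (\<lambda>ys. sd (\<lambda>hs. F hs ys) gs) xs = 0] (mod int p)"
    if "gs \<in> tuples G (Suc (Suc 0))" "xs \<in> K" for gs xs
    unfolding Dh_swap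
  proof (rule sd_cong_zero)
    fix as b bs assume "gs = as @ b # bs"
    then have "as @ bs \<in> tuples G 1"
      using that(1) tuples_face[of as b bs 1] by simp
    then show "[Dh p s 0 (F (as @ bs)) xs = 0] (mod int p)"
      using FD that(2) by simp
  qed
  ultimately show ?thesis
    unfolding chern_system_def using F0 FD by blast
qed

text \<open>
  Exactness of the levels yields a primitive for each tuple separately. Equivariance is achieved by
  choosing it only for tuples that start with the unit and transporting it by translation, which is
  possible because \<open>G\<close> acts freely on tuples.
\<close>

lemma chern_system_step:
  assumes F: "chern_system i F"
  shows "\<exists>F'. chern_system (Suc i) F' \<and> lifts i F F'"
proof -
  have eq: "F (map ((\<otimes>) g) gs) (map (act g) xs) = F gs xs"
    if "g \<in> carrier G" "gs \<in> tuples G (Suc i)" "xs \<in> K" for g gs xs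
    using F that by (auto simp: chern_system_def equivariant_def)
  define R where "R = (\<lambda>gs y. (\<forall>xs. D < Suc i + length xs \<longrightarrow> y xs = 0) \<and>
     (\<forall>xs\<in>K. [sd (\<lambda>hs. F hs xs) gs = Dh p s (Suc i) y xs] (mod int p)))"
  have ex: "\<exists>y. R gs y" if gs: "gs \<in> tuples G (Suc (Suc i))" for gs
  proof -
    define z where "z = (\<lambda>ys. sd (\<lambda>hs. F hs ys) gs)"
    have supp: "z xs = 0" if "D < i + length xs" for xs
      using F that by (simp add: z_def chern_system_def supported_def sd_zero)
    have coc: "[Dh p s i z xs = 0] (mod int p)" if "xs \<in> K" for xs
      using F gs that by (simp add: z_def chern_system_def)
    have zz: "sd (\<lambda>hs. F hs xs) gs = z xs" for xs
      by (simp add: z_def)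
    show ?thesis
    proof (cases i)
      case 0
      \<comment> \<open>\<open>F\<close> is constantly \<open>1\<close> on \<open>[]\<close>, so its coboundary vanishes there, as \<open>Dh_exact_zero\<close> demands\<close>
      have "sd (\<lambda>hs. F hs []) gs = sd (\<lambda>_. 1) gs"
      proof (rule sd_cong)
        fix as b bs assume "gs = as @ b # bs"
        then have "as @ bs \<in> tuples G 1"
          using gs 0 tuples_face[of as b bs 1] by simp
        then show "F (as @ bs) [] = 1"
          using F 0 by (simp add: chern_system_def)
      qed
      also have "\<dots> = 0"
        using gs 0 by (auto simp: tuples_def length_Suc_conv)
      finally have "[z [] = 0] (mod int p)"
        by (simp add: z_def)
      then show ?thesis
        using Dh_exact_zero[of z] supp coc 0 by (simp add: R_def zz)
    next
      case (Suc j)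
      then show ?thesis
        using Dh_exact[of i z] supp coc unfolding R_def zz by blast
    qed
  qed
  define Y where "Y = (\<lambda>gs. SOME y. R gs y)"
  have Y: "R gs (Y gs)" if "gs \<in> tuples G (Suc (Suc i))" for gs
    using someI_ex[OF ex[OF that]] by (simp add: Y_def)
  define F' where "F' = (\<lambda>gs xs. if gs \<in> tuples G (Suc (Suc i))
    then Y (map ((\<otimes>) (inv (hd gs))) gs) (map (act (inv (hd gs))) xs) else 0)"
  have F'_eq: "F' gs = (\<lambda>xs. Y (map ((\<otimes>) (inv (hd gs))) gs) (map (act (inv (hd gs))) xs))"
    if "gs \<in> tuples G (Suc (Suc i))" for gs
    using that by (simp add: F'_def)
  have lift: "[sd (\<lambda>hs. F hs xs) gs = Dh p s (Suc i) (F' gs) xs] (mod int p)"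
    if gs: "gs \<in> tuples G (Suc (Suc i))" and xs: "xs \<in> K" for gs xs
  proof -
    define k where "k = inv (hd gs)"
    have k: "k \<in> carrier G"
      using gs by (cases gs) (auto simp: tuples_def k_def)
    have "sd (\<lambda>hs. F hs (map (act k) xs)) (map ((\<otimes>) k) gs)
        = sd (\<lambda>hs. F (map ((\<otimes>) k) hs) (map (act k) xs)) gs"
      by (rule sd_map[symmetric])
    also have "\<dots> = sd (\<lambda>hs. F hs xs) gs"
      using gs k xs by (intro sd_cong eq) (auto intro: tuples_face)
    finally have e: "sd (\<lambda>hs. F hs (map (act k) xs)) (map ((\<otimes>) k) gs) = sd (\<lambda>hs. F hs xs) gs" .
    have "[sd (\<lambda>hs. F hs (map (act k) xs)) (map ((\<otimes>) k) gs)
        = Dh p s (Suc i) (Y (map ((\<otimes>) k) gs)) (map (act k) xs)] (mod int p)"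
      using Y[OF tuples_translate[OF k gs]] act_K[OF k xs] unfolding R_def by blast
    then have "[sd (\<lambda>hs. F hs xs) gs = Dh p s (Suc i) (Y (map ((\<otimes>) k) gs)) (map (act k) xs)] (mod int p)"
      unfolding e .
    then show ?thesis
      unfolding F'_eq[OF gs] k_def[symmetric] Dh_act[OF k xs] .
  qed
  have "equivariant (Suc i) F'"
    unfolding equivariant_def
  proof (intro ballI)
    fix g gs xs assume g: "g \<in> carrier G" and gs: "gs \<in> tuples G (Suc (Suc i))" and xs: "xs \<in> K"
    have h: "hd gs \<in> carrier G" "gs \<noteq> []"
      using gs by (cases gs; auto simp: tuples_def)+
    have hd: "hd (map ((\<otimes>) g) gs) = g \<otimes> hd gs"
      using h by (simp add: hd_map)
    have "act (inv (g \<otimes> hd gs)) (act g x) = act (inv (hd gs)) x" if "x \<in> X" for x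
      using g h that act_mult[of "inv (g \<otimes> hd gs)" g x] by (simp add: inv_mult_group m_assoc)
    then have 1: "map (act (inv (g \<otimes> hd gs))) (map (act g) xs) = map (act (inv (hd gs))) xs"
      using K_sub[OF xs] by auto
    have "inv (g \<otimes> hd gs) \<otimes> (g \<otimes> k) = inv (hd gs) \<otimes> k" if "k \<in> carrier G" for k
      using g h that by (simp add: inv_mult_group m_assoc inv_solve_left')
    then have 2: "map ((\<otimes>) (inv (g \<otimes> hd gs))) (map ((\<otimes>) g) gs) = map ((\<otimes>) (inv (hd gs))) gs"
      using gs by (auto simp: tuples_def)
    show "F' (map ((\<otimes>) g) gs) (map (act g) xs) = F' gs xs"
      unfolding F'_eq[OF gs] F'_eq[OF tuples_translate[OF g gs]] hd 1 2 ..
  qed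
  moreover have "supported (Suc i) F'"
    unfolding supported_def
  proof (intro allI impI)
    fix gs :: "'a list" and xs :: "'v list"
    assume xs: "D < Suc i + length xs"
    show "F' gs xs = 0"
    proof (cases "gs \<in> tuples G (Suc (Suc i))")
      case True
      then have "inv (hd gs) \<in> carrier G"
        by (cases gs) (auto simp: tuples_def)
      then show ?thesis
        using Y[OF tuples_translate[OF _ True]] xs by (simp add: F'_eq[OF True] R_def)
    qed (simp add: F'_def)
  qed
  moreover have "[Dh p s (Suc i) (\<lambda>ys. sd (\<lambda>hs. F' hs ys) gs) xs = 0] (mod int p)"
    if gs: "gs \<in> tuples G (Suc (Suc (Suc i)))" and xs: "xs \<in> K" for gs xs
  proof -
    have "[sd (\<lambda>hs. Dh p s (Suc i) (F' hs) xs) gs = sd (\<lambda>hs. sd (\<lambda>ks. F ks xs) hs) gs] (mod int p)"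
    proof (rule sd_cong_mod)
      fix as b bs assume "gs = as @ b # bs"
      then have "as @ bs \<in> tuples G (Suc (Suc i))"
        using gs tuples_face[of as b bs "Suc (Suc i)"] by simp
      then show "[Dh p s (Suc i) (F' (as @ bs)) xs = sd (\<lambda>ks. F ks xs) (as @ bs)] (mod int p)"
        using lift xs by (simp add: cong_sym)
    qed
    then show ?thesis
      by (simp add: Dh_swap sd_sd)
  qed
  ultimately show ?thesis
    using lift unfolding chern_system_def lifts_def by blast
qed

lemma chern_classes:
  "\<exists>F. \<forall>i. chern_system i (F i) \<and> lifts i (F i) (F (Suc i))"
  using dependent_nat_choice[of chern_system "lifts"] chern_system_base chern_system_step by blast

text \<open>
  At a vertex where \<open>c\<close> acts like \<open>s\<close>, equivariance turns the right action into left translation of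
  the group elements, so the periodic resolution becomes that of \<open>\<langle>c\<rangle>\<close> acting on its own tuples.
\<close>

lemma lifts_at_fixed_vertex:
  assumes c: "c \<in> carrier G" and vK: "[v] \<in> K" and vc: "act c v = s v"
    and F: "equivariant i F" and gs: "gs \<in> tuples G (Suc i)"
  shows "Eop p s k (F gs) [v] = Eop p ((\<otimes>) (inv c)) k (\<lambda>hs. F hs [v]) gs"
proof -
  have v: "v \<in> X"
    using K_sub[OF vK] by simp
  have pow: "F gs [(s ^^ j) v] = F (map ((\<otimes>) (inv c) ^^ j) gs) [v]" if "gs \<in> tuples G (Suc i)" for j gs
    using that
  proof (induction j arbitrary: gs)
    case (Suc j)
    have K': "[(s ^^ Suc j) v] \<in> K"
      using s_pow_K[OF vK, of "Suc j"] by simp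
    have "act (inv c) ((s ^^ Suc j) v) = (s ^^ j) (act (inv c) (act c v))"
      using v c act_s_pow[of "inv c" "s v" j] s_X vc by (simp add: funpow_swap1)
    also have "act (inv c) (act c v) = v"
      using v c act_mult[of "inv c" c v] act_one by simp
    finally have "F gs [(s ^^ Suc j) v] = F (map ((\<otimes>) (inv c)) gs) [(s ^^ j) v]"
      using F Suc.prems c K' unfolding equivariant_def
      by (metis (no_types, lifting) inv_closed list.simps(8) list.simps(9))
    also have "\<dots> = F (map ((\<otimes>) (inv c) ^^ j) (map ((\<otimes>) (inv c)) gs)) [v]"
      using Suc.prems c by (intro Suc.IH tuples_translate) auto
    also have "map ((\<otimes>) (inv c) ^^ j) (map ((\<otimes>) (inv c)) gs) = map ((\<otimes>) (inv c) ^^ Suc j) gs"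
      by (simp add: funpow_swap1)
    finally show ?case .
  qed simp
  from pow[OF gs] pow[OF gs, of 1] show ?thesis
    by (simp add: Eop_def)
qed

text \<open>
  Evaluation at the fixed vertex \<open>v\<close> gives cochains \<open>\<omega>\<^sub>i = F\<^sub>i(-)[v]\<close> that satisfy
  \<open>sd \<omega>\<^sub>i = a\<^bsub>i+1\<^esub> - E \<omega>\<^bsub>i+1\<^esub>\<close> and vanish for large \<open>i\<close>; they witness that the Euler class dies on
  the diagonal. Suppose \<open>a\<^bsub>i+1\<^esub> = sd b\<^sub>i\<close> on \<open>C = \<langle>c\<rangle>\<close>, where \<open>E\<close> kills \<open>b\<^sub>i\<close>. Tuples of \<open>C\<close> form a
  contractible complex, so by descending induction \<open>\<omega>\<^sub>i = b\<^sub>i + sd V + E V'\<close>. At \<open>i = 0\<close>, the norm of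
  the right-hand side is \<open>0\<close> modulo \<open>p\<close> at the unit, while the norm of \<open>\<omega>\<^sub>0\<close> is \<open>a\<^sub>0 = 1\<close>.

  The condition on \<open>b\<close> is \<open>C\<close>-invariance if the degree \<open>i + 1\<close> is even. If it is odd, only the norm
  of \<open>b\<close> has to vanish, which holds for every invariant \<open>b\<close>, and in degree one for homomorphisms.
\<close>

theorem chern_classes_not_all_trivial:
  assumes c: "c \<in> carrier G" and cp: "c [^] p = \<one>" and vK: "[v] \<in> K" and vc: "act c v = s v"
  defines "t \<equiv> (\<otimes>) (inv c)"
  defines "Q \<equiv> \<lambda>n. {gs \<in> tuples G n. set gs \<subseteq> range (\<lambda>j::nat. c [^] j)}"
  assumes triv: "\<And>i a. (\<And>gs. gs \<in> tuples G (Suc (Suc (Suc i))) \<Longrightarrow> [sd a gs = 0] (mod int p)) \<Longrightarrow>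
      (\<And>g gs. g \<in> carrier G \<Longrightarrow> gs \<in> tuples G (Suc (Suc i)) \<Longrightarrow> a (map ((\<otimes>) g) gs) = a gs) \<Longrightarrow>
      \<exists>b. (\<forall>gs\<in>Q (Suc (Suc i)). [sd b gs = a gs] (mod int p)) \<and>
          (\<forall>gs\<in>Q (Suc i). [Eop p t (Suc i) b gs = 0] (mod int p))"
  shows False
proof -
  obtain F where cs: "\<And>i. chern_system i (F i)" and li: "\<And>i. lifts i (F i) (F (Suc i))"
    using chern_classes by blast
  have QG: "gs \<in> Q n \<Longrightarrow> gs \<in> tuples G n" for gs n
    by (simp add: Q_def)
  have cinv: "inv c = c [^] (p - 1)"
  proof -
    have "c [^] (p - 1) \<otimes> c = c [^] Suc (p - 1)"
      by simp
    then have "c [^] (p - 1) \<otimes> c = \<one>"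
      using cp prime_gt_0_nat[OF prime_p] by simp
    then show ?thesis
      using c by (metis inv_equality nat_pow_closed)
  qed
  have Q_alt: "Q n = {gs. length gs = n \<and> set gs \<subseteq> range (\<lambda>j::nat. c [^] j)}" for n
    using c by (auto simp: Q_def tuples_def)
  have t_range: "t x \<in> range (\<lambda>j::nat. c [^] j)" if "x \<in> range (\<lambda>j::nat. c [^] j)" for x
    using that c unfolding t_def cinv by (auto simp: nat_pow_mult)
  have tQ: "map (t ^^ j) gs \<in> Q n" if "gs \<in> Q n" for j gs n
  proof -
    have "(t ^^ j) x \<in> range (\<lambda>j::nat. c [^] j)" if "x \<in> range (\<lambda>j::nat. c [^] j)" for x
      by (induction j) (use that t_range in auto)
    then show ?thesis
      using that unfolding Q_alt mem_Collect_eq length_map set_map by blast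
  qed
  have t_per: "(t ^^ p) y = y" if "y \<in> set gs" "gs \<in> Q n" for y gs n
  proof -
    have y: "y \<in> carrier G"
      using that by (auto simp: Q_def tuples_def)
    have "(t ^^ j) y = inv (c [^] j) \<otimes> y" for j
      by (induction j) (use c y in \<open>auto simp: t_def m_assoc inv_mult_group simp flip: nat_pow_Suc2\<close>)
    then show ?thesis
      using cp y by simp
  qed
  have Q_face: "as @ bs \<in> Q n" if "as @ b # bs \<in> Q (Suc n)" for as b bs n
    using that tuples_face by (auto simp: Q_def)
  have Q_cone: "\<one> # gs \<in> Q (Suc n)" if "gs \<in> Q n" for gs n
    using that by (auto simp: Q_def tuples_def intro: range_eqI[of _ _ "0::nat"])
  define \<omega> where "\<omega> = (\<lambda>i gs. F i gs [v])"
  define a where "a = (\<lambda>i gs. F i gs [])"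
  have rel: "[sd (\<omega> i) gs = a (Suc i) gs - Eop p t (Suc (Suc i)) (\<omega> (Suc i)) gs] (mod int p)"
    if gs: "gs \<in> tuples G (Suc (Suc i))" for i gs
  proof -
    have "[sd (\<omega> i) gs = Dh p s (Suc i) (F (Suc i) gs) [v]] (mod int p)"
      using li[of i] gs vK unfolding lifts_def \<omega>_def by blast
    also have "Dh p s (Suc i) (F (Suc i) gs) [v] = a (Suc i) gs - Eop p t (Suc (Suc i)) (\<omega> (Suc i)) gs"
      using lifts_at_fixed_vertex[OF c vK vc, of "Suc i" "F (Suc i)" gs] cs[of "Suc i"] gs
      by (simp add: Dh_def a_def \<omega>_def t_def chern_system_def)
    finally show ?thesis .
  qed
  have a_cocycle: "[sd (a i) gs = 0] (mod int p)" if gs: "gs \<in> tuples G (Suc (Suc i))" for i gs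
  proof -
    have "[sd (a i) gs = Dh p s (Suc i) (F (Suc i) gs) []] (mod int p)"
      using li[of i] gs Nil_K unfolding lifts_def a_def by blast
    also have "[Dh p s (Suc i) (F (Suc i) gs) [] = 0] (mod int p)"
      by (simp add: Dh_def Eop_def cong_0_iff)
    finally show ?thesis .
  qed
  have a_inv: "a i (map ((\<otimes>) g) gs) = a i gs" if "g \<in> carrier G" "gs \<in> tuples G (Suc i)" for i g gs
  proof -
    have "F i (map ((\<otimes>) g) gs) (map (act g) []) = F i gs []"
      using cs[of i] that Nil_K unfolding chern_system_def equivariant_def by blast
    then show ?thesis
      by (simp add: a_def)
  qed
  have "\<exists>b. (\<forall>gs\<in>Q (Suc (Suc i)). [sd b gs = a (Suc i) gs] (mod int p)) \<and>
          (\<forall>gs\<in>Q (Suc i). [Eop p t (Suc i) b gs = 0] (mod int p))" for i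
    using triv[of i "a (Suc i)"] a_cocycle a_inv by blast
  then obtain b where b: "\<And>i gs. gs \<in> Q (Suc (Suc i)) \<Longrightarrow> [sd (b i) gs = a (Suc i) gs] (mod int p)"
      "\<And>i gs. gs \<in> Q (Suc i) \<Longrightarrow> [Eop p t (Suc i) (b i) gs = 0] (mod int p)"
    by metis
  have step: "\<exists>V V'. \<forall>gs\<in>Q (Suc i). [\<omega> i gs = b i gs + sd V gs + Eop p t (Suc (Suc i)) V' gs] (mod int p)"
    if V1: "\<And>gs. gs \<in> Q (Suc (Suc i)) \<Longrightarrow>
      [Eop p t (Suc (Suc i)) (\<omega> (Suc i)) gs = sd (Eop p t (Suc (Suc i)) V1) gs] (mod int p)" for i V1
  proof -
    \<comment> \<open>the part of \<open>\<omega> i\<close> that remains to be explained; it is closed on \<open>C\<close>\<close>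
    define h where "h = (\<lambda>gs. \<omega> i gs - b i gs + Eop p t (Suc (Suc i)) V1 gs)"
    have closed: "[sd h gs = 0] (mod int p)" if gs: "gs \<in> Q (Suc (Suc i))" for gs
    proof -
      \<comment> \<open>the three congruences \<open>rel\<close>, \<open>b\<close> and \<open>V1\<close> combine to \<open>sd h = 0\<close>\<close>
      note dvd_diff[OF dvd_diff[OF
            rel[OF QG[OF gs], unfolded cong_iff_dvd_diff]
            b(1)[OF gs, unfolded cong_iff_dvd_diff]]
            V1[OF gs, unfolded cong_iff_dvd_diff]]
      then show ?thesis
        by (simp add: h_def sd_linear cong_0_iff algebra_simps)
    qed
    have "[\<omega> i gs = b i gs + sd (\<lambda>ys. h (\<one> # ys)) gs + Eop p t (Suc (Suc i)) (\<lambda>ys. - V1 ys) gs] (mod int p)"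
      if gs: "gs \<in> Q (Suc i)" for gs
    proof -
      have "int p dvd h gs - sd (\<lambda>ys. h (\<one> # ys)) gs"
        using closed[OF Q_cone[OF gs]] by (simp add: cong_0_iff)
      then show ?thesis
        by (simp add: h_def Eop_linear cong_iff_dvd_diff algebra_simps)
    qed
    then show ?thesis
      by blast
  qed
  have claim: "\<exists>V V'. \<forall>gs\<in>Q (Suc i). [\<omega> i gs = b i gs + sd V gs + Eop p t (Suc (Suc i)) V' gs] (mod int p)"
    if "D \<le> i + n" for i n
    using that
  proof (induction n arbitrary: i)
    case 0
    show ?case
    proof (rule step[of i "\<lambda>_. 0"])
      fix gs
      have "\<omega> (Suc i) = (\<lambda>_. 0)"
        using cs[of "Suc i"] 0 by (auto simp: chern_system_def supported_def \<omega>_def)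
      then show "[Eop p t (Suc (Suc i)) (\<omega> (Suc i)) gs = sd (Eop p t (Suc (Suc i)) (\<lambda>_. 0)) gs] (mod int p)"
        by (simp add: Eop_zero[abs_def] sd_zero)
    qed
  next
    case (Suc n)
    then obtain V V' where V: "\<And>gs. gs \<in> Q (Suc (Suc i)) \<Longrightarrow>
        [\<omega> (Suc i) gs = b (Suc i) gs + sd V gs + Eop p t (Suc (Suc (Suc i))) V' gs] (mod int p)"
      by (metis add_Suc_shift add_Suc)
    show ?case
    proof (rule step[of i V])
      fix gs assume gs: "gs \<in> Q (Suc (Suc i))"
      let ?E = "Eop p t (Suc (Suc i))"
      have "[?E (\<omega> (Suc i)) gs = ?E (\<lambda>gs. b (Suc i) gs + sd V gs + Eop p t (Suc (Suc (Suc i))) V' gs) gs] (mod int p)"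
        using V tQ[OF gs] by (intro Eop_cong_mod) blast
      also have "?E (\<lambda>gs. b (Suc i) gs + sd V gs + Eop p t (Suc (Suc (Suc i))) V' gs) gs
          = ?E (b (Suc i)) gs + sd (?E V) gs"
        using Eop_Eop'[where k = "Suc (Suc i)" and f = V', OF t_per[OF _ gs]]
        by (simp add: Eop_add sd_Eop)
      also have "[\<dots> = 0 + sd (?E V) gs] (mod int p)"
        using b(2)[OF gs] by (intro cong_add) auto
      finally show "[?E (\<omega> (Suc i)) gs = sd (?E V) gs] (mod int p)"
        by simp
    qed
  qed
  obtain V V' where V: "\<And>gs. gs \<in> Q (Suc 0) \<Longrightarrow>
      [\<omega> 0 gs = b 0 gs + sd V gs + Eop p t (Suc (Suc 0)) V' gs] (mod int p)"
    using claim[of 0 D] by auto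
  have q: "[\<one>] \<in> Q (Suc 0)"
    by (auto simp: Q_def tuples_def intro: range_eqI[of _ _ "0::nat"])
  let ?E = "Eop p t (Suc 0)"
  have "[?E (\<omega> 0) [\<one>] = ?E (\<lambda>gs. b 0 gs + sd V gs + Eop p t (Suc (Suc 0)) V' gs) [\<one>]] (mod int p)"
    using V tQ[OF q] by (intro Eop_cong_mod) blast
  also have "?E (\<lambda>gs. b 0 gs + sd V gs + Eop p t (Suc (Suc 0)) V' gs) [\<one>]
      = ?E (b 0) [\<one>] + int p * V []"
  proof -
    have "?E (Eop p t (Suc (Suc 0)) V') [\<one>] = 0"
      by (rule Eop_Eop'[OF t_per[OF _ q]])
    moreover have "?E (sd V) [\<one>] = int p * V []"
      by (simp add: Eop_def)
    ultimately show ?thesis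
      unfolding Eop_add by simp
  qed
  also have "[\<dots> = 0] (mod int p)"
    using b(2)[OF q] by (simp add: cong_0_iff)
  finally have "[?E (\<omega> 0) [\<one>] = 0] (mod int p)" .
  moreover have "?E (\<omega> 0) [\<one>] = 1"
  proof -
    have "[\<one>] \<in> tuples G 1"
      by (simp add: tuples_def)
    then have "F 0 [\<one>] [] = 1" "Dh p s 0 (F 0 [\<one>]) [v] = 0"
      using cs[of 0] vK unfolding chern_system_def by blast+
    moreover have "Eop p s (Suc 0) (F 0 [\<one>]) [v] = ?E (\<omega> 0) [\<one>]"
      using lifts_at_fixed_vertex[OF c vK vc, of 0 "F 0" "[\<one>]" "Suc 0"] cs[of 0]
      by (simp add: \<omega>_def t_def chern_system_def tuples_def)
    ultimately show ?thesis
      by (simp add: Dh_def)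
  qed
  ultimately have "int p dvd 1"
    by (simp add: cong_0_iff)
  then show False
    using prime_p by (simp add: prime_nat_iff)
qed

end

section \<open>A positive-degree class with nontrivial restriction\<close>

text \<open>
  A representative is chosen in each orbit, and elements are labelled by the power of \<open>s\<close> that leads
  from the representative to them. Since \<open>p\<close> is prime, a power of \<open>s\<close> with exponent between \<open>0\<close> and
  \<open>p\<close> has no fixed point either, so the label is unique.
\<close>

lemma free_cyclic_index:
  fixes s :: "'v \<Rightarrow> 'v"
  assumes p: "prime p" and sX: "\<And>x. x \<in> X \<Longrightarrow> s x \<in> X"
    and sp: "\<And>x. x \<in> X \<Longrightarrow> (s ^^ p) x = x" and free: "\<And>x. x \<in> X \<Longrightarrow> s x \<noteq> x"
  obtains idx where "\<And>x. x \<in> X \<Longrightarrow> idx x < p" "\<And>x. x \<in> X \<Longrightarrow> idx (s x) = Suc (idx x) mod p"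
proof -
  have p0: "0 < p"
    using p by (rule prime_gt_0_nat)
  have powX: "(s ^^ i) x \<in> X" if "x \<in> X" for i x
    by (induction i) (use that sX in auto)
  have no_fix: "(s ^^ i) x \<noteq> x" if x: "x \<in> X" and i: "0 < i" "i < p" for x i
  proof
    assume fx: "(s ^^ i) x = x"
    have "coprime i p"
      using p i by (metis coprime_commute dvd_imp_le not_le prime_imp_coprime)
    then obtain a where "[i * a = 1] (mod p)"
      using cong_solve_coprime_nat by auto
    then have m: "(i * a) mod p = 1"
      using prime_gt_1_nat[OF p] by (simp add: cong_def)
    have "(s ^^ (i * a)) x = x"
    proof -
      have "(s ^^ ((i * a) mod i)) x = (s ^^ (i * a)) x"
        using fx by (rule funpow_mod_eq)
      then show ?thesis
        by simp
    qed
    moreover have "(s ^^ ((i * a) mod p)) x = (s ^^ (i * a)) x"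
      using sp[OF x] by (rule funpow_mod_eq)
    ultimately show False
      using m free[OF x] by simp
  qed
  have uniq: "i = j" if x: "x \<in> X" and ij: "i < p" "j < p" "(s ^^ i) x = (s ^^ j) x" for x i j
    using ij
  proof (induction i j rule: linorder_wlog)
    case (le i j)
    have "(s ^^ (j - i)) ((s ^^ i) x) = (s ^^ (j - i + i)) x"
      by (simp only: funpow_add comp_apply)
    then have "(s ^^ (j - i)) ((s ^^ i) x) = (s ^^ i) x"
      using le by simp
    then show ?case
    proof (cases "i = j")
      case False
      then have "0 < j - i" "j - i < p"
        using le by auto
      then show ?thesis
        using no_fix[OF powX[OF x]] \<open>(s ^^ (j - i)) ((s ^^ i) x) = (s ^^ i) x\<close> by blast
    qed
  qed auto
  define orb where "orb = (\<lambda>x. range (\<lambda>i. (s ^^ i) x))"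
  have orb_s: "orb (s x) = orb x" if x: "x \<in> X" for x
  proof -
    have 1: "(s ^^ i) (s x) = (s ^^ Suc i) x" for i
      by (simp add: funpow_swap1)
    have "(s ^^ i) x = (s ^^ (i + (p - 1))) (s x)" for i
    proof -
      have "(s ^^ (i + (p - 1))) (s x) = (s ^^ (i + p)) x"
        unfolding 1 using p0 by simp
      also have "\<dots> = (s ^^ i) ((s ^^ p) x)"
        by (simp add: funpow_add)
      finally show ?thesis
        using sp[OF x] by simp
    qed
    then have "orb x \<subseteq> orb (s x)"
      unfolding orb_def by (metis image_subsetI rangeI)
    moreover have "orb (s x) \<subseteq> orb x"
      unfolding orb_def 1 by blast
    ultimately show ?thesis
      by blast
  qed
  define rep where "rep = (\<lambda>x. SOME y. y \<in> orb x)"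
  have rep: "rep x \<in> orb x" for x
  proof -
    have "(s ^^ 0) x \<in> orb x"
      unfolding orb_def by (rule rangeI)
    then show ?thesis
      unfolding rep_def by (simp add: someI[of "\<lambda>y. y \<in> orb x"])
  qed
  have ex: "\<exists>i<p. (s ^^ i) (rep x) = x" if x: "x \<in> X" for x
  proof -
    obtain i where i: "rep x = (s ^^ i) x"
      using rep[of x] by (auto simp: orb_def)
    have "i \<le> i * p"
      using p0 by simp
    then have "(s ^^ (i * p)) x = (s ^^ (i * p - i + i)) x"
      by simp
    then have "(s ^^ (i * p - i)) (rep x) = (s ^^ (i * p)) x"
      unfolding i by (simp only: funpow_add comp_apply)
    also have "\<dots> = (s ^^ ((i * p) mod p)) x"
      using funpow_mod_eq[OF sp[OF x]] by metis
    finally have "(s ^^ (i * p - i)) (rep x) = x"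
      by simp
    moreover have "(s ^^ p) (rep x) = rep x"
      using sp powX[OF x] i by simp
    ultimately have "(s ^^ ((i * p - i) mod p)) (rep x) = x"
      using funpow_mod_eq by metis
    then show ?thesis
      using p0 by (intro exI[of _ "(i * p - i) mod p"]) simp
  qed
  define idx where "idx = (\<lambda>x. SOME i. i < p \<and> (s ^^ i) (rep x) = x)"
  have idx: "idx x < p \<and> (s ^^ idx x) (rep x) = x" if "x \<in> X" for x
    unfolding idx_def using someI_ex[OF ex[OF that]] by blast
  have "idx (s x) = Suc (idx x) mod p" if x: "x \<in> X" for x
  proof (rule uniq[of "rep x"])
    show rX: "rep x \<in> X"
      using rep[of x] powX[OF x] by (auto simp: orb_def)
    show "idx (s x) < p" "Suc (idx x) mod p < p"
      using idx[OF sX[OF x]] p0 by auto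
    have "rep (s x) = rep x"
      by (simp add: rep_def orb_s[OF x])
    then have "(s ^^ idx (s x)) (rep x) = s x"
      using idx[OF sX[OF x]] by simp
    moreover have "(s ^^ (Suc (idx x) mod p)) (rep x) = s x"
      using funpow_mod_eq[OF sp[OF rX], of "Suc (idx x)"] idx[OF x] by simp
    ultimately show "(s ^^ idx (s x)) (rep x) = (s ^^ (Suc (idx x) mod p)) (rep x)"
      by simp
  qed
  then show ?thesis
    using that[of idx] idx by blast
qed

text \<open>
  The sphere is the complex of nonempty subsets of \<open>G\<close> that contain no left coset of \<open>C = \<langle>c\<rangle>\<close>.
  Right translation by \<open>c\<close> preserves each coset and fixes no such subset, since a subset fixed by it
  is a union of cosets. On the vertex \<open>{\<one>}\<close>, left and right translation by \<open>c\<close> agree.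
\<close>

theorem (in group) positive_degree_restriction_nontrivial:
  assumes fin: "finite (carrier G)" and p: "prime p"
    and c: "c \<in> carrier G" and c1: "c \<noteq> \<one>" and cp: "c [^] p = \<one>"
  defines "t \<equiv> (\<otimes>) (inv c)"
  defines "Q \<equiv> \<lambda>n. {gs \<in> tuples G n. set gs \<subseteq> range (\<lambda>j::nat. c [^] j)}"
  assumes triv: "\<And>i a. (\<And>gs. gs \<in> tuples G (Suc (Suc (Suc i))) \<Longrightarrow> [sd a gs = 0] (mod int p)) \<Longrightarrow>
      (\<And>g gs. g \<in> carrier G \<Longrightarrow> gs \<in> tuples G (Suc (Suc i)) \<Longrightarrow> a (map ((\<otimes>) g) gs) = a gs) \<Longrightarrow>
      \<exists>b. (\<forall>gs\<in>Q (Suc (Suc i)). [sd b gs = a gs] (mod int p)) \<and>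
          (\<forall>gs\<in>Q (Suc i). [Eop p t (Suc i) b gs = 0] (mod int p))"
  shows False
proof -
  define C where "C = range (\<lambda>j::nat. c [^] j)"
  define \<pi> where "\<pi> = (\<lambda>x. (\<otimes>) x ` C)"
  define V where "V = carrier G"
  define X where "X = faces \<pi> V"
  define K where "K = chains X"
  define D where "D = card V - card (\<pi> ` V)"
  define s where "s = (\<lambda>\<sigma>. (\<lambda>x. x \<otimes> c) ` \<sigma>)"
  define act where "act = (\<lambda>g \<sigma>. (\<otimes>) g ` \<sigma>)"
  have CV: "C \<subseteq> carrier G"
    using c by (auto simp: C_def)
  have XV: "\<sigma> \<subseteq> carrier G" if "\<sigma> \<in> X" for \<sigma>
    using that by (auto simp: X_def faces_def V_def)
  have \<pi>c: "\<pi> (x \<otimes> c) = \<pi> x" if x: "x \<in> carrier G" for x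
  proof -
    have cC: "(\<otimes>) c ` C = C"
    proof -
      have 1: "c \<otimes> c [^] j = c [^] Suc j" for j :: nat
        using c nat_pow_Suc2 by simp
      have "c [^] j = c \<otimes> c [^] (j + (p - 1))" for j :: nat
      proof -
        have "c \<otimes> c [^] (j + (p - 1)) = c [^] (j + p)"
          unfolding 1 using prime_gt_0_nat[OF p] by (metis Suc_pred add_Suc_right One_nat_def)
        also have "\<dots> = c [^] j \<otimes> c [^] p"
          using c by (simp add: nat_pow_mult)
        finally show ?thesis
          using c cp by simp
      qed
      then have "C \<subseteq> (\<otimes>) c ` C"
        unfolding C_def by blast
      moreover have "(\<otimes>) c ` C \<subseteq> C"
        unfolding C_def using 1 by blast
      ultimately show ?thesis
        by blast
    qed
    have "\<pi> (x \<otimes> c) = (\<otimes>) x ` ((\<otimes>) c ` C)"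
      unfolding \<pi>_def image_image using x c CV by (intro image_cong) (auto simp: m_assoc)
    then show ?thesis
      by (simp add: cC \<pi>_def)
  qed
  have \<pi>g: "\<pi> (g \<otimes> x) = (\<otimes>) g ` \<pi> x" if "g \<in> carrier G" "x \<in> carrier G" for g x
    unfolding \<pi>_def image_image using that CV by (intro image_cong) (auto simp: m_assoc)
  have sX: "s \<sigma> \<in> X" if \<sigma>: "\<sigma> \<in> X" for \<sigma>
  proof -
    have "\<exists>u\<in>V. \<pi> u = \<pi> v \<and> u \<notin> s \<sigma>" if v: "v \<in> V" for v
    proof -
      obtain u where u: "u \<in> carrier G" "\<pi> u = \<pi> v" "u \<notin> \<sigma>"
        using \<sigma> v unfolding X_def faces_def V_def by blast
      have "u \<otimes> c \<notin> s \<sigma>"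
      proof
        assume "u \<otimes> c \<in> s \<sigma>"
        then obtain x where "x \<in> \<sigma>" "u \<otimes> c = x \<otimes> c"
          by (auto simp: s_def)
        then show False
          using u c XV[OF \<sigma>] by (metis right_cancel subsetD)
      qed
      then show ?thesis
        using u c \<pi>c by (intro bexI[of _ "u \<otimes> c"]) (auto simp: V_def)
    qed
    moreover have "s \<sigma> \<subseteq> V" "s \<sigma> \<noteq> {}"
      using XV[OF \<sigma>] \<sigma> c by (auto simp: s_def V_def X_def faces_def)
    ultimately show ?thesis
      by (simp add: X_def faces_def)
  qed
  have actX: "act g \<sigma> \<in> X" if g: "g \<in> carrier G" and \<sigma>: "\<sigma> \<in> X" for g \<sigma>
  proof -
    have "\<exists>u\<in>V. \<pi> u = \<pi> v \<and> u \<notin> act g \<sigma>" if v: "v \<in> V" for v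
    proof -
      have v': "v \<in> carrier G" "inv g \<otimes> v \<in> carrier G"
        using v g by (auto simp: V_def)
      obtain u where u: "u \<in> carrier G" "\<pi> u = \<pi> (inv g \<otimes> v)" "u \<notin> \<sigma>"
        using \<sigma> v'(2) unfolding X_def faces_def V_def by blast
      have "g \<otimes> (inv g \<otimes> v) = v"
        using g v' by (simp flip: m_assoc)
      then have "\<pi> (g \<otimes> u) = \<pi> v"
        using \<pi>g[OF g u(1)] \<pi>g[OF g v'(2)] u(2) by simp
      moreover have "g \<otimes> u \<notin> act g \<sigma>"
      proof
        assume "g \<otimes> u \<in> act g \<sigma>"
        then obtain x where "x \<in> \<sigma>" "g \<otimes> u = g \<otimes> x"
          by (auto simp: act_def)
        then show False
          using u g XV[OF \<sigma>] by (metis Units_eq Units_l_cancel subsetD)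
      qed
      ultimately show ?thesis
        using u g by (intro bexI[of _ "g \<otimes> u"]) (auto simp: V_def)
    qed
    moreover have "act g \<sigma> \<subseteq> V" "act g \<sigma> \<noteq> {}"
      using XV[OF \<sigma>] \<sigma> g by (auto simp: act_def V_def X_def faces_def)
    ultimately show ?thesis
      by (simp add: X_def faces_def)
  qed
  have s_pow: "(s ^^ j) \<sigma> = (\<lambda>x. x \<otimes> c [^] j) ` \<sigma>" if \<sigma>: "\<sigma> \<in> X" for j \<sigma>
  proof (induction j)
    case 0
    have "(\<lambda>x. x \<otimes> \<one>) ` \<sigma> = (\<lambda>x. x) ` \<sigma>"
      using XV[OF \<sigma>] by (intro image_cong) auto
    then show ?case
      by simp
  next
    case (Suc j)
    have "s ((\<lambda>x. x \<otimes> c [^] j) ` \<sigma>) = (\<lambda>x. x \<otimes> c [^] Suc j) ` \<sigma>"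
      unfolding s_def image_image using XV[OF \<sigma>] c by (intro image_cong) (auto simp: m_assoc)
    then show ?case
      using Suc by simp
  qed
  have s_p: "(s ^^ p) \<sigma> = \<sigma>" if \<sigma>: "\<sigma> \<in> X" for \<sigma>
  proof -
    have "(\<lambda>x. x \<otimes> \<one>) ` \<sigma> = (\<lambda>x. x) ` \<sigma>"
      using XV[OF \<sigma>] by (intro image_cong) auto
    then show ?thesis
      using s_pow[OF \<sigma>, of p] cp by simp
  qed
  have s_free: "s \<sigma> \<noteq> \<sigma>" if \<sigma>: "\<sigma> \<in> X" for \<sigma>
  proof
    assume fixed: "s \<sigma> = \<sigma>"
    obtain v where v: "v \<in> \<sigma>" "v \<in> V"
      using \<sigma> by (auto simp: X_def faces_def)
    obtain u where u: "u \<in> V" "\<pi> u = \<pi> v" "u \<notin> \<sigma>"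
      using \<sigma> v(2) unfolding X_def faces_def by blast
    have "\<one> \<in> C"
      by (auto simp: C_def intro: range_eqI[of _ _ "0::nat"])
    then have "u \<otimes> \<one> \<in> \<pi> u"
      by (simp add: \<pi>_def)
    then have "u \<in> \<pi> v"
      using u(1,2) by (simp add: V_def)
    then obtain j :: nat where j: "u = v \<otimes> c [^] j"
      by (auto simp: \<pi>_def C_def)
    have "(s ^^ j) \<sigma> = \<sigma>"
      by (induction j) (simp_all add: fixed)
    then show False
      using s_pow[OF \<sigma>, of j] j v(1) u(3) by blast
  qed
  obtain idx where idx: "\<And>\<sigma>. \<sigma> \<in> X \<Longrightarrow> idx \<sigma> < p" "\<And>\<sigma>. \<sigma> \<in> X \<Longrightarrow> idx (s \<sigma>) = Suc (idx \<sigma>) mod p"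
    using free_cyclic_index[of p X s] p sX s_p s_free by blast
  have "\<not> int p dvd 1"
    using p by (simp add: prime_nat_iff)
  note coh = cohomology_of_faces[of V "int p" \<pi>, OF _ this, folded X_def K_def D_def]
  have finV: "finite V"
    using fin by (simp add: V_def)
  interpret S: free_sphere_action G p D X K s idx act
  proof unfold_locales
    show "prime p" by (rule p)
    show "xs \<in> K \<Longrightarrow> set xs \<subseteq> X" for xs
      by (auto simp: K_def chains_def)
    show "[] \<in> K"
      by (simp add: K_def chains_def)
    show "face_closed K"
      unfolding K_def by (rule face_closed_chains)
    show "map s xs \<in> K" if "xs \<in> K" for xs
      using that unfolding K_def by (rule chains_map) (auto simp: sX, auto simp: s_def)
    show "map (act g) xs \<in> K" if "g \<in> carrier G" "xs \<in> K" for g xs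
      using that(2) unfolding K_def by (rule chains_map) (auto simp: actX that(1), auto simp: act_def)
    show "act \<one> \<sigma> = \<sigma>" if "\<sigma> \<in> X" for \<sigma>
      using XV[OF that] by (force simp: act_def)
    show "act (g \<otimes> h) \<sigma> = act g (act h \<sigma>)" if "g \<in> carrier G" "h \<in> carrier G" "\<sigma> \<in> X" for g h \<sigma>
      unfolding act_def image_image using XV[OF that(3)] that by (intro image_cong) (auto simp: m_assoc)
    show "act g (s \<sigma>) = s (act g \<sigma>)" if "g \<in> carrier G" "\<sigma> \<in> X" for g \<sigma>
      unfolding act_def s_def image_image using XV[OF that(2)] that c by (intro image_cong) (auto simp: m_assoc)
    show "acyclic_in (int p) K q" if "q < D" for q
      using coh finV that by blast
    show "rank_le_one_in (int p) K D"
      using coh finV by blast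
    show "\<exists>as b bs. xs = as @ b # b # bs" if "xs \<in> K" "D < length xs" for xs
      using chain_repeats[of xs \<pi> V] that finV by (simp add: K_def X_def D_def)
  qed (use sX s_p idx actX in auto)
  have "{\<one>} \<in> X"
  proof -
    have "\<exists>u\<in>V. \<pi> u = \<pi> v \<and> u \<notin> {\<one>}" if v: "v \<in> V" for v
    proof (cases "v = \<one>")
      case True
      then show ?thesis
        using c c1 \<pi>c[of \<one>] by (intro bexI[of _ c]) (auto simp: V_def)
    qed (use v in blast)
    then show ?thesis
      by (simp add: X_def faces_def V_def)
  qed
  then have K1: "[{\<one>}] \<in> K"
    by (simp add: K_def chains_def)
  have "act c {\<one>} = s {\<one>}"
    using c by (simp add: act_def s_def)
  then show False
    by (rule S.chern_classes_not_all_trivial[OF c cp K1, folded t_def]) (rule triv[unfolded Q_def]; assumption)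
qed

section \<open>Classes generated in degree one\<close>

definition hom_mod :: "int \<Rightarrow> ('a, 'm) monoid_scheme \<Rightarrow> ('a \<Rightarrow> int) \<Rightarrow> bool" where
  "hom_mod m G \<alpha> \<longleftrightarrow>
     (\<forall>g\<in>carrier G. \<forall>h\<in>carrier G. [\<alpha> (g \<otimes>\<^bsub>G\<^esub> h) = \<alpha> g + \<alpha> h] (mod m))"

definition inv_cochain :: "int \<Rightarrow> ('a, 'm) monoid_scheme \<Rightarrow> nat \<Rightarrow> ('a list \<Rightarrow> int) \<Rightarrow> bool" where
  "inv_cochain m G n F \<longleftrightarrow>
     (\<forall>g\<in>carrier G. \<forall>gs\<in>tuples G (Suc n). [F (map ((\<otimes>\<^bsub>G\<^esub>) g) gs) = F gs] (mod m))"

definition is_cocycle :: "int \<Rightarrow> ('a, 'm) monoid_scheme \<Rightarrow> nat \<Rightarrow> ('a list \<Rightarrow> int) \<Rightarrow> bool" where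
  "is_cocycle m G n F \<longleftrightarrow> inv_cochain m G n F \<and> (\<forall>gs\<in>tuples G (Suc (Suc n)). [sd F gs = 0] (mod m))"

text \<open>
  The cup product of a homomorphism with a cochain: \<open>\<alpha>\<close> corresponds to the homogeneous
  cochain \<open>(g\<^sub>0, g\<^sub>1) \<mapsto> \<alpha> g\<^sub>1 - \<alpha> g\<^sub>0\<close>.
\<close>

definition cup1 :: "('a \<Rightarrow> int) \<Rightarrow> ('a list \<Rightarrow> int) \<Rightarrow> 'a list \<Rightarrow> int" where
  "cup1 \<alpha> F gs = (\<alpha> (gs ! 1) - \<alpha> (gs ! 0)) * F (tl gs)"

text \<open>
  The cocycles whose classes lie in the subalgebra generated in degree one. Products with a single
  homomorphism on the left suffice to form all monomials, which keeps induction over the products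
  one-sided. Coboundaries enter only in positive degree: in degree \<open>0\<close> there are none.
\<close>

inductive gen1 :: "int \<Rightarrow> ('a, 'm) monoid_scheme \<Rightarrow> nat \<Rightarrow> ('a list \<Rightarrow> int) \<Rightarrow> bool"
  for m :: int and G :: "('a, 'm) monoid_scheme"
where
  const: "(\<And>gs. gs \<in> tuples G 1 \<Longrightarrow> [F gs = a] (mod m)) \<Longrightarrow> gen1 m G 0 F"
| cup: "gen1 m G n F \<Longrightarrow> hom_mod m G \<alpha> \<Longrightarrow> gen1 m G (Suc n) (cup1 \<alpha> F)"
| add: "gen1 m G n F \<Longrightarrow> gen1 m G n F' \<Longrightarrow> gen1 m G n (\<lambda>gs. F gs + F' gs)"
| coh: "gen1 m G (Suc n) F \<Longrightarrow> inv_cochain m G n U \<Longrightarrow>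
    (\<And>gs. gs \<in> tuples G (Suc (Suc n)) \<Longrightarrow> [F' gs = F gs + sd U gs] (mod m)) \<Longrightarrow> gen1 m G (Suc n) F'"

lemma tuples_take: "gs \<in> tuples G n \<Longrightarrow> k \<le> n \<Longrightarrow> take k gs \<in> tuples G k"
  by (auto simp: tuples_def dest: in_set_takeD)

lemma tuples_drop: "gs \<in> tuples G n \<Longrightarrow> drop k gs \<in> tuples G (n - k)"
  by (auto simp: tuples_def dest: in_set_dropD)

lemma tuples_Suc_conv: "gs \<in> tuples G (Suc n) \<longleftrightarrow> (\<exists>g hs. gs = g # hs \<and> g \<in> carrier G \<and> hs \<in> tuples G n)"
  by (cases gs) (auto simp: tuples_def)

lemma gen1_0_const:
  "gen1 m G n F \<Longrightarrow> n = 0 \<Longrightarrow> \<exists>a. \<forall>gs\<in>tuples G 1. [F gs = a] (mod m)"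
proof (induction rule: gen1.induct)
  case (add n F F')
  then obtain a b where "\<forall>gs\<in>tuples G 1. [F gs = a] (mod m)" "\<forall>gs\<in>tuples G 1. [F' gs = b] (mod m)"
    by blast
  then have "\<forall>gs\<in>tuples G 1. [F gs + F' gs = a + b] (mod m)"
    by (auto intro: cong_add)
  then show ?case ..
qed auto

lemma inv_cochain_zero: "inv_cochain m G n (\<lambda>_. 0)"
  by (simp add: inv_cochain_def)

lemma gen1_cong:
  assumes "gen1 m G n F" "\<And>gs. gs \<in> tuples G (Suc n) \<Longrightarrow> [F' gs = F gs] (mod m)"
  shows "gen1 m G n F'"
proof (cases n)
  case 0
  then obtain a where "\<forall>gs\<in>tuples G 1. [F gs = a] (mod m)"
    using gen1_0_const[OF assms(1)] by blast
  then show ?thesis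
    unfolding 0 using assms(2) 0 by (intro gen1.const[of _ _ a]) (metis One_nat_def cong_trans)
next
  case (Suc k)
  show ?thesis
    unfolding Suc by (rule gen1.coh[OF assms(1)[unfolded Suc] inv_cochain_zero])
      (use assms(2) Suc in \<open>simp add: sd_zero\<close>)
qed

text \<open>
  The cocycle of \<open>\<alpha>\<close> is the coboundary of the noninvariant function \<open>\<alpha> \<circ> hd\<close>. Hence multiplying
  \<open>F\<close> by \<open>\<alpha> \<circ> hd\<close> produces a noninvariant primitive of \<open>cup1 \<alpha> F\<close>, up to a multiple of \<open>sd F\<close>.
\<close>

lemma sd_hd_mult:
  assumes "gs \<noteq> []"
  shows "sd (\<lambda>ys. \<alpha> (hd ys) * F ys) (g # gs) = cup1 \<alpha> F (g # gs) + \<alpha> g * sd F (g # gs)"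
proof -
  have "sd (\<lambda>ys. \<alpha> (hd (g # ys)) * F (g # ys)) gs = \<alpha> g * sd (\<lambda>ys. F (g # ys)) gs"
    by (simp add: sd_mult)
  moreover have "\<alpha> (hd gs) = \<alpha> ((g # gs) ! 1)"
    using assms by (simp add: hd_conv_nth)
  ultimately show ?thesis
    by (simp add: cup1_def algebra_simps)
qed

lemma sd_cup1:
  assumes F: "\<And>gs. gs \<in> tuples G (Suc (Suc n)) \<Longrightarrow> [sd F gs = 0] (mod m)"
    and gs: "gs \<in> tuples G (Suc (Suc (Suc n)))"
  shows "[sd (cup1 \<alpha> F) gs = 0] (mod m)"
proof -
  have "[sd (cup1 \<alpha> F) gs = sd (\<lambda>hs. sd (\<lambda>ys. \<alpha> (hd ys) * F ys) hs) gs] (mod m)"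
  proof (rule sd_cong_mod)
    fix as b bs assume e: "gs = as @ b # bs"
    then have t: "as @ bs \<in> tuples G (Suc (Suc n))"
      using gs by (auto simp: tuples_def)
    then obtain g hs where g: "as @ bs = g # hs" "hs \<in> tuples G (Suc n)"
      unfolding tuples_Suc_conv[of _ _ "Suc n"] by blast
    then have ne: "hs \<noteq> []"
      by (auto simp: tuples_def)
    have "[sd (\<lambda>ys. \<alpha> (hd ys) * F ys) (as @ bs) - cup1 \<alpha> F (as @ bs) = 0] (mod m)"
      unfolding g(1) sd_hd_mult[OF ne] using F[OF t[unfolded g(1)]] by (simp add: cong_0_iff del: sd.simps)
    then show "[cup1 \<alpha> F (as @ bs) = sd (\<lambda>ys. \<alpha> (hd ys) * F ys) (as @ bs)] (mod m)"
      using cong_diff_iff_cong_0 cong_sym by blast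
  qed
  then show ?thesis
    by (simp add: sd_sd)
qed

context group
begin

lemma inv_cochain_add:
  "inv_cochain m G n F \<Longrightarrow> inv_cochain m G n F' \<Longrightarrow> inv_cochain m G n (\<lambda>gs. F gs + F' gs)"
  by (auto simp: inv_cochain_def intro: cong_add)

lemma inv_cochain_mult:
  "inv_cochain m G n F \<Longrightarrow> inv_cochain m G n (\<lambda>gs. a * F gs)"
  by (auto simp: inv_cochain_def intro: cong_scalar_left)

lemma inv_cochain_sd:
  assumes U: "inv_cochain m G n U"
  shows "inv_cochain m G (Suc n) (sd U)"
  unfolding inv_cochain_def
proof (intro ballI)
  fix g gs assume g: "g \<in> carrier G" and gs: "gs \<in> tuples G (Suc (Suc n))"
  have "[sd (\<lambda>ys. U (map ((\<otimes>) g) ys)) gs = sd U gs] (mod m)"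
  proof (rule sd_cong_mod)
    fix as b bs assume "gs = as @ b # bs"
    then have "as @ bs \<in> tuples G (Suc n)"
      using gs by (auto simp: tuples_def)
    then show "[U (map ((\<otimes>) g) (as @ bs)) = U (as @ bs)] (mod m)"
      using U g unfolding inv_cochain_def by blast
  qed
  then show "[sd U (map ((\<otimes>) g) gs) = sd U gs] (mod m)"
    by (simp add: sd_map)
qed

lemma inv_cochain_cong:
  assumes "inv_cochain m G n F" "\<And>gs. gs \<in> tuples G (Suc n) \<Longrightarrow> [F' gs = F gs] (mod m)"
  shows "inv_cochain m G n F'"
  unfolding inv_cochain_def
proof (intro ballI)
  fix g gs assume g: "g \<in> carrier G" and gs: "gs \<in> tuples G (Suc n)"
  have "[F' (map ((\<otimes>) g) gs) = F (map ((\<otimes>) g) gs)] (mod m)"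
    using g gs by (intro assms(2) tuples_translate)
  also have "[F (map ((\<otimes>) g) gs) = F gs] (mod m)"
    using assms(1) g gs unfolding inv_cochain_def by blast
  also have "[F gs = F' gs] (mod m)"
    using assms(2)[OF gs] by (rule cong_sym)
  finally show "[F' (map ((\<otimes>) g) gs) = F' gs] (mod m)" .
qed

lemma inv_cochain_cup1:
  assumes F: "inv_cochain m G n F" and \<alpha>: "hom_mod m G \<alpha>"
  shows "inv_cochain m G (Suc n) (cup1 \<alpha> F)"
  unfolding inv_cochain_def
proof (intro ballI)
  fix g gs assume g: "g \<in> carrier G" and gs: "gs \<in> tuples G (Suc (Suc n))"
  then obtain x y hs where gs': "gs = x # y # hs" "x \<in> carrier G" "y \<in> carrier G" "y # hs \<in> tuples G (Suc n)"
    by (auto simp: tuples_Suc_conv)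
  have "[\<alpha> (g \<otimes> y) - \<alpha> (g \<otimes> x) = (\<alpha> g + \<alpha> y) - (\<alpha> g + \<alpha> x)] (mod m)"
    using \<alpha> g gs' by (intro cong_diff) (auto simp: hom_mod_def)
  moreover have "[F (map ((\<otimes>) g) (y # hs)) = F (y # hs)] (mod m)"
    using F g gs'(4) unfolding inv_cochain_def by blast
  ultimately have "[(\<alpha> (g \<otimes> y) - \<alpha> (g \<otimes> x)) * F (map ((\<otimes>) g) (y # hs)) = ((\<alpha> g + \<alpha> y) - (\<alpha> g + \<alpha> x)) * F (y # hs)] (mod m)"
    by (rule cong_mult)
  then show "[cup1 \<alpha> F (map ((\<otimes>) g) gs) = cup1 \<alpha> F gs] (mod m)"
    by (simp add: cup1_def gs'(1))
qed

lemma gen1_cocycle: "gen1 m G n F \<Longrightarrow> is_cocycle m G n F"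
proof (induction rule: gen1.induct)
  case (const F a)
  have "[F gs = F hs] (mod m)" if "gs \<in> tuples G 1" "hs \<in> tuples G 1" for gs hs
    using const[OF that(1)] const[OF that(2)] cong_sym cong_trans by blast
  moreover have "[sd F gs = 0] (mod m)" if gs: "gs \<in> tuples G (Suc (Suc 0))" for gs
  proof -
    obtain g h where gh: "gs = [g, h]"
      using gs by (auto simp: tuples_def length_Suc_conv)
    then have gh': "[g] \<in> tuples G 1" "[h] \<in> tuples G 1"
      using gs by (auto simp: tuples_def)
    have "[F [h] - F [g] = a - a] (mod m)"
      using const[OF gh'(1)] const[OF gh'(2)] by (intro cong_diff)
    then show ?thesis
      by (simp add: gh)
  qed
  ultimately show ?case
    by (simp add: is_cocycle_def inv_cochain_def tuples_translate)
next
  case (cup n F \<alpha>)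
  then show ?case
    using inv_cochain_cup1 sd_cup1[of G n F m] unfolding is_cocycle_def by blast
next
  case (add n F F')
  have "[sd F gs + sd F' gs = 0 + 0] (mod m)" if "gs \<in> tuples G (Suc (Suc n))" for gs
    using add that unfolding is_cocycle_def by (intro cong_add) auto
  then show ?case
    using add inv_cochain_add by (simp add: is_cocycle_def sd_add)
next
  case (coh n F U F')
  have "inv_cochain m G (Suc n) F"
    using coh.IH by (simp add: is_cocycle_def)
  then have "inv_cochain m G (Suc n) (\<lambda>gs. F gs + sd U gs)"
    by (rule inv_cochain_add[OF _ inv_cochain_sd[OF coh.hyps(2)]])
  then have "inv_cochain m G (Suc n) F'"
    by (rule inv_cochain_cong) (rule coh.hyps(3))
  moreover have "[sd F' gs = 0] (mod m)" if gs: "gs \<in> tuples G (Suc (Suc (Suc n)))" for gs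
  proof -
    have "[sd F' gs = sd (\<lambda>ys. F ys + sd U ys) gs] (mod m)"
    proof (rule sd_cong_mod)
      fix as b bs assume "gs = as @ b # bs"
      then have "as @ bs \<in> tuples G (Suc (Suc n))"
        using gs by (auto simp: tuples_def)
      then show "[F' (as @ bs) = F (as @ bs) + sd U (as @ bs)] (mod m)"
        by (rule coh.hyps)
    qed
    also have "sd (\<lambda>ys. F ys + sd U ys) gs = sd F gs"
      by (simp add: sd_add sd_sd)
    also have "[sd F gs = 0] (mod m)"
      using coh gs by (simp add: is_cocycle_def)
    finally show ?thesis .
  qed
  ultimately show ?case
    by (simp add: is_cocycle_def)
qed

lemma gen1_mult: "gen1 m G n F \<Longrightarrow> gen1 m G n (\<lambda>gs. a * F gs)"
proof (induction rule: gen1.induct)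
  case (const F b)
  then show ?case
    by (intro gen1.const[of _ _ "a * b"] cong_scalar_left)
next
  case (cup n F \<alpha>)
  show ?case
    by (rule gen1_cong[OF gen1.cup[OF cup.IH cup.hyps(2)]]) (simp add: cup1_def ac_simps)
next
  case (add n F F')
  show ?case
    by (rule gen1_cong[OF gen1.add[OF add.IH]]) (simp add: algebra_simps)
next
  case (coh n F U F')
  show ?case
  proof (rule gen1.coh[OF coh.IH inv_cochain_mult[OF coh.hyps(2)]])
    fix gs assume "gs \<in> tuples G (Suc (Suc n))"
    then have "[a * F' gs = a * (F gs + sd U gs)] (mod m)"
      using coh.hyps(3) by (intro cong_scalar_left)
    then show "[a * F' gs = a * F gs + sd (\<lambda>gs. a * U gs) gs] (mod m)"
      by (simp add: sd_mult algebra_simps)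
  qed
qed

lemma gen1_zero: "gen1 m G n (\<lambda>_. 0)"
proof (induction n)
  case 0
  show ?case
    by (rule gen1.const[of _ _ 0]) simp
next
  case (Suc n)
  have "hom_mod m G (\<lambda>_. 0)"
    by (simp add: hom_mod_def)
  from gen1_cong[OF gen1.cup[OF Suc this]] show ?case
    by (simp add: cup1_def)
qed

lemma gen1_coboundary: "inv_cochain m G n U \<Longrightarrow> gen1 m G (Suc n) (sd U)"
  by (rule gen1.coh[OF gen1_zero]) auto

text \<open>
  The cup product of homogeneous cochains, the first one of degree \<open>k\<close>: the two factors share the
  entry at position \<open>k\<close>.
\<close>

definition cupk :: "nat \<Rightarrow> ('a list \<Rightarrow> int) \<Rightarrow> ('a list \<Rightarrow> int) \<Rightarrow> 'a list \<Rightarrow> int" where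
  "cupk k F H gs = F (take (Suc k) gs) * H (drop k gs)"

end

lemma leibniz:
  assumes "Suc k < length gs"
  shows "sd (\<lambda>gs. F (take (Suc k) gs) * H (drop k gs)) gs
    = sd F (take (Suc (Suc k)) gs) * H (drop (Suc k) gs) + (- 1) ^ k * F (take (Suc k) gs) * sd H (drop k gs)"
  using assms
proof (induction k arbitrary: F gs)
  case 0
  then obtain g h hs where gs: "gs = g # h # hs"
    by (cases gs; cases "tl gs") auto
  have "sd (\<lambda>ys. F [g] * H (g # ys)) (h # hs) = F [g] * sd (\<lambda>ys. H (g # ys)) (h # hs)"
    by (rule sd_mult)
  then show ?case
    by (simp add: gs algebra_simps del: sd.simps) (simp add: algebra_simps)
next
  case (Suc k)
  then obtain g hs where gs: "gs = g # hs" "Suc k < length hs"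
    by (cases gs) auto
  have "sd (\<lambda>gs. F (take (Suc (Suc k)) gs) * H (drop (Suc k) gs)) gs
      = F (take (Suc (Suc k)) hs) * H (drop (Suc k) hs)
        - sd (\<lambda>ys. F (g # take (Suc k) ys) * H (drop k ys)) hs"
    by (simp add: gs(1))
  also have "sd (\<lambda>ys. F (g # take (Suc k) ys) * H (drop k ys)) hs
      = sd (\<lambda>ys. F (g # ys)) (take (Suc (Suc k)) hs) * H (drop (Suc k) hs)
        + (- 1) ^ k * F (g # take (Suc k) hs) * sd H (drop k hs)"
    using Suc.IH[OF gs(2), of "\<lambda>ys. F (g # ys)"] by simp
  finally show ?case
    by (simp add: gs(1) algebra_simps)
qed

context group
begin

lemma inv_cochain_cupk:
  assumes F: "inv_cochain m G k F" and H: "inv_cochain m G n H"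
  shows "inv_cochain m G (k + n) (cupk k F H)"
  unfolding inv_cochain_def
proof (intro ballI)
  fix g gs assume g: "g \<in> carrier G" and gs: "gs \<in> tuples G (Suc (k + n))"
  have "[F (map ((\<otimes>) g) (take (Suc k) gs)) = F (take (Suc k) gs)] (mod m)"
    using F g tuples_take[OF gs, of "Suc k"] unfolding inv_cochain_def by simp
  moreover have "[H (map ((\<otimes>) g) (drop k gs)) = H (drop k gs)] (mod m)"
    using H g tuples_drop[OF gs, of k] unfolding inv_cochain_def by simp
  ultimately show "[cupk k F H (map ((\<otimes>) g) gs) = cupk k F H gs] (mod m)"
    unfolding cupk_def take_map drop_map by (rule cong_mult)
qed

lemma cupk_coboundary:
  assumes H: "is_cocycle m G n H" and gs: "gs \<in> tuples G (Suc (Suc (k + n)))"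
  shows "[cupk (Suc k) (sd U) H gs = sd (cupk k U H) gs] (mod m)"
proof -
  have "drop k gs \<in> tuples G (Suc (Suc n))"
    using tuples_drop[OF gs, of k] by simp
  then have "[sd H (drop k gs) = 0] (mod m)"
    using H by (simp add: is_cocycle_def)
  moreover have "sd (cupk k U H) gs = cupk (Suc k) (sd U) H gs
      + (- 1) ^ k * U (take (Suc k) gs) * sd H (drop k gs)"
    unfolding cupk_def[abs_def] using gs by (subst leibniz) (auto simp: tuples_def)
  ultimately show ?thesis
    by (simp add: cong_iff_dvd_diff cong_0_iff)
qed

lemma cupk_coboundary_right:
  assumes F: "is_cocycle m G k F" and gs: "gs \<in> tuples G (Suc (Suc (k + n)))"
  shows "[cupk k F (sd U) gs = sd (cupk k F (\<lambda>ys. (- 1) ^ k * U ys)) gs] (mod m)"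
proof -
  have "take (Suc (Suc k)) gs \<in> tuples G (Suc (Suc k))"
    using tuples_take[OF gs, of "Suc (Suc k)"] by simp
  then have "[sd F (take (Suc (Suc k)) gs) = 0] (mod m)"
    using F by (simp add: is_cocycle_def)
  moreover have "sd (cupk k F (\<lambda>ys. (- 1) ^ k * U ys)) gs
      = sd F (take (Suc (Suc k)) gs) * ((- 1) ^ k * U (drop (Suc k) gs)) + cupk k F (sd U) gs"
    unfolding cupk_def[abs_def] using gs
    by (subst leibniz) (auto simp: tuples_def sd_mult simp flip: power_add mult.assoc mult_2)
  ultimately show ?thesis
    by (simp add: cong_iff_dvd_diff cong_0_iff)
qed

lemma gen1_cupk:
  assumes "gen1 m G k F" and H: "gen1 m G n H"
  shows "gen1 m G (k + n) (cupk k F H)"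
  using assms(1)
proof (induction rule: gen1.induct)
  case (const F a)
  have "gen1 m G n (cupk 0 F H)"
  proof (rule gen1_cong[OF gen1_mult[OF H, of a]])
    fix gs assume "gs \<in> tuples G (Suc n)"
    then have "[F (take 1 gs) = a] (mod m)"
      using tuples_take[of gs G "Suc n" 1] const by simp
    then show "[cupk 0 F H gs = a * H gs] (mod m)"
      by (simp add: cupk_def cong_scalar_right)
  qed
  then show ?case
    by simp
next
  case (cup k F \<alpha>)
  have "gen1 m G (Suc (k + n)) (cupk (Suc k) (cup1 \<alpha> F) H)"
  proof (rule gen1_cong[OF gen1.cup[OF cup.IH cup.hyps(2)]])
    fix gs assume "gs \<in> tuples G (Suc (Suc (k + n)))"
    then obtain x y hs where "gs = x # y # hs"
      by (auto simp: tuples_Suc_conv)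
    then show "[cupk (Suc k) (cup1 \<alpha> F) H gs = cup1 \<alpha> (cupk k F H) gs] (mod m)"
      by (simp add: cupk_def cup1_def ac_simps)
  qed
  then show ?case
    by simp
next
  case (add k F F')
  show ?case
    by (rule gen1_cong[OF gen1.add[OF add.IH]]) (simp add: cupk_def algebra_simps)
next
  case (coh k F U F')
  have Hc: "is_cocycle m G n H"
    using H by (rule gen1_cocycle)
  have "gen1 m G (Suc (k + n)) (cupk (Suc k) F' H)"
  proof (rule gen1.coh[OF _ inv_cochain_cupk[OF coh.hyps(2), of n H]])
    show "gen1 m G (Suc (k + n)) (cupk (Suc k) F H)"
      using coh.IH by simp
    show "inv_cochain m G n H"
      using Hc by (simp add: is_cocycle_def)
    fix gs assume gs: "gs \<in> tuples G (Suc (Suc (k + n)))"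
    have "[F' (take (Suc (Suc k)) gs) = F (take (Suc (Suc k)) gs) + sd U (take (Suc (Suc k)) gs)] (mod m)"
      using tuples_take[OF gs, of "Suc (Suc k)"] by (intro coh.hyps(3)) simp
    then have "[F' (take (Suc (Suc k)) gs) * H (drop (Suc k) gs)
        = (F (take (Suc (Suc k)) gs) + sd U (take (Suc (Suc k)) gs)) * H (drop (Suc k) gs)] (mod m)"
      by (rule cong_scalar_right)
    then have "[cupk (Suc k) F' H gs = cupk (Suc k) F H gs + cupk (Suc k) (sd U) H gs] (mod m)"
      by (simp add: cupk_def algebra_simps)
    also have "[cupk (Suc k) F H gs + cupk (Suc k) (sd U) H gs
        = cupk (Suc k) F H gs + sd (cupk k U H) gs] (mod m)"
      by (intro cong_add cupk_coboundary[OF Hc gs]) simp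
    finally show "[cupk (Suc k) F' H gs = cupk (Suc k) F H gs + sd (cupk k U H) gs] (mod m)" .
  qed
  then show ?case
    by simp
qed

end

lemma gen1_pullback:
  assumes "gen1 m S n F" and G: "group G" and S: "group S"
    and \<rho>: "\<rho> \<in> hom G S"
  shows "gen1 m G n (\<lambda>gs. F (map \<rho> gs))"
  using assms(1)
proof (induction rule: gen1.induct)
  interpret G: group G by (rule G)
  have tup: "map \<rho> gs \<in> tuples S n" if "gs \<in> tuples G n" for gs n
    using that \<rho> by (auto simp: tuples_def hom_def)
  {
    case (const F a)
    show ?case
      by (rule gen1.const) (rule const[OF tup])
  next
    case (cup n F \<alpha>)
    have "hom_mod m G (\<lambda>g. \<alpha> (\<rho> g))"
      using cup.hyps(2) \<rho> by (auto simp: hom_mod_def hom_def)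
    from gen1.cup[OF cup.IH this] show ?case
    proof (rule gen1_cong)
      fix gs assume "gs \<in> tuples G (Suc (Suc n))"
      then obtain x y hs where "gs = x # y # hs"
        by (auto simp: tuples_Suc_conv)
      then show "[cup1 \<alpha> F (map \<rho> gs) = cup1 (\<lambda>g. \<alpha> (\<rho> g)) (\<lambda>gs. F (map \<rho> gs)) gs] (mod m)"
        by (simp add: cup1_def)
    qed
  next
    case (add n F F')
    then show ?case
      by (intro gen1.add)
  next
    case (coh n F U F')
    show ?case
    proof (rule gen1.coh[OF coh.IH])
      show "inv_cochain m G n (\<lambda>gs. U (map \<rho> gs))"
        unfolding inv_cochain_def
      proof (intro ballI)
        fix g gs assume g: "g \<in> carrier G" and gs: "gs \<in> tuples G (Suc n)"
        have "map \<rho> (map ((\<otimes>\<^bsub>G\<^esub>) g) gs) = map ((\<otimes>\<^bsub>S\<^esub>) (\<rho> g)) (map \<rho> gs)"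
          using gs g \<rho> by (auto simp: tuples_def hom_def)
        moreover have "\<rho> g \<in> carrier S"
          using g \<rho> by (auto simp: hom_def)
        ultimately show "[U (map \<rho> (map ((\<otimes>\<^bsub>G\<^esub>) g) gs)) = U (map \<rho> gs)] (mod m)"
          using coh.hyps(2) tup[OF gs] unfolding inv_cochain_def by metis
      qed
      fix gs assume "gs \<in> tuples G (Suc (Suc n))"
      then have "[F' (map \<rho> gs) = F (map \<rho> gs) + sd U (map \<rho> gs)] (mod m)"
        by (intro coh.hyps(3) tup)
      then show "[F' (map \<rho> gs) = F (map \<rho> gs) + sd (\<lambda>gs. U (map \<rho> gs)) gs] (mod m)"
        by (simp add: sd_map)
    qed
  }
qed

lemma prism_map:
  assumes "\<And>x. x \<in> set xs \<Longrightarrow> \<phi> (\<psi> x) = \<psi> (\<phi> x)"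
  shows "prism \<phi> f (map \<psi> xs) = prism \<phi> (\<lambda>ys. f (map \<psi> ys)) xs"
  using assms
proof (induction xs arbitrary: f)
  case (Cons x xs)
  have "map \<phi> (map \<psi> xs) = map \<psi> (map \<phi> xs)"
    using Cons.prems by simp
  then show ?case
    using Cons by (simp del: map_map)
qed simp

lemma prism_cong_mod:
  assumes "\<And>as b bs. xs = as @ b # bs \<Longrightarrow>
    [f (as @ b # map \<phi> (b # bs)) = g (as @ b # map \<phi> (b # bs))] (mod m)"
  shows "[prism \<phi> f xs = prism \<phi> g xs] (mod m)"
proof -
  have "[prism \<phi> (\<lambda>ys. f ys - g ys) xs = 0] (mod m)"
    by (rule prism_cong_zero) (use assms cong_diff_iff_cong_0 in blast)
  then show ?thesis
    by (simp add: prism_diff cong_diff_iff_cong_0)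
qed

context group
begin

text \<open>
  Pulling back along \<open>\<phi>\<close> changes a cocycle by the differential of its prism. In general this prism is
  invariant only under translations that commute with \<open>\<phi>\<close> (see \<open>prism_translate\<close>), so it need not be
  a coboundary in the cohomology of \<open>G\<close>.
\<close>

lemma prism_cocycle:
  assumes F: "is_cocycle m G n F" and \<phi>: "\<phi> \<in> carrier G \<rightarrow> carrier G" and gs: "gs \<in> tuples G (Suc n)"
  shows "[sd (prism \<phi> F) gs = F (map \<phi> gs) - F gs] (mod m)"
proof -
  have "[prism \<phi> (sd F) gs = 0] (mod m)"
  proof (rule prism_cong_zero)
    fix as b bs assume "gs = as @ b # bs"
    then have "as @ b # map \<phi> (b # bs) \<in> tuples G (Suc (Suc n))"
      using gs \<phi> by (auto simp: tuples_def)
    then show "[sd F (as @ b # map \<phi> (b # bs)) = 0] (mod m)"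
      using F unfolding is_cocycle_def by blast
  qed
  then show ?thesis
    using prism_homotopy[of \<phi> F gs] by (metis cong_add_lcancel cong_sym add.right_neutral)
qed

lemma prism_translate:
  assumes F: "inv_cochain m G n F" and \<phi>: "\<phi> \<in> carrier G \<rightarrow> carrier G"
    and g: "g \<in> carrier G" "\<And>x. x \<in> carrier G \<Longrightarrow> \<phi> (g \<otimes> x) = g \<otimes> \<phi> x"
    and gs: "gs \<in> tuples G n"
  shows "[prism \<phi> F (map ((\<otimes>) g) gs) = prism \<phi> F gs] (mod m)"
proof -
  have "prism \<phi> F (map ((\<otimes>) g) gs) = prism \<phi> (\<lambda>ys. F (map ((\<otimes>) g) ys)) gs"
    using gs g(2) by (intro prism_map) (auto simp: tuples_def)
  also have "[\<dots> = prism \<phi> F gs] (mod m)"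
  proof (rule prism_cong_mod)
    fix as b bs assume "gs = as @ b # bs"
    then have "as @ b # map \<phi> (b # bs) \<in> tuples G (Suc n)"
      using gs \<phi> by (auto simp: tuples_def)
    then show "[F (map ((\<otimes>) g) (as @ b # map \<phi> (b # bs))) = F (as @ b # map \<phi> (b # bs))] (mod m)"
      using F g(1) unfolding inv_cochain_def by blast
  qed
  finally show ?thesis .
qed

lemma gen1_degree_zero:
  assumes F: "is_cocycle m G 0 F"
  shows "gen1 m G 0 F"
proof (rule gen1.const)
  fix gs assume gs: "gs \<in> tuples G 1"
  then obtain g where g: "gs = [g]" "g \<in> carrier G"
    by (auto simp: tuples_def length_Suc_conv)
  then have "[\<one>, g] \<in> tuples G (Suc (Suc 0))"
    by (simp add: tuples_def)
  then have "[sd F [\<one>, g] = 0] (mod m)"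
    using F unfolding is_cocycle_def by blast
  then show "[F gs = F [\<one>]] (mod m)"
    using g by (simp add: cong_diff_iff_cong_0)
qed

lemma inv_cochainI_generators:
  assumes "\<And>g. g \<in> carrier G \<Longrightarrow> \<exists>h\<in>A. \<exists>k\<in>B. g = h \<otimes> k"
    and AB: "A \<subseteq> carrier G" "B \<subseteq> carrier G"
    and F: "\<And>g gs. g \<in> A \<union> B \<Longrightarrow> gs \<in> tuples G (Suc n) \<Longrightarrow> [F (map ((\<otimes>) g) gs) = F gs] (mod m)"
  shows "inv_cochain m G n F"
  unfolding inv_cochain_def
proof (intro ballI)
  fix g gs assume g: "g \<in> carrier G" and gs: "gs \<in> tuples G (Suc n)"
  obtain h k where hk: "h \<in> A" "k \<in> B" "g = h \<otimes> k"
    using assms(1)[OF g] by blast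
  then have c: "h \<in> carrier G" "k \<in> carrier G"
    using AB by auto
  have "map ((\<otimes>) g) gs = map ((\<otimes>) h) (map ((\<otimes>) k) gs)"
    using gs c hk(3) by (auto simp: tuples_def m_assoc)
  then have "[F (map ((\<otimes>) g) gs) = F (map ((\<otimes>) k) gs)] (mod m)"
    using F[of h "map ((\<otimes>) k) gs"] tuples_translate[OF c(2) gs] hk by (simp del: map_map)
  also have "[F (map ((\<otimes>) k) gs) = F gs] (mod m)"
    using F[of k gs] gs hk by simp
  finally show "[F (map ((\<otimes>) g) gs) = F gs] (mod m)" .
qed

lemma is_cocycle_subgroup:
  assumes "subgroup H G" "is_cocycle m G n F"
  shows "is_cocycle m (G\<lparr>carrier := H\<rparr>) n F"
proof -
  have "tuples (G\<lparr>carrier := H\<rparr>) k \<subseteq> tuples G k" for k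
    using subgroup.subset[OF assms(1)] by (auto simp: tuples_def)
  then show ?thesis
    using assms(2) subgroup.subset[OF assms(1)] unfolding is_cocycle_def inv_cochain_def
    by (auto simp: subset_iff)
qed

end

section \<open>Elementary abelian groups and normal complements of odd order\<close>

text \<open>
  \<open>H\<close> is a maximal subgroup among those that avoid \<open>\<tau>\<close>. If \<open>x\<close> lies outside \<open>H\<close>, then \<open>H \<union> x H\<close> is a
  larger subgroup, hence contains \<open>\<tau>\<close>; so \<open>\<tau> \<in> x H\<close> and \<open>\<tau> x \<in> H\<close>.
\<close>

lemma (in comm_group) elementary_split:
  assumes fin: "finite (carrier G)" and sq: "\<And>x. x \<in> carrier G \<Longrightarrow> x \<otimes> x = \<one>"
    and nt: "carrier G \<noteq> {\<one>}"
  obtains H \<tau> where "subgroup H G" "\<tau> \<in> carrier G" "\<tau> \<notin> H"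
    "\<And>x. x \<in> carrier G \<Longrightarrow> x \<notin> H \<Longrightarrow> \<tau> \<otimes> x \<in> H"
proof -
  obtain \<tau> where \<tau>: "\<tau> \<in> carrier G" "\<tau> \<noteq> \<one>"
    using nt one_closed by blast
  define A where "A = {H. subgroup H G \<and> \<tau> \<notin> H}"
  have "A \<subseteq> Pow (carrier G)"
    by (auto simp: A_def dest: subgroup.subset)
  then have "finite A"
    using fin finite_subset by blast
  moreover have "{\<one>} \<in> A"
    using \<tau> by (simp add: A_def triv_subgroup)
  ultimately obtain H where H: "H \<in> A" "\<forall>H'\<in>A. H \<subseteq> H' \<longrightarrow> H = H'"
    using finite_has_maximal[of A] by blast
  then interpret H: subgroup H G
    by (simp add: A_def)
  have inv_self: "inv x = x" if "x \<in> carrier G" for x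
    using sq[OF that] that by (simp add: inv_equality)
  have "\<tau> \<otimes> x \<in> H" if x: "x \<in> carrier G" "x \<notin> H" for x
  proof -
    define H' where "H' = H \<union> (\<otimes>) x ` H"
    have "subgroup H' G"
    proof (rule subgroupI)
      show sub: "H' \<subseteq> carrier G"
        using x H.subset by (auto simp: H'_def)
      show "H' \<noteq> {}"
        unfolding H'_def using H.one_closed by blast
      show "inv a \<in> H'" if "a \<in> H'" for a
        using inv_self[of a] that sub by auto
      have 1: "x \<otimes> h \<otimes> k \<in> H'" "k \<otimes> (x \<otimes> h) \<in> H'" if "h \<in> H" "k \<in> H" for h k
      proof -
        have "x \<otimes> h \<otimes> k = x \<otimes> (h \<otimes> k)" "k \<otimes> (x \<otimes> h) = x \<otimes> (k \<otimes> h)"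
          using that x by (simp_all add: m_ac)
        then show "x \<otimes> h \<otimes> k \<in> H'" "k \<otimes> (x \<otimes> h) \<in> H'"
          using that by (auto simp: H'_def)
      qed
      have 2: "x \<otimes> h \<otimes> (x \<otimes> k) \<in> H'" if "h \<in> H" "k \<in> H" for h k
      proof -
        have "x \<otimes> h \<otimes> (x \<otimes> k) = (x \<otimes> x) \<otimes> (h \<otimes> k)"
          using that x by (simp add: m_ac)
        then show ?thesis
          using that sq[OF x(1)] by (simp add: H'_def)
      qed
      show "a \<otimes> b \<in> H'" if "a \<in> H'" "b \<in> H'" for a b
      proof -
        have 0: "h \<otimes> k \<in> H'" if "h \<in> H" "k \<in> H" for h k
          using that by (simp add: H'_def)
        have "a \<in> H \<or> (\<exists>h\<in>H. a = x \<otimes> h)" "b \<in> H \<or> (\<exists>k\<in>H. b = x \<otimes> k)"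
          using that by (auto simp: H'_def)
        then show ?thesis
          by (elim disjE bexE) (simp_all only: 0 1 2)
      qed
    qed
    moreover have "x \<otimes> \<one> \<in> H'"
      unfolding H'_def using H.one_closed by blast
    then have "x \<in> H'"
      using x(1) by simp
    then have "H \<noteq> H'"
      using x by blast
    ultimately have "\<tau> \<in> H'"
      using H(2) unfolding A_def by (auto simp: H'_def)
    then obtain h where h: "h \<in> H" "\<tau> = x \<otimes> h"
      using H(1) by (auto simp: A_def H'_def)
    have "\<tau> \<otimes> x = (x \<otimes> x) \<otimes> h"
      using h x by (simp add: m_ac)
    then show ?thesis
      using h sq[OF x(1)] by simp
  qed
  then show ?thesis
    using that[of H \<tau>] H(1) \<tau>(1) by (simp add: A_def)
qed

lemma cong2_uminus: "[- a = a] (mod (2::int))"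
  by (simp add: cong_iff_dvd_diff)

text \<open>
  A Gysin argument. Let \<open>pr\<close> be the projection \<open>G \<rightarrow> H\<close> with kernel \<open>\<langle>\<tau>\<rangle>\<close>. The prism \<open>w\<close> over \<open>pr\<close>
  joins \<open>F\<close> to its pullback along \<open>pr\<close> but is only \<open>H\<close>-invariant. Its defect of \<open>\<tau>\<close>-invariance,
  \<open>f = \<tau> w - w\<close>, is an invariant cocycle of smaller degree. If \<open>\<theta>\<close> is the homomorphism with kernel
  \<open>H\<close>, then \<open>w + (\<theta> \<circ> hd) f\<close> is fully invariant, and its differential exhibits \<open>F\<close> as the pullback
  plus the product of \<open>\<theta>\<close> and \<open>f\<close>, up to a coboundary.
\<close>

lemma (in comm_group) gen1_index_two:
  assumes sq: "\<And>x. x \<in> carrier G \<Longrightarrow> x \<otimes> x = \<one>"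
    and H: "subgroup H G" and \<tau>: "\<tau> \<in> carrier G" "\<tau> \<notin> H"
    and \<tau>H: "\<And>x. x \<in> carrier G \<Longrightarrow> x \<notin> H \<Longrightarrow> \<tau> \<otimes> x \<in> H"
    and IH: "\<And>n F. is_cocycle 2 (G\<lparr>carrier := H\<rparr>) n F \<Longrightarrow> gen1 2 (G\<lparr>carrier := H\<rparr>) n F"
  shows "is_cocycle 2 G n F \<Longrightarrow> gen1 2 G n F"
proof (induction n arbitrary: F)
  case 0
  then show ?case
    by (rule gen1_degree_zero)
next
  case (Suc n)
  interpret H: subgroup H G
    by (rule H)
  have \<tau>\<tau>: "\<tau> \<otimes> (\<tau> \<otimes> x) = x" if "x \<in> carrier G" for x
    using sq[OF \<tau>(1)] \<tau>(1) that by (simp flip: m_assoc)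
  have \<tau>x: "\<tau> \<otimes> x \<in> H \<longleftrightarrow> x \<notin> H" if x: "x \<in> carrier G" for x
  proof
    assume a: "\<tau> \<otimes> x \<in> H"
    show "x \<notin> H"
    proof
      assume "x \<in> H"
      then have "(\<tau> \<otimes> x) \<otimes> inv x \<in> H"
        using a by simp
      then show False
        using \<tau> x by (simp add: m_assoc)
    qed
  qed (rule \<tau>H[OF x])
  have Hx: "h \<otimes> x \<in> H \<longleftrightarrow> x \<in> H" if "h \<in> H" "x \<in> carrier G" for h x
  proof
    assume "h \<otimes> x \<in> H"
    then have "inv h \<otimes> (h \<otimes> x) \<in> H"
      using that by simp
    then show "x \<in> H"
      using that by (simp flip: m_assoc)
  qed (use that in simp)
  define pr where "pr = (\<lambda>x. if x \<in> H then x else \<tau> \<otimes> x)"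
  define \<theta> where "\<theta> = (\<lambda>x. if x \<in> H then 0 else 1 :: int)"
  have prH: "pr x \<in> H" if "x \<in> carrier G" for x
    using \<tau>H[OF that] by (simp add: pr_def)
  have pr_h: "pr (h \<otimes> x) = h \<otimes> pr x" if "h \<in> H" "x \<in> carrier G" for h x
    using that Hx[OF that] \<tau>(1) by (auto simp: pr_def m_lcomm)
  have pr_\<tau>: "pr (\<tau> \<otimes> x) = pr x" if "x \<in> carrier G" for x
    using \<tau>x[OF that] \<tau>\<tau>[OF that] by (simp add: pr_def)
  have decomp: "\<exists>h\<in>H. \<exists>k\<in>{\<one>, \<tau>}. g = h \<otimes> k" if g: "g \<in> carrier G" for g
  proof (cases "g \<in> H")
    case True
    then show ?thesis
      using g by (intro bexI[of _ g] bexI[of _ \<one>]) auto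
  next
    case False
    have "(\<tau> \<otimes> g) \<otimes> \<tau> = g"
      using \<tau>\<tau>[OF g] \<tau>(1) g by (simp add: m_ac)
    then show ?thesis
      using \<tau>H[OF g False] by (intro bexI[of _ "\<tau> \<otimes> g"] bexI[of _ \<tau>]) auto
  qed
  have pr_hom: "pr \<in> hom G (G\<lparr>carrier := H\<rparr>)"
  proof (rule homI)
    show "pr x \<in> carrier (G\<lparr>carrier := H\<rparr>)" if "x \<in> carrier G" for x
      using prH[OF that] by simp
    show "pr (x \<otimes> y) = pr x \<otimes>\<^bsub>G\<lparr>carrier := H\<rparr>\<^esub> pr y" if x: "x \<in> carrier G" and y: "y \<in> carrier G" for x y
    proof (cases "x \<in> H")
      case True
      then show ?thesis
        using pr_h[OF True y] by (simp add: pr_def)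
    next
      case False
      then have "\<tau> \<otimes> x \<in> H"
        using \<tau>H x by blast
      moreover have "\<tau> \<otimes> x \<otimes> y = \<tau> \<otimes> (x \<otimes> y)"
        using x y \<tau>(1) by (simp add: m_assoc)
      ultimately have "pr (x \<otimes> y) = \<tau> \<otimes> x \<otimes> pr y"
        using pr_h[of "\<tau> \<otimes> x" y] pr_\<tau>[of "x \<otimes> y"] x y by simp
      then show ?thesis
        using False by (simp add: pr_def)
    qed
  qed
  have \<theta>_hom: "hom_mod 2 G \<theta>"
    unfolding hom_mod_def
  proof (intro ballI)
    fix x y assume x: "x \<in> carrier G" and y: "y \<in> carrier G"
    show "[\<theta> (x \<otimes> y) = \<theta> x + \<theta> y] (mod 2)"
    proof (cases "x \<in> H")
      case True
      then show ?thesis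
        using Hx[OF True y] by (simp add: \<theta>_def)
    next
      case False
      then have "\<tau> \<otimes> x \<otimes> y \<in> H \<longleftrightarrow> y \<in> H"
        using Hx[OF \<tau>H[OF x False] y] by simp
      then have "\<tau> \<otimes> (x \<otimes> y) \<in> H \<longleftrightarrow> y \<in> H"
        using x y \<tau>(1) by (simp add: m_assoc)
      then have "x \<otimes> y \<in> H \<longleftrightarrow> y \<notin> H"
        using \<tau>x[of "x \<otimes> y"] x y by blast
      then show ?thesis
        using False by (simp add: \<theta>_def cong_def)
    qed
  qed
  have pr_G: "pr \<in> carrier G \<rightarrow> carrier G"
    using prH H.subset by auto
  define w where "w = prism pr F"
  have F: "is_cocycle 2 G (Suc n) F" "inv_cochain 2 G (Suc n) F"
    using Suc.prems by (auto simp: is_cocycle_def)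
  have sdw: "[sd w gs = F (map pr gs) - F gs] (mod 2)" if "gs \<in> tuples G (Suc (Suc n))" for gs
    unfolding w_def using F(1) pr_G that by (rule prism_cocycle)
  have wH: "[w (map ((\<otimes>) h) gs) = w gs] (mod 2)" if "h \<in> H" "gs \<in> tuples G (Suc n)" for h gs
    unfolding w_def using pr_h that by (intro prism_translate[OF F(2) pr_G]) auto
  define f where "f = (\<lambda>gs. w (map ((\<otimes>) \<tau>) gs) - w gs)"
  have map_\<tau>\<tau>: "map ((\<otimes>) \<tau>) (map ((\<otimes>) \<tau>) gs) = gs" if "gs \<in> tuples G k" for gs k
    using that \<tau>\<tau> by (auto simp: tuples_def intro!: map_idI)
  have map_\<tau>h: "map ((\<otimes>) \<tau>) (map ((\<otimes>) h) gs) = map ((\<otimes>) h) (map ((\<otimes>) \<tau>) gs)"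
    if "h \<in> H" "gs \<in> tuples G k" for h gs k
    using that \<tau>(1) by (auto simp: tuples_def m_lcomm subset_iff)
  have map_one: "map ((\<otimes>) \<one>) gs = gs" if "gs \<in> tuples G k" for gs k
    using that by (auto simp: tuples_def intro!: map_idI)
  have fH: "[f (map ((\<otimes>) h) gs) = f gs] (mod 2)" if h: "h \<in> H" and gs: "gs \<in> tuples G (Suc n)" for h gs
    unfolding f_def map_\<tau>h[OF h gs]
    using wH[OF h gs] wH[OF h tuples_translate[OF \<tau>(1) gs]] by (rule cong_diff[rotated])
  have f\<tau>: "[f (map ((\<otimes>) \<tau>) gs) = f gs] (mod 2)" if gs: "gs \<in> tuples G (Suc n)" for gs
    using cong2_uminus[of "f gs"] by (simp add: f_def map_\<tau>\<tau>[OF gs] del: map_map)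
  have f_inv: "inv_cochain 2 G n f"
  proof (rule inv_cochainI_generators[of H "{\<one>, \<tau>}"])
    fix g gs assume "g \<in> H \<union> {\<one>, \<tau>}" "gs \<in> tuples G (Suc n)"
    then show "[f (map ((\<otimes>) g) gs) = f gs] (mod 2)"
      using fH f\<tau> by auto
  qed (use decomp H.subset \<tau>(1) in auto)
  have sdf: "[sd f gs = 0] (mod 2)" if gs: "gs \<in> tuples G (Suc (Suc n))" for gs
  proof -
    have \<tau>gs: "map ((\<otimes>) \<tau>) gs \<in> tuples G (Suc (Suc n))"
      using tuples_translate[OF \<tau>(1) gs] .
    have "map pr (map ((\<otimes>) \<tau>) gs) = map pr gs"
      using gs pr_\<tau> by (auto simp: tuples_def)
    then have 1: "[sd w (map ((\<otimes>) \<tau>) gs) = F (map pr gs) - F (map ((\<otimes>) \<tau>) gs)] (mod 2)"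
      using sdw[OF \<tau>gs] by (simp del: map_map)
    have 2: "[F (map ((\<otimes>) \<tau>) gs) = F gs] (mod 2)"
      using F(2) \<tau>(1) gs unfolding inv_cochain_def by blast
    have "sd f gs = sd w (map ((\<otimes>) \<tau>) gs) - sd w gs"
      by (simp add: f_def sd_diff sd_map)
    also have "[\<dots> = (F (map pr gs) - F (map ((\<otimes>) \<tau>) gs)) - (F (map pr gs) - F gs)] (mod 2)"
      using 1 sdw[OF gs] by (rule cong_diff)
    also have "[(F (map pr gs) - F (map ((\<otimes>) \<tau>) gs)) - (F (map pr gs) - F gs)
        = (F (map pr gs) - F gs) - (F (map pr gs) - F gs)] (mod 2)"
      using 2 by (intro cong_diff) auto
    finally show ?thesis
      by simp
  qed
  have f_gen: "gen1 2 G n f"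
    using f_inv sdf by (intro Suc.IH) (simp add: is_cocycle_def)
  define v where "v = (\<lambda>gs. w gs + \<theta> (hd gs) * f gs)"
  have v_inv: "inv_cochain 2 G n v"
  proof (rule inv_cochainI_generators[of H "{\<one>, \<tau>}"])
    fix g gs assume g: "g \<in> H \<union> {\<one>, \<tau>}" and gs: "gs \<in> tuples G (Suc n)"
    have hd: "hd gs \<in> carrier G" "\<And>x. hd (map ((\<otimes>) x) gs) = x \<otimes> hd gs"
      using gs by (auto simp: tuples_Suc_conv)
    show "[v (map ((\<otimes>) g) gs) = v gs] (mod 2)"
    proof (cases "g \<in> H")
      case True
      then have "\<theta> (g \<otimes> hd gs) = \<theta> (hd gs)"
        using Hx[OF True hd(1)] by (simp add: \<theta>_def)
      then show ?thesis
        unfolding v_def hd(2) using wH[OF True gs] fH[OF True gs]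
        by (simp add: cong_add cong_scalar_left)
    next
      case False
      then have g: "g = \<tau>"
        using g H.one_closed by auto
      have "v (map ((\<otimes>) \<tau>) gs) = v gs"
        using \<tau>x[OF hd(1)] by (simp add: v_def hd(2) f_def \<theta>_def map_\<tau>\<tau>[OF gs] del: map_map)
      then show ?thesis
        by (simp add: g)
    qed
  qed (use decomp H.subset \<tau>(1) in auto)
  have sdv: "[sd v gs = sd w gs + cup1 \<theta> f gs] (mod 2)" if gs: "gs \<in> tuples G (Suc (Suc n))" for gs
  proof -
    obtain g hs where g': "gs = g # hs" "hs \<in> tuples G (Suc n)"
      using gs unfolding tuples_Suc_conv[of _ _ "Suc n"] by blast
    then have g: "gs = g # hs" "hs \<noteq> []"
      by (auto simp: tuples_def)
    have "sd v gs = sd w gs + (cup1 \<theta> f gs + \<theta> g * sd f gs)"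
      unfolding v_def sd_add g(1) sd_hd_mult[OF g(2)] ..
    moreover have "[\<theta> g * sd f gs = 0] (mod 2)"
      using sdf[OF gs] by (simp add: cong_0_iff)
    ultimately show ?thesis
      by (simp add: cong_iff_dvd_diff cong_0_iff)
  qed
  have grpH: "group (G\<lparr>carrier := H\<rparr>)"
    using H by (rule subgroup_imp_group)
  have "gen1 2 G (Suc n) (\<lambda>gs. F (map pr gs))"
    using IH[OF is_cocycle_subgroup[OF H F(1)]] group_axioms grpH pr_hom by (rule gen1_pullback)
  then have "gen1 2 G (Suc n) (\<lambda>gs. F (map pr gs) + cup1 \<theta> f gs)"
    by (rule gen1.add) (rule gen1.cup[OF f_gen \<theta>_hom])
  then show ?case
  proof (rule gen1.coh[OF _ v_inv])
    fix gs assume gs: "gs \<in> tuples G (Suc (Suc n))"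
    have "2 dvd sd w gs - (F (map pr gs) - F gs)" "2 dvd sd v gs - (sd w gs + cup1 \<theta> f gs)"
      using sdw[OF gs] sdv[OF gs] by (simp_all only: cong_iff_dvd_diff)
    then have "2 dvd F gs - (F (map pr gs) + cup1 \<theta> f gs + sd v gs)"
      by presburger
    then show "[F gs = F (map pr gs) + cup1 \<theta> f gs + sd v gs] (mod 2)"
      by (simp only: cong_iff_dvd_diff)
  qed
qed

theorem gen1_elementary_abelian:
  fixes G :: "('a, 'm) monoid_scheme"
  assumes "comm_group G" "finite (carrier G)" "\<And>x. x \<in> carrier G \<Longrightarrow> x \<otimes>\<^bsub>G\<^esub> x = \<one>\<^bsub>G\<^esub>"
    and "is_cocycle 2 G n F"
  shows "gen1 2 G n F"
  using assms
proof (induction "card (carrier G)" arbitrary: G n F rule: less_induct)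
  case less
  then interpret comm_group G
    by simp
  show ?case
  proof (cases "carrier G = {\<one>\<^bsub>G\<^esub>}")
    case False
    then obtain H \<tau> where H: "subgroup H G" "\<tau> \<in> carrier G" "\<tau> \<notin> H"
        "\<And>x. x \<in> carrier G \<Longrightarrow> x \<notin> H \<Longrightarrow> \<tau> \<otimes>\<^bsub>G\<^esub> x \<in> H"
      using elementary_split less.prems by metis
    interpret H: subgroup H G
      by (rule H(1))
    have "card H < card (carrier G)"
      using H(2,3) H.subset less.prems(2) by (intro psubset_card_mono) auto
    moreover have "comm_group (G\<lparr>carrier := H\<rparr>)"
      using H.subset m_comm
      by (intro group.group_comm_groupI subgroup_imp_group[OF H(1)]) (auto simp: subset_iff)
    ultimately have "gen1 2 (G\<lparr>carrier := H\<rparr>) n F" if "is_cocycle 2 (G\<lparr>carrier := H\<rparr>) n F" for n F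
      using that less.hyps[of "G\<lparr>carrier := H\<rparr>" n F] less.prems(2,3) H.subset finite_subset by auto
    then show ?thesis
      using gen1_index_two[OF less.prems(3) H] less.prems(4) by blast
  next
    case True
    show ?thesis
    proof (cases n)
      case 0
      then show ?thesis
        using gen1_degree_zero less.prems(4) by simp
    next
      case (Suc k)
      define U where "U = (\<lambda>gs. F (\<one>\<^bsub>G\<^esub> # gs))"
      have "inv_cochain 2 G k U"
        unfolding inv_cochain_def
      proof (intro ballI)
        fix g gs assume "g \<in> carrier G" "gs \<in> tuples G (Suc k)"
        then have "map ((\<otimes>\<^bsub>G\<^esub>) g) gs = gs"
          using True by (auto simp: tuples_def intro!: map_idI)
        then show "[U (map ((\<otimes>\<^bsub>G\<^esub>) g) gs) = U gs] (mod 2)"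
          by simp
      qed
      then have "gen1 2 G (Suc k) (sd U)"
        by (rule gen1_coboundary)
      then show ?thesis
        unfolding Suc
      proof (rule gen1_cong)
        fix gs assume "gs \<in> tuples G (Suc (Suc k))"
        then have "\<one>\<^bsub>G\<^esub> # gs \<in> tuples G (Suc (Suc n))"
          by (simp add: tuples_def Suc)
        then have "[sd F (\<one>\<^bsub>G\<^esub> # gs) = 0] (mod 2)"
          using less.prems(4) unfolding is_cocycle_def by blast
        then show "[F gs = sd U gs] (mod 2)"
          by (simp add: U_def cong_diff_iff_cong_0)
      qed
    qed
  qed
qed

text \<open>
  Let \<open>\<rho>\<close> be the projection \<open>G \<rightarrow> S\<close> with kernel \<open>N\<close>. The prism \<open>w\<close> over \<open>\<rho>\<close> is \<open>S\<close>-invariant, and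
  the sum of its \<open>N\<close>-translates is \<open>G\<close>-invariant. Its differential is \<open>card N\<close> times the
  difference of \<open>F\<close> and its pullback along \<open>\<rho>\<close>, and \<open>card N\<close> is odd.
\<close>

theorem (in group) gen1_normal_complement:
  assumes fin: "finite (carrier G)" and N: "N \<lhd> G" and S: "subgroup S G"
    and NS: "N \<inter> S = {\<one>}" "N <#> S = carrier G" and odd: "odd (card N)"
    and IH: "\<And>n F. is_cocycle 2 (G\<lparr>carrier := S\<rparr>) n F \<Longrightarrow> gen1 2 (G\<lparr>carrier := S\<rparr>) n F"
    and F: "is_cocycle 2 G n F"
  shows "gen1 2 G n F"
proof -
  interpret N: normal N G
    by (rule N)
  interpret S: subgroup S G
    by (rule S)
  define \<rho> where "\<rho> = (\<lambda>g. THE s. s \<in> S \<and> g \<otimes> inv s \<in> N)"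
  have uniq: "s = s'" if "g \<in> carrier G" "s \<in> S" "s' \<in> S" "g \<otimes> inv s \<in> N" "g \<otimes> inv s' \<in> N" for g s s'
  proof -
    have "inv (g \<otimes> inv s) \<otimes> (g \<otimes> inv s') \<in> N"
      using that by simp
    also have "inv (g \<otimes> inv s) \<otimes> (g \<otimes> inv s') = s \<otimes> inv s'"
    proof -
      have "inv g \<otimes> (g \<otimes> inv s') = inv s'"
        using that by (simp flip: m_assoc)
      then show ?thesis
        using that by (simp add: inv_mult_group m_assoc)
    qed
    finally have "s \<otimes> inv s' \<in> N \<inter> S"
      using that by simp
    then have "s \<otimes> inv s' = \<one>"
      using NS(1) by auto
    then show ?thesis
      using that by (metis S.mem_carrier inv_closed inv_equality inv_inv)
  qed
  have \<rho>I: "\<rho> g = s" if "g \<in> carrier G" "s \<in> S" "g \<otimes> inv s \<in> N" for g s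
    unfolding \<rho>_def using that uniq by (intro the_equality) auto
  have \<rho>: "\<rho> g \<in> S \<and> g \<otimes> inv (\<rho> g) \<in> N" if g: "g \<in> carrier G" for g
  proof -
    obtain k s where ks: "k \<in> N" "s \<in> S" "g = k \<otimes> s"
      using g NS(2)[symmetric] by (auto simp: set_mult_def)
    then have "g \<otimes> inv s \<in> N"
      by (simp add: m_assoc)
    then show ?thesis
      using \<rho>I[OF g ks(2)] ks(2) by simp
  qed
  have \<rho>_S: "\<rho> g \<in> S" "\<rho> g \<in> carrier G" if "g \<in> carrier G" for g
    using \<rho>[OF that] by auto
  have \<rho>_mult: "\<rho> (g \<otimes> h) = \<rho> g \<otimes> \<rho> h" if g: "g \<in> carrier G" and h: "h \<in> carrier G" for g h
  proof (rule \<rho>I)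
    have "g \<otimes> (h \<otimes> inv (\<rho> h)) \<otimes> inv g \<in> N"
      using \<rho>[OF h] g by (intro N.inv_op_closed2) auto
    then have "g \<otimes> (h \<otimes> inv (\<rho> h)) \<otimes> inv g \<otimes> (g \<otimes> inv (\<rho> g)) \<in> N"
      using \<rho>[OF g] by simp
    also have "g \<otimes> (h \<otimes> inv (\<rho> h)) \<otimes> inv g \<otimes> (g \<otimes> inv (\<rho> g)) = g \<otimes> h \<otimes> inv (\<rho> g \<otimes> \<rho> h)"
    proof -
      have "inv g \<otimes> (g \<otimes> inv (\<rho> g)) = inv (\<rho> g)"
        using g \<rho>_S[OF g] by (simp flip: m_assoc)
      then show ?thesis
        using g h \<rho>_S[OF g] \<rho>_S[OF h] by (simp add: inv_mult_group m_assoc)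
    qed
    finally show "g \<otimes> h \<otimes> inv (\<rho> g \<otimes> \<rho> h) \<in> N" .
  qed (use g h \<rho>_S in auto)
  have \<rho>_hom: "\<rho> \<in> hom G (G\<lparr>carrier := S\<rparr>)"
    using \<rho>_S \<rho>_mult by (intro homI) auto
  have \<rho>s: "\<rho> s = s" if "s \<in> S" for s
    using that by (intro \<rho>I) auto
  have \<rho>N: "\<rho> a = \<one>" if "a \<in> N" for a
    using that by (intro \<rho>I) auto
  show ?thesis
  proof (cases n)
    case 0
    then show ?thesis
      using F gen1_degree_zero by simp
  next
    case (Suc k)
    have F': "is_cocycle 2 G (Suc k) F" "inv_cochain 2 G (Suc k) F"
      using F by (auto simp: is_cocycle_def Suc)
    have \<rho>_G: "\<rho> \<in> carrier G \<rightarrow> carrier G"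
      using \<rho>_S by auto
    define w where "w = prism \<rho> F"
    have sdw: "[sd w gs = F (map \<rho> gs) - F gs] (mod 2)" if "gs \<in> tuples G (Suc (Suc k))" for gs
      unfolding w_def using F'(1) \<rho>_G that by (rule prism_cocycle)
    have wS: "[w (map ((\<otimes>) s) gs) = w gs] (mod 2)" if "s \<in> S" "gs \<in> tuples G (Suc k)" for s gs
      unfolding w_def using \<rho>_mult \<rho>s that by (intro prism_translate[OF F'(2) \<rho>_G]) auto
    define v where "v = (\<lambda>gs. \<Sum>a\<in>N. w (map ((\<otimes>) a) gs))"
    have v_inv: "inv_cochain 2 G k v"
      unfolding inv_cochain_def
    proof (intro ballI)
      fix g gs assume g: "g \<in> carrier G" and gs: "gs \<in> tuples G (Suc k)"
      define s where "s = \<rho> g"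
      \<comment> \<open>With \<open>g = s b\<close> and \<open>b \<in> N\<close>, left translation by \<open>a g\<close> is translation by \<open>\<beta> a\<close>, followed
        by \<open>s\<close>, under which \<open>w\<close> is invariant; \<open>\<beta>\<close> permutes \<open>N\<close>.\<close>
      define b where "b = inv s \<otimes> g"
      have s: "s \<in> S" "s \<in> carrier G"
        using \<rho>_S[OF g] by (auto simp: s_def)
      have "inv s \<otimes> (g \<otimes> inv s) \<otimes> s \<in> N"
        using \<rho>[OF g] s by (intro N.inv_op_closed1) (auto simp: s_def)
      then have b: "b \<in> N" "b \<in> carrier G"
        using g s by (auto simp: b_def m_assoc)
      define \<beta> where "\<beta> = (\<lambda>a. inv s \<otimes> a \<otimes> s \<otimes> b)"
      have \<beta>N: "\<beta> a \<in> N" if "a \<in> N" for a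
        using N.inv_op_closed1[of s a] that s b by (simp add: \<beta>_def)
      have "inj_on \<beta> N"
        using s b by (auto simp: inj_on_def \<beta>_def)
      moreover have "finite N"
        using fin N.subset finite_subset by blast
      ultimately have "bij_betw \<beta> N N"
        using \<beta>N endo_inj_surj[of N \<beta>] by (auto simp: bij_betw_def)
      have "[w (map ((\<otimes>) a) (map ((\<otimes>) g) gs)) = w (map ((\<otimes>) (\<beta> a)) gs)] (mod 2)" if a: "a \<in> N" for a
      proof -
        have ac: "a \<in> carrier G"
          using a by simp
        have sb: "s \<otimes> b = g"
          using s g by (simp add: b_def flip: m_assoc)
        have "a \<otimes> g = s \<otimes> \<beta> a"
        proof -
          have "s \<otimes> (inv s \<otimes> (a \<otimes> (s \<otimes> b))) = a \<otimes> (s \<otimes> b)"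
            using s b ac by (simp flip: m_assoc)
          then have "s \<otimes> \<beta> a = a \<otimes> (s \<otimes> b)"
            using s b ac by (simp add: \<beta>_def m_assoc)
          then show ?thesis
            using s ac sb by simp
        qed
        then have "a \<otimes> (g \<otimes> x) = s \<otimes> (\<beta> a \<otimes> x)" if "x \<in> carrier G" for x
          using that ac g s b by (simp add: \<beta>_def flip: m_assoc)
        then have "map ((\<otimes>) a) (map ((\<otimes>) g) gs) = map ((\<otimes>) s) (map ((\<otimes>) (\<beta> a)) gs)"
          using gs by (auto simp: tuples_def)
        then show ?thesis
          using wS[OF s(1), of "map ((\<otimes>) (\<beta> a)) gs"] tuples_translate[OF _ gs, of "\<beta> a"] \<beta>N[OF a]
          by (simp del: map_map)
      qed
      then have "[v (map ((\<otimes>) g) gs) = (\<Sum>a\<in>N. w (map ((\<otimes>) (\<beta> a)) gs))] (mod 2)"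
        unfolding v_def by (intro cong_sum)
      also have "(\<Sum>a\<in>N. w (map ((\<otimes>) (\<beta> a)) gs)) = v gs"
        unfolding v_def using \<open>bij_betw \<beta> N N\<close> by (rule sum.reindex_bij_betw)
      finally show "[v (map ((\<otimes>) g) gs) = v gs] (mod 2)" .
    qed
    have sdv: "[sd v gs = F (map \<rho> gs) - F gs] (mod 2)" if gs: "gs \<in> tuples G (Suc (Suc k))" for gs
    proof -
      have "sd v gs = (\<Sum>a\<in>N. sd w (map ((\<otimes>) a) gs))"
        unfolding v_def sd_sum sd_map ..
      also have "[\<dots> = (\<Sum>a\<in>N. F (map \<rho> gs) - F gs)] (mod 2)"
      proof (rule cong_sum)
        fix a assume a: "a \<in> N"
        have ac: "a \<in> carrier G"
          using a by simp
        have "map \<rho> (map ((\<otimes>) a) gs) = map \<rho> gs"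
          using gs \<rho>_mult[OF ac] \<rho>N[OF a] \<rho>_S by (auto simp: tuples_def)
        then have "[sd w (map ((\<otimes>) a) gs) = F (map \<rho> gs) - F (map ((\<otimes>) a) gs)] (mod 2)"
          using sdw[OF tuples_translate[OF ac gs]] by (simp del: map_map)
        also have "[F (map \<rho> gs) - F (map ((\<otimes>) a) gs) = F (map \<rho> gs) - F gs] (mod 2)"
          using F'(2) ac gs unfolding inv_cochain_def by (intro cong_diff) auto
        finally show "[sd w (map ((\<otimes>) a) gs) = F (map \<rho> gs) - F gs] (mod 2)" .
      qed
      also have "(\<Sum>a\<in>N. F (map \<rho> gs) - F gs) = int (card N) * (F (map \<rho> gs) - F gs)"
        by simp
      also have "[\<dots> = 1 * (F (map \<rho> gs) - F gs)] (mod 2)"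
        using odd by (intro cong_scalar_right) (simp add: cong_iff_dvd_diff)
      finally show ?thesis
        by simp
    qed
    have "gen1 2 G (Suc k) (\<lambda>gs. F (map \<rho> gs))"
      using IH[OF is_cocycle_subgroup[OF S F'(1)]] group_axioms subgroup_imp_group[OF S] \<rho>_hom
      by (rule gen1_pullback)
    then show ?thesis
      unfolding Suc
    proof (rule gen1.coh[OF _ v_inv])
      fix gs assume gs: "gs \<in> tuples G (Suc (Suc k))"
      have "2 dvd sd v gs - (F (map \<rho> gs) - F gs)"
        using sdv[OF gs] by (simp only: cong_iff_dvd_diff)
      then have "2 dvd F gs - (F (map \<rho> gs) + sd v gs)"
        by presburger
      then show "[F gs = F (map \<rho> gs) + sd v gs] (mod 2)"
        by (simp only: cong_iff_dvd_diff)
    qed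
  qed
qed

section \<open>Generation in degree one forces detection by homomorphisms\<close>

context group
begin

lemma hom_mod_one: "hom_mod m G \<alpha> \<Longrightarrow> [\<alpha> \<one> = 0] (mod m)"
  unfolding hom_mod_def by (metis cong_add_lcancel_0 cong_sym l_one one_closed)

lemma hom_mod_inv:
  assumes "hom_mod m G \<alpha>" "g \<in> carrier G"
  shows "[\<alpha> (inv g) = - \<alpha> g] (mod m)"
proof -
  have "[\<alpha> (inv g \<otimes> g) = \<alpha> (inv g) + \<alpha> g] (mod m)"
    using assms unfolding hom_mod_def by blast
  then have "[\<alpha> \<one> = \<alpha> (inv g) + \<alpha> g] (mod m)"
    using assms(2) by simp
  then have "[\<alpha> (inv g) + \<alpha> g = 0] (mod m)"
    using hom_mod_one[OF assms(1)] cong_sym cong_trans by blast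
  then show ?thesis
    by (simp add: cong_iff_dvd_diff cong_0_iff)
qed

lemma hom_mod_pow:
  assumes "hom_mod m G \<alpha>" "g \<in> carrier G"
  shows "[\<alpha> (g [^] (j::nat)) = int j * \<alpha> g] (mod m)"
proof (induction j)
  case 0
  then show ?case
    using hom_mod_one[OF assms(1)] by simp
next
  case (Suc j)
  have "[\<alpha> (g [^] j \<otimes> g) = \<alpha> (g [^] j) + \<alpha> g] (mod m)"
    using assms unfolding hom_mod_def by blast
  also have "[\<alpha> (g [^] j) + \<alpha> g = int j * \<alpha> g + \<alpha> g] (mod m)"
    using Suc by (intro cong_add) auto
  finally show ?case
    by (simp add: algebra_simps)
qed

lemma hom_mod_of_cocycle:
  assumes F: "is_cocycle m G 1 F"
  shows "hom_mod m G (\<lambda>g. F [\<one>, g])"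
    and "\<And>x y. x \<in> carrier G \<Longrightarrow> y \<in> carrier G \<Longrightarrow> [F [x, y] = F [\<one>, y] - F [\<one>, x]] (mod m)"
proof -
  show 2: "[F [x, y] = F [\<one>, y] - F [\<one>, x]] (mod m)" if "x \<in> carrier G" "y \<in> carrier G" for x y
  proof -
    have "[\<one>, x, y] \<in> tuples G (Suc (Suc 1))"
      using that by (simp add: tuples_def)
    then have "[sd F [\<one>, x, y] = 0] (mod m)"
      using F unfolding is_cocycle_def by blast
    then show ?thesis
      by (simp add: cong_iff_dvd_diff algebra_simps)
  qed
  show "hom_mod m G (\<lambda>g. F [\<one>, g])"
    unfolding hom_mod_def
  proof (intro ballI)
    fix g h assume g: "g \<in> carrier G" and h: "h \<in> carrier G"
    have "[\<one>, h] \<in> tuples G (Suc 1)"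
      using h by (simp add: tuples_def)
    then have "[F (map ((\<otimes>) g) [\<one>, h]) = F [\<one>, h]] (mod m)"
      using F g unfolding is_cocycle_def inv_cochain_def by blast
    then have "[F [g, g \<otimes> h] = F [\<one>, h]] (mod m)"
      using g by simp
    from dvd_diff[OF this[unfolded cong_iff_dvd_diff] 2[OF g m_closed[OF g h], unfolded cong_iff_dvd_diff]]
    show "[F [\<one>, g \<otimes> h] = F [\<one>, g] + F [\<one>, h]] (mod m)"
      by (simp add: cong_iff_dvd_diff algebra_simps)
  qed
qed

text \<open>
  Products with a homomorphism are compatible with primitives that are not invariant: this is the
  Leibniz rule, read off from \<open>sd_hd_mult\<close> and \<open>sd (sd _) = 0\<close>.
\<close>

lemma cup1_coboundary:
  assumes "Suc (Suc 0) < length gs"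
  shows "cup1 \<alpha> (sd b) gs = sd (\<lambda>ys. - cup1 \<alpha> b ys) gs"
proof -
  have c: "cup1 \<alpha> f ys = sd (\<lambda>ys. \<alpha> (hd ys) * f ys) ys - \<alpha> (hd ys) * sd f ys" if "Suc 0 < length ys" for f ys
  proof -
    obtain g hs where "ys = g # hs" "hs \<noteq> []"
      using \<open>Suc 0 < length ys\<close> by (cases ys) auto
    then show ?thesis
      using sd_hd_mult[of hs \<alpha> f g] by (simp del: sd.simps)
  qed
  have "sd (\<lambda>ys. - cup1 \<alpha> b ys) gs
      = sd (\<lambda>ys. \<alpha> (hd ys) * sd b ys - sd (\<lambda>ys. \<alpha> (hd ys) * b ys) ys) gs"
    using assms by (intro sd_cong) (auto simp: c)
  also have "\<dots> = sd (\<lambda>ys. \<alpha> (hd ys) * sd b ys) gs"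
    by (simp add: sd_diff sd_sd)
  finally show ?thesis
    using assms c[of gs "sd b"] by (simp add: sd_sd)
qed

text \<open>
  On a cyclic group all homomorphisms are proportional, so a product of degree at least two
  contains a multiple of a square \<open>\<alpha> \<alpha>\<close>. If \<open>p\<close> is odd, \<open>- \<alpha>\<^sup>2 / 2\<close> as a function of
  \<open>g\<^sub>0\<inverse> g\<^sub>1\<close> is an invariant primitive of the square. If \<open>p = 2\<close>, the homomorphisms vanish on \<open>c\<close> by assumption, and \<open>0\<close> is a primitive.
\<close>

lemma gen1_restrict_cyclic:
  assumes p: "prime p" and c: "c \<in> carrier G"
    and two: "\<And>\<alpha>. p = 2 \<Longrightarrow> hom_mod 2 G \<alpha> \<Longrightarrow> [\<alpha> c = 0] (mod 2)"
  defines "Q \<equiv> \<lambda>n. {gs \<in> tuples G n. set gs \<subseteq> range (\<lambda>j::nat. c [^] j)}"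
  shows "gen1 (int p) G n F \<Longrightarrow> 2 \<le> n \<Longrightarrow>
    \<exists>b. (\<forall>gs\<in>Q n. [b (map ((\<otimes>) (inv c)) gs) = b gs] (mod int p)) \<and>
        (\<forall>gs\<in>Q (Suc n). [sd b gs = F gs] (mod int p))"
proof (induction rule: gen1.induct)
  have R_G: "range (\<lambda>j::nat. c [^] j) \<subseteq> carrier G"
    using c by auto
  have \<alpha>_t: "[\<alpha> (inv c \<otimes> y) - \<alpha> (inv c \<otimes> x) = \<alpha> y - \<alpha> x] (mod int p)"
    if "hom_mod (int p) G \<alpha>" "x \<in> carrier G" "y \<in> carrier G" for \<alpha> x y
  proof -
    have "[\<alpha> (inv c \<otimes> y) - \<alpha> (inv c \<otimes> x) = (\<alpha> (inv c) + \<alpha> y) - (\<alpha> (inv c) + \<alpha> x)] (mod int p)"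
      using that c unfolding hom_mod_def by (intro cong_diff) auto
    then show ?thesis
      by simp
  qed
  {
    case (const F a)
    then show ?case
      by simp
  next
    case (cup n F \<alpha>)
    show ?case
    proof (cases "2 \<le> n")
      case True
      then obtain b where b: "\<And>gs. gs \<in> Q n \<Longrightarrow> [b (map ((\<otimes>) (inv c)) gs) = b gs] (mod int p)"
          "\<And>gs. gs \<in> Q (Suc n) \<Longrightarrow> [sd b gs = F gs] (mod int p)"
        using cup.IH by blast
      have "[- cup1 \<alpha> b (map ((\<otimes>) (inv c)) gs) = - cup1 \<alpha> b gs] (mod int p)" if gs: "gs \<in> Q (Suc n)" for gs
      proof -
        obtain x y hs where g: "gs = x # y # hs"
          using gs True by (cases gs; cases "tl gs") (auto simp: Q_def tuples_def)
        have "[\<alpha> (inv c \<otimes> y) - \<alpha> (inv c \<otimes> x) = \<alpha> y - \<alpha> x] (mod int p)"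
          using gs g by (intro \<alpha>_t cup.hyps(2)) (auto simp: Q_def tuples_def)
        moreover have "[b (map ((\<otimes>) (inv c)) (y # hs)) = b (y # hs)] (mod int p)"
          using gs g by (intro b) (auto simp: Q_def tuples_def)
        ultimately have "[cup1 \<alpha> b (map ((\<otimes>) (inv c)) gs) = cup1 \<alpha> b gs] (mod int p)"
          unfolding g cup1_def by (simp add: cong_mult)
        then show ?thesis
          by (simp add: cong_minus_minus_iff)
      qed
      moreover have "[sd (\<lambda>gs. - cup1 \<alpha> b gs) gs = cup1 \<alpha> F gs] (mod int p)" if gs: "gs \<in> Q (Suc (Suc n))" for gs
      proof -
        have "sd (\<lambda>gs. - cup1 \<alpha> b gs) gs = cup1 \<alpha> (sd b) gs"
          using gs True by (intro cup1_coboundary[symmetric]) (auto simp: Q_def tuples_def)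
        moreover have "tl gs \<in> Q (Suc n)"
          using gs by (cases gs) (auto simp: Q_def tuples_def)
        then have "[sd b (tl gs) = F (tl gs)] (mod int p)"
          by (rule b)
        ultimately show ?thesis
          unfolding cup1_def[of \<alpha> F] cup1_def[of \<alpha> "sd b"] by (simp add: cong_scalar_left)
      qed
      ultimately show ?thesis
        by (intro exI[of _ "\<lambda>gs. - cup1 \<alpha> b gs"] conjI ballI)
    next
      case False
      then have n: "n = 1"
        using cup.prems by simp
      have F: "is_cocycle (int p) G 1 F"
        using cup.hyps(1) n gen1_cocycle by simp
      define \<beta> where "\<beta> = (\<lambda>g. F [\<one>, g])"
      have \<beta>: "hom_mod (int p) G \<beta>"
        unfolding \<beta>_def by (rule hom_mod_of_cocycle(1)[OF F])
      \<comment> \<open>\<open>h\<close> is \<open>1/2\<close> for odd \<open>p\<close>, and the coefficient \<open>0\<close> for \<open>p = 2\<close>\<close>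
      obtain h where h: "p = 2 \<and> h = 0 \<or> [2 * h = 1] (mod int p)"
      proof (cases "p = 2")
        case False
        then have "odd p"
          using p prime_odd_nat prime_ge_2_nat[OF p] by (metis le_neq_implies_less)
        then have "coprime 2 (int p)"
          by simp
        then show ?thesis
          using that cong_solve_coprime_int by blast
      qed auto
      define b where "b = (\<lambda>gs. - (h * ((\<alpha> (gs ! 1) - \<alpha> (gs ! 0)) * (\<beta> (gs ! 1) - \<beta> (gs ! 0)))))"
      have "[b (map ((\<otimes>) (inv c)) gs) = b gs] (mod int p)" if gs: "gs \<in> Q (Suc n)" for gs
      proof -
        obtain x y where g: "gs = [x, y]"
          using gs n by (auto simp: Q_def tuples_def length_Suc_conv)
        then have xy: "x \<in> carrier G" "y \<in> carrier G"
          using gs by (auto simp: Q_def tuples_def)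
        have "[(\<alpha> (inv c \<otimes> y) - \<alpha> (inv c \<otimes> x)) * (\<beta> (inv c \<otimes> y) - \<beta> (inv c \<otimes> x))
            = (\<alpha> y - \<alpha> x) * (\<beta> y - \<beta> x)] (mod int p)"
          using \<alpha>_t[OF cup.hyps(2) xy] \<alpha>_t[OF \<beta> xy] by (rule cong_mult)
        then have "[h * ((\<alpha> (inv c \<otimes> y) - \<alpha> (inv c \<otimes> x)) * (\<beta> (inv c \<otimes> y) - \<beta> (inv c \<otimes> x)))
            = h * ((\<alpha> y - \<alpha> x) * (\<beta> y - \<beta> x))] (mod int p)"
          by (rule cong_scalar_left)
        then show ?thesis
          by (simp add: b_def g cong_minus_minus_iff)
      qed
      moreover have "[sd b gs = cup1 \<alpha> F gs] (mod int p)" if gs: "gs \<in> Q (Suc (Suc n))" for gs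
      proof -
        obtain x y z where g: "gs = [x, y, z]"
          using gs n by (auto simp: Q_def tuples_def length_Suc_conv)
        then have xyz: "x \<in> carrier G" "y \<in> carrier G" "z \<in> carrier G"
          using gs by (auto simp: Q_def tuples_def)
        obtain i j k :: nat where ijk: "x = c [^] i" "y = c [^] j" "z = c [^] k"
          using gs g by (auto simp: Q_def)
        define A1 A2 B1 B2 where "A1 = \<alpha> y - \<alpha> x" and "A2 = \<alpha> z - \<alpha> y"
          and "B1 = \<beta> y - \<beta> x" and "B2 = \<beta> z - \<beta> y"
        have diff: "[\<gamma> (c [^] l) - \<gamma> (c [^] q) = (int l - int q) * \<gamma> c] (mod int p)"
          if "hom_mod (int p) G \<gamma>" for \<gamma> and l q :: nat
          using cong_diff[OF hom_mod_pow[OF that c] hom_mod_pow[OF that c]] by (simp add: left_diff_distrib)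
        have A: "[A1 = (int j - int i) * \<alpha> c] (mod int p)" "[A2 = (int k - int j) * \<alpha> c] (mod int p)"
          unfolding A1_def A2_def ijk by (rule diff[OF cup.hyps(2)])+
        have B: "[B1 = (int j - int i) * \<beta> c] (mod int p)" "[B2 = (int k - int j) * \<beta> c] (mod int p)"
          unfolding B1_def B2_def ijk by (rule diff[OF \<beta>])+
        have "[A2 * B1 = ((int k - int j) * \<alpha> c) * ((int j - int i) * \<beta> c)] (mod int p)"
          by (rule cong_mult[OF A(2) B(1)])
        also have "((int k - int j) * \<alpha> c) * ((int j - int i) * \<beta> c) = ((int j - int i) * \<alpha> c) * ((int k - int j) * \<beta> c)"
          by simp
        also have "[((int j - int i) * \<alpha> c) * ((int k - int j) * \<beta> c) = A1 * B2] (mod int p)"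
          using cong_mult[OF A(1) B(2)] by (rule cong_sym)
        finally have sym: "[A2 * B1 = A1 * B2] (mod int p)" .
        have "sd b gs = h * (A1 * B2 + A2 * B1)"
          by (simp add: g b_def A1_def A2_def B1_def B2_def algebra_simps)
        also have "[h * (A1 * B2 + A2 * B1) = h * (A1 * B2 + A1 * B2)] (mod int p)"
          using sym by (intro cong_scalar_left cong_add) auto
        also have "h * (A1 * B2 + A1 * B2) = 2 * h * (A1 * B2)"
          by simp
        also have "[2 * h * (A1 * B2) = A1 * B2] (mod int p)"
          using h
        proof
          assume "[2 * h = 1] (mod int p)"
          then show ?thesis
            using cong_scalar_right[of "2 * h" 1 "int p" "A1 * B2"] by simp
        next
          assume p2: "p = 2 \<and> h = 0"
          then have "[\<alpha> c = 0] (mod int p)"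
            using two[of \<alpha>] cup.hyps(2) by simp
          then have "[A1 = 0] (mod int p)"
            using A(1) by (metis cong_scalar_left cong_trans mult_zero_right)
          then show ?thesis
            using p2 by (simp add: cong_0_iff cong_iff_dvd_diff)
        qed
        also have "[A1 * B2 = A1 * F [y, z]] (mod int p)"
          using hom_mod_of_cocycle(2)[OF F xyz(2,3)] unfolding B2_def \<beta>_def
          by (intro cong_scalar_left) (rule cong_sym)
        finally show ?thesis
          by (simp add: g cup1_def A1_def)
      qed
      ultimately show ?thesis
        by blast
    qed
  next
    case (add n F F')
    then obtain b b' where b: "\<forall>gs\<in>Q n. [b (map ((\<otimes>) (inv c)) gs) = b gs] (mod int p)"
          "\<forall>gs\<in>Q (Suc n). [sd b gs = F gs] (mod int p)"
        and b': "\<forall>gs\<in>Q n. [b' (map ((\<otimes>) (inv c)) gs) = b' gs] (mod int p)"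
          "\<forall>gs\<in>Q (Suc n). [sd b' gs = F' gs] (mod int p)"
      by blast
    show ?case
      by (rule exI[of _ "\<lambda>gs. b gs + b' gs"]) (use b b' in \<open>auto simp: sd_add intro: cong_add\<close>)
  next
    case (coh n F U F')
    then obtain b where b: "\<forall>gs\<in>Q (Suc n). [b (map ((\<otimes>) (inv c)) gs) = b gs] (mod int p)"
          "\<forall>gs\<in>Q (Suc (Suc n)). [sd b gs = F gs] (mod int p)"
      by blast
    have "[U (map ((\<otimes>) (inv c)) gs) = U gs] (mod int p)" if "gs \<in> Q (Suc n)" for gs
      using coh.hyps(2) that c unfolding inv_cochain_def Q_def by simp
    moreover have "[sd b gs + sd U gs = F' gs] (mod int p)" if gs: "gs \<in> Q (Suc (Suc n))" for gs
    proof -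
      have "[sd b gs + sd U gs = F gs + sd U gs] (mod int p)"
        using b(2) gs by (intro cong_add) auto
      also have "[F gs + sd U gs = F' gs] (mod int p)"
        using coh.hyps(3)[of gs, THEN cong_sym] gs by (simp add: Q_def)
      finally show ?thesis .
    qed
    ultimately show ?case
      using b(1) by (intro exI[of _ "\<lambda>gs. b gs + U gs"]) (auto simp: sd_add intro: cong_add)
  }
qed

text \<open>
  Otherwise every cocycle of degree at least two has an invariant primitive on \<open>\<langle>c\<rangle>\<close>, which the
  operators \<open>Eop\<close> kill. A cocycle of degree one is a homomorphism \<open>\<beta>\<close>, itself a primitive with
  norm \<open>p \<beta>(g) - (0 + 1 + \<dots> + (p - 1)) \<beta>(c)\<close>. This is \<open>0\<close> modulo \<open>p\<close> because the sum is divisible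
  by \<open>p\<close> if \<open>p\<close> is odd, and \<open>\<beta>(c)\<close> is even if \<open>p = 2\<close>.
\<close>

theorem gen1_all_imp_hom:
  assumes fin: "finite (carrier G)" and p: "prime p"
    and c: "c \<in> carrier G" "c \<noteq> \<one>" "c [^] p = \<one>"
    and gen: "\<And>n F. is_cocycle (int p) G n F \<Longrightarrow> gen1 (int p) G n F"
  shows "p = 2 \<and> (\<exists>\<alpha>. hom_mod 2 G \<alpha> \<and> \<not> [\<alpha> c = 0] (mod 2))"
proof (rule ccontr)
  assume neg: "\<not> ?thesis"
  then have two: "[\<alpha> c = 0] (mod 2)" if "p = 2" "hom_mod 2 G \<alpha>" for \<alpha>
    using that by blast
  show False
  proof (rule positive_degree_restriction_nontrivial[OF fin p c])
    fix i :: nat and a :: "'a list \<Rightarrow> int"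
    assume "\<And>gs. gs \<in> tuples G (Suc (Suc (Suc i))) \<Longrightarrow> [sd a gs = 0] (mod int p)"
      and "\<And>g gs. g \<in> carrier G \<Longrightarrow> gs \<in> tuples G (Suc (Suc i)) \<Longrightarrow> a (map ((\<otimes>) g) gs) = a gs"
    then have a: "is_cocycle (int p) G (Suc i) a"
      by (simp add: is_cocycle_def inv_cochain_def)
    let ?Q = "\<lambda>n. {gs \<in> tuples G n. set gs \<subseteq> range (\<lambda>j::nat. c [^] j)}"
    let ?t = "(\<otimes>) (inv c)"
    show "\<exists>b. (\<forall>gs\<in>?Q (Suc (Suc i)). [sd b gs = a gs] (mod int p)) \<and>
          (\<forall>gs\<in>?Q (Suc i). [Eop p ?t (Suc i) b gs = 0] (mod int p))"
    proof (cases i)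
      case 0
      define b where "b = (\<lambda>gs. a (\<one> # gs))"
      define \<beta> where "\<beta> = (\<lambda>g. a [\<one>, g])"
      have \<beta>: "hom_mod (int p) G \<beta>"
        unfolding \<beta>_def using a 0 by (intro hom_mod_of_cocycle(1)) simp
      have "[sd b gs = a gs] (mod int p)" if "gs \<in> tuples G (Suc (Suc i))" for gs
      proof -
        have "\<one> # gs \<in> tuples G (Suc (Suc (Suc i)))"
          using that by (simp add: tuples_def)
        then have "[sd a (\<one> # gs) = 0] (mod int p)"
          using a unfolding is_cocycle_def by blast
        then show ?thesis
          by (simp add: b_def cong_iff_dvd_diff dvd_diff_commute)
      qed
      moreover have "[Eop p ?t (Suc i) b gs = 0] (mod int p)" if gs: "gs \<in> tuples G (Suc i)" for gs
      proof -
        obtain g where g: "gs = [g]" "g \<in> carrier G"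
          using gs 0 by (auto simp: tuples_def length_Suc_conv)
        have tj: "(?t ^^ j) g \<in> carrier G \<and> [\<beta> ((?t ^^ j) g) = \<beta> g - int j * \<beta> c] (mod int p)" for j
        proof (induction j)
          case (Suc j)
          have "[\<beta> (inv c \<otimes> (?t ^^ j) g) = \<beta> (inv c) + \<beta> ((?t ^^ j) g)] (mod int p)"
            using \<beta> c(1) Suc unfolding hom_mod_def by simp
          also have "[\<beta> (inv c) + \<beta> ((?t ^^ j) g) = - \<beta> c + (\<beta> g - int j * \<beta> c)] (mod int p)"
            using Suc hom_mod_inv[OF \<beta> c(1)] by (intro cong_add) auto
          finally show ?case
            using Suc c(1) by (simp add: algebra_simps)
        qed (use g in simp)
        have "Eop p ?t (Suc i) b gs = (\<Sum>j<p. \<beta> ((?t ^^ j) g))"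
          by (simp add: Eop_def 0 g b_def \<beta>_def)
        also have "[\<dots> = (\<Sum>j<p. \<beta> g - int j * \<beta> c)] (mod int p)"
          using tj by (intro cong_sum) auto
        also have "(\<Sum>j<p. \<beta> g - int j * \<beta> c) = int p * \<beta> g - (\<Sum>j<p. int j) * \<beta> c"
          by (simp add: sum_subtractf sum_distrib_right)
        also have "[\<dots> = 0] (mod int p)"
        proof -
          have "int p dvd (\<Sum>j<p. int j) * \<beta> c"
          proof (cases "p = 2")
            case True
            then have "int p dvd \<beta> c"
              using two[of \<beta>] \<beta> by (simp add: cong_0_iff)
            then show ?thesis
              by simp
          next
            case False
            then have "odd p"
              using p prime_odd_nat prime_ge_2_nat[OF p] by (metis le_neq_implies_less)
            then obtain k where k: "p = 2 * k + 1"
              by (auto elim: oddE)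
            have "2 * (\<Sum>j<q. int j) = int q * (int q - 1)" for q
              by (induction q) (auto simp: algebra_simps)
            from this[of p] have "(\<Sum>j<p. int j) = int p * int k"
              using k by simp
            then show ?thesis
              by simp
          qed
          then show ?thesis
            by (simp add: cong_0_iff)
        qed
        finally show ?thesis .
      qed
      ultimately show ?thesis
        by blast
    next
      case (Suc k)
      have i2: "2 \<le> Suc i"
        using Suc by simp
      have "\<exists>b. (\<forall>gs\<in>?Q (Suc i). [b (map ?t gs) = b gs] (mod int p)) \<and>
          (\<forall>gs\<in>?Q (Suc (Suc i)). [sd b gs = a gs] (mod int p))"
        by (rule gen1_restrict_cyclic[OF p c(1) _ gen[OF a] i2]) (rule two)
      then obtain b where b: "\<And>gs. gs \<in> ?Q (Suc i) \<Longrightarrow> [b (map ?t gs) = b gs] (mod int p)"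
          "\<And>gs. gs \<in> ?Q (Suc (Suc i)) \<Longrightarrow> [sd b gs = a gs] (mod int p)"
        by blast
      have "[Eop p ?t (Suc i) b gs = 0] (mod int p)" if gs: "gs \<in> ?Q (Suc i)" for gs
      proof -
        have tQ: "map (?t ^^ j) gs \<in> ?Q (Suc i)" for j
        proof (induction j)
          case (Suc j)
          define R where "R = range (\<lambda>j::nat. c [^] j)"
          have tR: "inv c \<otimes> x \<in> R" if x: "x \<in> R" for x
          proof -
            have "c [^] (p - 1) \<otimes> c = c [^] Suc (p - 1)"
              by simp
            then have "c [^] (p - 1) \<otimes> c = \<one>"
              using c prime_gt_0_nat[OF p] by simp
            then have "inv c = c [^] (p - 1)"
              using c by (metis inv_equality nat_pow_closed)
            moreover obtain l :: nat where "x = c [^] l"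
              using x unfolding R_def by blast
            ultimately have "inv c \<otimes> x = c [^] (p - 1 + l)"
              using c by (simp add: nat_pow_mult)
            then show ?thesis
              unfolding R_def by blast
          qed
          have j: "map (?t ^^ j) gs \<in> tuples G (Suc i)" "set (map (?t ^^ j) gs) \<subseteq> R"
            using Suc unfolding R_def by blast+
          have "set (map ?t (map (?t ^^ j) gs)) \<subseteq> R"
            unfolding set_map[of ?t] using j(2) tR by blast
          moreover have "map ?t (map (?t ^^ j) gs) \<in> tuples G (Suc i)"
            using j(1) c(1) by (intro tuples_translate) auto
          moreover have "map ?t (map (?t ^^ j) gs) = map (?t ^^ Suc j) gs"
            by simp
          ultimately show ?case
            unfolding R_def by (simp add: comp_def)
        qed (use gs in simp)
        have bj: "[b (map (?t ^^ j) gs) = b gs] (mod int p)" for j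
        proof (induction j)
          case (Suc j)
          have "[b (map ?t (map (?t ^^ j) gs)) = b (map (?t ^^ j) gs)] (mod int p)"
            using tQ by (intro b)
          also have "[b (map (?t ^^ j) gs) = b gs] (mod int p)"
            by (rule Suc)
          finally show ?case
            by (simp add: comp_def)
        qed simp
        have "[Eop p ?t (Suc i) b gs = Eop p ?t (Suc i) (\<lambda>_. b gs) gs] (mod int p)"
          using bj by (intro Eop_cong_mod)
        also have "[Eop p ?t (Suc i) (\<lambda>_. b gs) gs = 0] (mod int p)"
          by (simp add: Eop_def cong_0_iff)
        finally show ?thesis .
      qed
      then show ?thesis
        using b(2) by blast
    qed
  qed
qed

section \<open>The common kernel of the homomorphisms to \<int>/2\<close>

lemma Cauchy_element:
  assumes fin: "finite (carrier G)" and q: "prime q" "q dvd order G"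
  obtains c where "c \<in> carrier G" "c \<noteq> \<one>" "c [^] q = \<one>"
proof -
  obtain m where "order G = q ^ 1 * m"
    using q(2) by auto
  then obtain H where H: "subgroup H G" "card H = q"
    using sylow_thm[OF q(1) is_group, of 1 m] fin by auto
  interpret H: subgroup H G
    by (rule H(1))
  have "1 < card H"
    using H(2) prime_gt_1_nat[OF q(1)] by simp
  then have "\<not> H \<subseteq> {\<one>}"
    using card_mono[of "{\<one>}" H] by auto
  then obtain c where c: "c \<in> H" "c \<noteq> \<one>"
    by blast
  have "c [^]\<^bsub>G\<lparr>carrier := H\<rparr>\<^esub> order (G\<lparr>carrier := H\<rparr>) = \<one>\<^bsub>G\<lparr>carrier := H\<rparr>\<^esub>"
    using c(1) subgroup_imp_group[OF H(1)] by (intro group.pow_order_eq_1) auto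
  then have "c [^] q = \<one>"
    by (simp add: order_def H(2) nat_pow_consistent[symmetric])
  then show ?thesis
    using that[of c] c by auto
qed

text \<open>
  This is the subgroup generated by all squares; in particular it contains all commutators.
\<close>

definition mod2_radical :: "'a set" where
  "mod2_radical = {g \<in> carrier G. \<forall>\<alpha>. hom_mod 2 G \<alpha> \<longrightarrow> [\<alpha> g = 0] (mod 2)}"

lemma hom_mod_mult:
  "hom_mod m G \<alpha> \<Longrightarrow> g \<in> carrier G \<Longrightarrow> h \<in> carrier G \<Longrightarrow> m dvd \<alpha> (g \<otimes> h) - (\<alpha> g + \<alpha> h)"
  by (simp add: hom_mod_def cong_iff_dvd_diff)

lemma mod2_hom_conj:
  assumes \<alpha>: "hom_mod 2 G \<alpha>" and g: "g \<in> carrier G" and h: "h \<in> carrier G"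
  shows "[\<alpha> (g \<otimes> h \<otimes> inv g) = \<alpha> h] (mod 2)"
proof -
  have "2 dvd \<alpha> (g \<otimes> h \<otimes> inv g) - (\<alpha> (g \<otimes> h) + \<alpha> (inv g))" "2 dvd \<alpha> (g \<otimes> h) - (\<alpha> g + \<alpha> h)"
      "2 dvd \<alpha> (inv g) + \<alpha> g"
    using hom_mod_mult[OF \<alpha>] g h hom_mod_inv[OF \<alpha> g] by (auto simp: cong_iff_dvd_diff)
  then have "2 dvd \<alpha> (g \<otimes> h \<otimes> inv g) - \<alpha> h"
    by presburger
  then show ?thesis
    by (simp add: cong_iff_dvd_diff)
qed

lemma mod2_radical_normal: "mod2_radical \<lhd> G"
proof (rule normal_invI)
  show "subgroup mod2_radical G"
  proof (rule subgroupI)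
    show "mod2_radical \<subseteq> carrier G"
      by (auto simp: mod2_radical_def)
    have "\<one> \<in> mod2_radical"
      using hom_mod_one by (auto simp: mod2_radical_def)
    then show "mod2_radical \<noteq> {}"
      by blast
    show "inv a \<in> mod2_radical" if "a \<in> mod2_radical" for a
    proof -
      have "[\<alpha> (inv a) = 0] (mod 2)" if \<alpha>: "hom_mod 2 G \<alpha>" for \<alpha>
      proof -
        have "2 dvd \<alpha> a" "2 dvd \<alpha> (inv a) + \<alpha> a"
          using \<open>a \<in> mod2_radical\<close> \<alpha> hom_mod_inv[OF \<alpha>, of a]
          by (auto simp: mod2_radical_def cong_0_iff cong_iff_dvd_diff)
        then show ?thesis
          by (simp add: cong_0_iff dvd_add_left_iff)
      qed
      then show ?thesis
        using that by (simp add: mod2_radical_def)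
    qed
    show "a \<otimes> b \<in> mod2_radical" if ab: "a \<in> mod2_radical" "b \<in> mod2_radical" for a b
    proof -
      have "[\<alpha> (a \<otimes> b) = 0] (mod 2)" if \<alpha>: "hom_mod 2 G \<alpha>" for \<alpha>
      proof -
        have "2 dvd \<alpha> a" "2 dvd \<alpha> b" "2 dvd \<alpha> (a \<otimes> b) - (\<alpha> a + \<alpha> b)"
          using ab \<alpha> hom_mod_mult[OF \<alpha>, of a b] by (auto simp: mod2_radical_def cong_0_iff)
        then show ?thesis
          unfolding cong_0_iff by presburger
      qed
      then show ?thesis
        using ab by (simp add: mod2_radical_def)
    qed
  qed
  fix x h assume x: "x \<in> carrier G" and h: "h \<in> mod2_radical"
  then have hc: "h \<in> carrier G"
    by (simp add: mod2_radical_def)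
  have "[\<alpha> (x \<otimes> h \<otimes> inv x) = 0] (mod 2)" if \<alpha>: "hom_mod 2 G \<alpha>" for \<alpha>
    using mod2_hom_conj[OF \<alpha> x hc] h \<alpha> cong_trans unfolding mod2_radical_def by blast
  then show "x \<otimes> h \<otimes> inv x \<in> mod2_radical"
    using x hc by (simp add: mod2_radical_def)
qed

lemma square_in_mod2_radical:
  assumes g: "g \<in> carrier G"
  shows "g \<otimes> g \<in> mod2_radical"
proof -
  have "[\<alpha> (g \<otimes> g) = 0] (mod 2)" if \<alpha>: "hom_mod 2 G \<alpha>" for \<alpha>
  proof -
    have "2 dvd \<alpha> (g \<otimes> g) - (\<alpha> g + \<alpha> g)"
      using hom_mod_mult[OF \<alpha> g g] .
    then show ?thesis
      unfolding cong_0_iff by presburger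
  qed
  then show ?thesis
    using g by (simp add: mod2_radical_def)
qed

lemma commutator_in_mod2_radical:
  assumes g: "g \<in> carrier G" and h: "h \<in> carrier G"
  shows "g \<otimes> h \<otimes> inv g \<otimes> inv h \<in> mod2_radical"
proof -
  have "[\<alpha> (g \<otimes> h \<otimes> inv g \<otimes> inv h) = 0] (mod 2)" if \<alpha>: "hom_mod 2 G \<alpha>" for \<alpha>
  proof -
    have "2 dvd \<alpha> (g \<otimes> h \<otimes> inv g \<otimes> inv h) - (\<alpha> (g \<otimes> h \<otimes> inv g) + \<alpha> (inv h))"
        "2 dvd \<alpha> (g \<otimes> h \<otimes> inv g) - \<alpha> h" "2 dvd \<alpha> (inv h) + \<alpha> h"
      using hom_mod_mult[OF \<alpha>, of "g \<otimes> h \<otimes> inv g" "inv h"] mod2_hom_conj[OF \<alpha> g h] hom_mod_inv[OF \<alpha> h] g h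
      by (auto simp: cong_iff_dvd_diff)
    then show ?thesis
      unfolding cong_0_iff by presburger
  qed
  then show ?thesis
    using g h by (simp add: mod2_radical_def)
qed

lemma two_part_odd_index:
  assumes fin: "finite (carrier G)" and S: "sylow_subgroup 2 S G" and H: "subgroup H G" "S \<subseteq> H"
  shows "odd (card (rcosets H))"
proof
  assume "even (card (rcosets H))"
  have "card S dvd card H"
  proof -
    have "subgroup S (G\<lparr>carrier := H\<rparr>)"
      using S H by (intro subgroup_incl) (auto simp: sylow_subgroup_def)
    then have "card S dvd order (G\<lparr>carrier := H\<rparr>)"
      using group.lagrange[OF subgroup_imp_group[OF H(1)]] by (metis dvd_triv_right)
    then show ?thesis
      by (simp add: order_def)
  qed
  then have "2 * card S dvd card (rcosets H) * card H"
    using \<open>even (card (rcosets H))\<close> by (rule mult_dvd_mono[rotated])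
  then have "2 ^ Suc (multiplicity 2 (order G)) dvd order G"
    using S lagrange[OF H(1)] by (simp add: sylow_subgroup_def)
  moreover have "order G \<noteq> 0"
    using fin order_gt_0_iff_finite by auto
  ultimately have "Suc (multiplicity 2 (order G)) \<le> multiplicity 2 (order G)"
    by (intro multiplicity_geI) auto
  then show False
    by simp
qed

text \<open>
  Let \<open>N\<close> be the radical. \<open>N \<inter> S\<close> is trivial as \<open>N\<close> has odd order. \<open>N S\<close> contains \<open>N\<close>, hence all
  commutators and squares, so it is normal with a quotient in which every square is trivial; this
  quotient has odd order because \<open>N S\<close> contains a Sylow \<open>2\<close>-subgroup, so it is trivial. Finally,
  squares and commutators of elements of \<open>S\<close> lie in \<open>N \<inter> S\<close>.
\<close>

lemma elementary_normal_complement: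
  assumes fin: "finite (carrier G)" and S: "sylow_subgroup 2 S G"
    and odd: "odd (card mod2_radical)"
  shows "normal_complement mod2_radical S G" "elementary_2_abelian (G\<lparr>carrier := S\<rparr>)"
proof -
  define N where "N = mod2_radical"
  interpret N: normal N G
    unfolding N_def by (rule mod2_radical_normal)
  have Ssub: "subgroup S G"
    using S by (simp add: sylow_subgroup_def)
  interpret S: subgroup S G
    by (rule Ssub)
  have int: "N \<inter> S = {\<one>}"
  proof -
    have NSsub: "subgroup (N \<inter> S) G"
      using N.subgroup_axioms Ssub by (rule subgroup_Int)
    have D: "card (N \<inter> S) dvd card H" if "subgroup H G" "N \<inter> S \<subseteq> H" for H
    proof -
      have "subgroup (N \<inter> S) (G\<lparr>carrier := H\<rparr>)"
        using NSsub that by (intro subgroup_incl)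
      then have "card (N \<inter> S) dvd order (G\<lparr>carrier := H\<rparr>)"
        using group.lagrange[OF subgroup_imp_group[OF that(1)]] by (metis dvd_triv_right)
      then show ?thesis
        by (simp add: order_def)
    qed
    have "card (N \<inter> S) dvd card N" "card (N \<inter> S) dvd card S"
      by (rule D; use N.subgroup_axioms Ssub in blast)+
    moreover have "card S = 2 ^ multiplicity 2 (order G)"
      using S by (simp add: sylow_subgroup_def)
    moreover have "coprime (card N) (2 ^ multiplicity 2 (order G))"
      using odd by (simp add: N_def)
    ultimately have "card (N \<inter> S) = 1"
      by (metis coprime_common_divisor_nat)
    then show ?thesis
      using N.one_closed S.one_closed by (metis IntI card_1_singletonE singletonD)
  qed
  have prodNS: "N <#> S = carrier G"
  proof -
    define H where "H = N <#> S"
    have Hsub: "subgroup H G"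
      unfolding H_def by (rule mult_norm_subgroup[OF N.normal_axioms Ssub])
    interpret H: subgroup H G
      by (rule Hsub)
    have NH: "N \<subseteq> H"
    proof
      fix n assume "n \<in> N"
      then have "n = n \<otimes> \<one>"
        by simp
      then show "n \<in> H"
        unfolding H_def set_mult_def using \<open>n \<in> N\<close> S.one_closed by blast
    qed
    have SH: "S \<subseteq> H"
    proof
      fix x assume "x \<in> S"
      then have "x = \<one> \<otimes> x"
        by simp
      then show "x \<in> H"
        unfolding H_def set_mult_def using \<open>x \<in> S\<close> N.one_closed by blast
    qed
    have "H \<lhd> G"
    proof (rule normal_invI[OF Hsub])
      fix x h assume x: "x \<in> carrier G" and h: "h \<in> H"
      have "x \<otimes> h \<otimes> inv x \<otimes> inv h \<in> H"
        using commutator_in_mod2_radical[OF x, of h] h NH by (auto simp: N_def)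
      then have "x \<otimes> h \<otimes> inv x \<otimes> inv h \<otimes> h \<in> H"
        using h by simp
      then show "x \<otimes> h \<otimes> inv x \<in> H"
        using x h by (simp add: m_assoc)
    qed
    then interpret HN: normal H G .
    interpret Q: group "G Mod H"
      by (rule HN.factorgroup_is_group)
    have oddQ: "odd (order (G Mod H))"
      using two_part_odd_index[OF fin S Hsub SH] by (simp add: order_def FactGroup_def)
    have "g \<in> H" if g: "g \<in> carrier G" for g
    proof -
      define C where "C = H #> g"
      have C: "C \<in> carrier (G Mod H)"
        using g by (auto simp: C_def FactGroup_def RCOSETS_def)
      have "C \<otimes>\<^bsub>G Mod H\<^esub> C = H #> (g \<otimes> g)"
        using g by (simp add: C_def FactGroup_def HN.rcos_sum)
      also have "\<dots> = H"
        using square_in_mod2_radical[OF g] NH g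
        by (intro H.rcos_const[OF is_group]) (auto simp: N_def)
      finally have "C \<otimes>\<^bsub>G Mod H\<^esub> C = \<one>\<^bsub>G Mod H\<^esub>"
        by (simp add: FactGroup_def)
      moreover have "C [^]\<^bsub>G Mod H\<^esub> (2::nat) = C \<otimes>\<^bsub>G Mod H\<^esub> C"
        using C Q.l_one by (simp add: numeral_2_eq_2 del: one_FactGroup mult_FactGroup)
      ultimately have "C [^]\<^bsub>G Mod H\<^esub> (2::nat) = \<one>\<^bsub>G Mod H\<^esub>"
        by simp
      then have "Q.ord C dvd 2"
        using Q.pow_eq_id[OF C] by blast
      moreover have "Q.ord C dvd order (G Mod H)"
        using C by (rule Q.ord_dvd_group_order)
      ultimately have "Q.ord C = 1"
        using oddQ by (metis dvd_trans even_Suc gcd_nat.extremum_unique is_unit_gcd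
            prime_nat_iff two_is_prime_nat)
      then have "C = H"
        using C Q.ord_eq_1 by (simp add: FactGroup_def)
      then show ?thesis
        using rcos_self[OF g Hsub] by (simp add: C_def)
    qed
    then show ?thesis
      using H.subset by (auto simp: H_def)
  qed
  show "normal_complement mod2_radical S G"
    using N.normal_axioms int prodNS by (simp add: normal_complement_def N_def)
  have sq: "x \<otimes> x = \<one>" if "x \<in> S" for x
    using square_in_mod2_radical[of x] that int by (auto simp: N_def)
  have comm: "x \<otimes> y = y \<otimes> x" if xy: "x \<in> S" "y \<in> S" for x y
  proof -
    have "x \<otimes> y \<otimes> inv x \<otimes> inv y \<in> N \<inter> S"
      using commutator_in_mod2_radical[of x y] xy by (simp add: N_def)
    then have "x \<otimes> y \<otimes> inv x \<otimes> inv y = \<one>"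
      using int by blast
    then have "x \<otimes> y \<otimes> inv x \<otimes> inv y \<otimes> (y \<otimes> x) = y \<otimes> x"
      using xy by simp
    moreover have "x \<otimes> y \<otimes> inv x \<otimes> inv y \<otimes> (y \<otimes> x) = x \<otimes> y"
    proof -
      have "inv x \<otimes> (inv y \<otimes> (y \<otimes> x)) = \<one>"
        using xy by (simp flip: m_assoc)
      then show ?thesis
        using xy by (simp add: m_assoc)
    qed
    ultimately show ?thesis
      by simp
  qed
  have grpS: "group (G\<lparr>carrier := S\<rparr>)"
    by (rule subgroup_imp_group[OF Ssub])
  then interpret GS: group "G\<lparr>carrier := S\<rparr>" .
  have "comm_group (G\<lparr>carrier := S\<rparr>)"
    using comm by (intro GS.group_comm_groupI) auto
  moreover have "GS.ord x dvd 2" if x: "x \<in> carrier (G\<lparr>carrier := S\<rparr>)" for x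
  proof -
    have "x [^]\<^bsub>G\<lparr>carrier := S\<rparr>\<^esub> (2::nat) = \<one>\<^bsub>G\<lparr>carrier := S\<rparr>\<^esub>"
      using x sq[of x] by (simp add: numeral_2_eq_2)
    then show ?thesis
      using GS.pow_eq_id[OF x] by blast
  qed
  ultimately show "elementary_2_abelian (G\<lparr>carrier := S\<rparr>)"
    by (simp add: elementary_2_abelian_def)
qed

lemma normal_complement_odd:
  assumes fin: "finite (carrier G)" and S: "sylow_subgroup 2 S G" and N: "normal_complement N S G"
  shows "odd (card N)"
proof
  assume even: "even (card N)"
  interpret N: normal N G
    using N by (simp add: normal_complement_def)
  have Ssub: "subgroup S G"
    using S by (simp add: sylow_subgroup_def)
  interpret S: subgroup S G
    by (rule Ssub)
  have "inj_on (\<lambda>(n, s). n \<otimes> s) (N \<times> S)"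
  proof (rule inj_onI, clarify)
    fix n s n' s' assume ns: "n \<in> N" "s \<in> S" "n' \<in> N" "s' \<in> S" "n \<otimes> s = n' \<otimes> s'"
    have "inv n' \<otimes> n = s' \<otimes> inv s"
    proof -
      have "inv n' \<otimes> n = inv n' \<otimes> (n \<otimes> s) \<otimes> inv s"
        using ns(1-4) by (simp add: m_assoc)
      also have "inv n' \<otimes> (n \<otimes> s) = s'"
        unfolding ns(5) using ns by (simp flip: m_assoc)
      finally show ?thesis .
    qed
    moreover have "inv n' \<otimes> n \<in> N" "s' \<otimes> inv s \<in> S"
      using ns by auto
    ultimately have "s' \<otimes> inv s \<in> N \<inter> S"
      by simp
    then have "s' \<otimes> inv s = \<one>"
      using N unfolding normal_complement_def by blast
    then have "s' = s"
      using ns by (metis S.mem_carrier inv_closed inv_equality inv_inv)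
    then show "n = n' \<and> s = s'"
      using ns by simp
  qed
  moreover have "N <#> S = (\<lambda>(n, s). n \<otimes> s) ` (N \<times> S)"
    by (force simp: set_mult_def)
  then have "(\<lambda>(n, s). n \<otimes> s) ` (N \<times> S) = carrier G"
    using N by (simp add: normal_complement_def)
  ultimately have "order G = card N * card S"
    unfolding order_def by (metis card_image card_cartesian_product)
  then have "2 * card S dvd order G"
    using even by (simp add: mult_dvd_mono)
  then have "2 ^ Suc (multiplicity 2 (order G)) dvd order G"
    using S by (simp add: sylow_subgroup_def)
  moreover have "order G \<noteq> 0"
    using fin order_gt_0_iff_finite by auto
  ultimately have "Suc (multiplicity 2 (order G)) \<le> multiplicity 2 (order G)"
    by (intro multiplicity_geI) auto
  then show False
    by simp
qed

text \<open>
  If the radical had even order, Cauchy's theorem would give an element of order \<open>2\<close> in it, on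
  which all homomorphisms to \<open>\<int>/2\<close> vanish, contrary to \<open>gen1_all_imp_hom\<close>.
\<close>

theorem gen1_all_iff:
  assumes fin: "finite (carrier G)" and p: "prime p" "p dvd order G" and S: "sylow_subgroup 2 S G"
  shows "(\<forall>n F. is_cocycle (int p) G n F \<longrightarrow> gen1 (int p) G n F) \<longleftrightarrow>
    p = 2 \<and> S \<noteq> {\<one>} \<and> elementary_2_abelian (G\<lparr>carrier := S\<rparr>) \<and> (\<exists>N. normal_complement N S G)"
proof
  assume gen: "\<forall>n F. is_cocycle (int p) G n F \<longrightarrow> gen1 (int p) G n F"
  have hom: "p = 2 \<and> (\<exists>\<alpha>. hom_mod 2 G \<alpha> \<and> \<not> [\<alpha> c = 0] (mod 2))"
    if "c \<in> carrier G" "c \<noteq> \<one>" "c [^] p = \<one>" for c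
    using gen1_all_imp_hom[OF fin p(1) that] gen by blast
  obtain c where "c \<in> carrier G" "c \<noteq> \<one>" "c [^] p = \<one>"
    using Cauchy_element[OF fin p] by blast
  then have p2: "p = 2"
    using hom by blast
  interpret N: normal mod2_radical G
    by (rule mod2_radical_normal)
  have "odd (card mod2_radical)"
  proof
    assume even: "even (card mod2_radical)"
    have grp: "group (G\<lparr>carrier := mod2_radical\<rparr>)"
      by (rule subgroup_imp_group[OF N.subgroup_axioms])
    have "finite (carrier (G\<lparr>carrier := mod2_radical\<rparr>))"
      using fin N.subset finite_subset by auto
    moreover have "2 dvd order (G\<lparr>carrier := mod2_radical\<rparr>)"
      using even by (simp add: order_def)
    ultimately obtain c where "c \<in> mod2_radical" "c \<noteq> \<one>" "c [^]\<^bsub>G\<lparr>carrier := mod2_radical\<rparr>\<^esub> (2::nat) = \<one>"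
      using group.Cauchy_element[OF grp _ two_is_prime_nat] by auto
    then have c: "c \<in> mod2_radical" "c \<in> carrier G" "c \<noteq> \<one>" "c [^] p = \<one>"
      using p2 by (auto simp: nat_pow_consistent[symmetric])
    then obtain \<alpha> where "hom_mod 2 G \<alpha>" "\<not> [\<alpha> c = 0] (mod 2)"
      using hom by blast
    then show False
      using c(1) unfolding mod2_radical_def by blast
  qed
  note elementary_normal_complement[OF fin S this]
  moreover have "S \<noteq> {\<one>}"
  proof
    assume "S = {\<one>}"
    then have "2 ^ multiplicity 2 (order G) = (1::nat)"
      using S by (simp add: sylow_subgroup_def)
    then have "multiplicity 2 (order G) = 0"
      by simp
    moreover have "order G \<noteq> 0"
      using fin order_gt_0_iff_finite by auto
    ultimately have "\<not> 2 dvd order G"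
      by (simp add: multiplicity_eq_zero_iff)
    then show False
      using p(2) p2 by simp
  qed
  ultimately show "p = 2 \<and> S \<noteq> {\<one>} \<and> elementary_2_abelian (G\<lparr>carrier := S\<rparr>) \<and> (\<exists>N. normal_complement N S G)"
    using p2 by blast
next
  assume R: "p = 2 \<and> S \<noteq> {\<one>} \<and> elementary_2_abelian (G\<lparr>carrier := S\<rparr>) \<and> (\<exists>N. normal_complement N S G)"
  then obtain N where N: "normal_complement N S G"
    by blast
  have Ssub: "subgroup S G"
    using S by (simp add: sylow_subgroup_def)
  have comm: "comm_group (G\<lparr>carrier := S\<rparr>)"
    using R by (simp add: elementary_2_abelian_def)
  interpret GS: comm_group "G\<lparr>carrier := S\<rparr>"
    by (rule comm)
  have sq: "x \<otimes>\<^bsub>G\<lparr>carrier := S\<rparr>\<^esub> x = \<one>\<^bsub>G\<lparr>carrier := S\<rparr>\<^esub>" if x: "x \<in> carrier (G\<lparr>carrier := S\<rparr>)" for x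
  proof -
    have "GS.ord x dvd 2"
      using R x by (simp add: elementary_2_abelian_def)
    then have "x [^]\<^bsub>G\<lparr>carrier := S\<rparr>\<^esub> (2::nat) = \<one>\<^bsub>G\<lparr>carrier := S\<rparr>\<^esub>"
      using GS.pow_eq_id[OF x] by blast
    then show ?thesis
      using x subgroup.mem_carrier[OF Ssub] by (simp add: numeral_2_eq_2)
  qed
  have finS: "finite (carrier (G\<lparr>carrier := S\<rparr>))"
    using fin subgroup.subset[OF Ssub] finite_subset by auto
  have "gen1 2 G n F" if F: "is_cocycle 2 G n F" for n F
  proof (rule gen1_normal_complement[OF fin _ Ssub _ _ normal_complement_odd[OF fin S N] _ F])
    show "N \<lhd> G" "N \<inter> S = {\<one>}" "N <#> S = carrier G"
      using N by (auto simp: normal_complement_def)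
    show "gen1 2 (G\<lparr>carrier := S\<rparr>) n F" if "is_cocycle 2 (G\<lparr>carrier := S\<rparr>) n F" for n F
      using comm finS sq that by (rule gen1_elementary_abelian)
  qed
  then show "\<forall>n F. is_cocycle (int p) G n F \<longrightarrow> gen1 (int p) G n F"
    using R by simp
qed

end

section \<open>Homogeneous and inhomogeneous cochains\<close>

lemma sd_index:
  "sd F xs = (\<Sum>i<length xs. (- 1) ^ i * F (take i xs @ drop (Suc i) xs))"
proof (induction xs arbitrary: F)
  case (Cons x xs)
  have "(\<Sum>i<length (x # xs). (- 1) ^ i * F (take i (x # xs) @ drop (Suc i) (x # xs)))
      = F xs + (\<Sum>i<length xs. (- 1) ^ Suc i * F (x # take i xs @ drop (Suc i) xs))"
    by (simp only: length_Cons sum.lessThan_Suc_shift) simp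
  also have "\<dots> = F xs - sd (\<lambda>ys. F (x # ys)) xs"
    unfolding Cons by (simp add: sum_negf)
  finally show ?case
    by simp
qed simp

text \<open>
  The change of coordinates between homogeneous and inhomogeneous cochains:
  \<open>(g\<^sub>0, \<dots>, g\<^sub>n) \<mapsto> (g\<^sub>0\<inverse> g\<^sub>1, \<dots>, g\<^bsub>n-1\<^esub>\<inverse> g\<^sub>n)\<close>, with the partial products as inverse once \<open>g\<^sub>0\<close> is given.
\<close>

fun quots :: "('a, 'm) monoid_scheme \<Rightarrow> 'a list \<Rightarrow> 'a list" where
  "quots G [] = []"
| "quots G [g] = []"
| "quots G (g # h # hs) = (inv\<^bsub>G\<^esub> g \<otimes>\<^bsub>G\<^esub> h) # quots G (h # hs)"

fun prods :: "('a, 'm) monoid_scheme \<Rightarrow> 'a \<Rightarrow> 'a list \<Rightarrow> 'a list" where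
  "prods G g [] = [g]"
| "prods G g (x # xs) = g # prods G (g \<otimes>\<^bsub>G\<^esub> x) xs"

lemma quots_tl: "quots G (tl gs) = tl (quots G gs)"
  by (cases gs; cases "tl gs") auto

lemma quots_butlast: "quots G (butlast gs) = butlast (quots G gs)"
proof (induction G gs rule: quots.induct)
  case (3 G g h hs)
  then show ?case
    by (cases hs) auto
qed auto

lemma quots_drop: "quots G (drop k gs) = drop k (quots G gs)"
proof (induction k arbitrary: gs)
  case (Suc k)
  have "drop (Suc k) gs = drop k (tl gs)" "drop (Suc k) (quots G gs) = drop k (tl (quots G gs))"
    by (simp_all add: drop_Suc)
  then show ?case
    using Suc by (simp add: quots_tl)
qed simp

lemma quots_take: "quots G (take (Suc k) gs) = take k (quots G gs)"
proof (induction k arbitrary: gs)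
  case 0
  then show ?case
    by (cases gs) auto
next
  case (Suc k)
  show ?case
  proof (cases gs)
    case (Cons g hs)
    then show ?thesis
      using Suc[of hs] by (cases hs) auto
  qed simp
qed

context group
begin

lemma quots_closed: "gs \<in> tuples G (Suc n) \<Longrightarrow> quots G gs \<in> tuples G n"
proof (induction n arbitrary: gs)
  case 0
  then show ?case
    by (auto simp: tuples_def length_Suc_conv)
next
  case (Suc n)
  then obtain g h hs where gs: "gs = g # h # hs" "g \<in> carrier G" "h \<in> carrier G" "h # hs \<in> tuples G (Suc n)"
    by (auto simp: tuples_def length_Suc_conv)
  then show ?case
    using Suc.IH[OF gs(4)] by (auto simp: tuples_def)
qed

lemma quots_translate:
  assumes "g \<in> carrier G" "set gs \<subseteq> carrier G"
  shows "quots G (map ((\<otimes>) g) gs) = quots G gs"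
  using assms(2)
proof (induction gs rule: induct_list012)
  case (3 x y zs)
  have "inv (g \<otimes> x) \<otimes> (g \<otimes> y) = inv x \<otimes> (inv g \<otimes> (g \<otimes> y))"
    using 3 assms(1) by (simp add: inv_mult_group m_assoc)
  also have "inv g \<otimes> (g \<otimes> y) = y"
    using 3 assms(1) by (simp flip: m_assoc)
  finally show ?case
    using 3 by simp
qed auto

lemma prods_closed: "g \<in> carrier G \<Longrightarrow> xs \<in> tuples G n \<Longrightarrow> prods G g xs \<in> tuples G (Suc n)"
proof (induction xs arbitrary: g n)
  case (Cons x xs)
  then show ?case
    by (cases n) (auto simp: tuples_def)
qed (auto simp: tuples_def)

lemma prods_hd: "\<exists>hs. prods G g xs = g # hs"
  by (cases xs) auto

lemma quots_prods: "g \<in> carrier G \<Longrightarrow> set xs \<subseteq> carrier G \<Longrightarrow> quots G (prods G g xs) = xs"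
proof (induction xs arbitrary: g)
  case (Cons x xs)
  obtain hs where hs: "prods G (g \<otimes> x) xs = (g \<otimes> x) # hs"
    using prods_hd by blast
  have "inv g \<otimes> (g \<otimes> x) = x"
    using Cons by (simp flip: m_assoc)
  then show ?case
    using Cons.IH[of "g \<otimes> x"] Cons.prems hs by simp
qed simp

lemma prods_quots: "g \<in> carrier G \<Longrightarrow> set hs \<subseteq> carrier G \<Longrightarrow> prods G g (quots G (g # hs)) = g # hs"
proof (induction hs arbitrary: g)
  case (Cons h hs)
  have "g \<otimes> (inv g \<otimes> h) = h"
    using Cons by (simp flip: m_assoc)
  then show ?case
    using Cons by simp
qed simp

lemma prods_translate:
  "k \<in> carrier G \<Longrightarrow> g \<in> carrier G \<Longrightarrow> set xs \<subseteq> carrier G \<Longrightarrow> prods G (k \<otimes> g) xs = map ((\<otimes>) k) (prods G g xs)"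
  by (induction xs arbitrary: g) (auto simp: m_assoc)

lemma prods_one_quots:
  assumes "gs \<in> tuples G (Suc n)"
  shows "prods G \<one> (quots G gs) = map ((\<otimes>) (inv (hd gs))) gs"
proof -
  obtain g hs where gs: "gs = g # hs" "g \<in> carrier G" "set hs \<subseteq> carrier G"
    using assms by (cases gs) (auto simp: tuples_def)
  have "prods G (inv g \<otimes> g) (quots G gs) = map ((\<otimes>) (inv g)) (prods G g (quots G gs))"
    using gs quots_closed[OF assms] by (intro prods_translate) (auto simp: tuples_def)
  then show ?thesis
    using gs prods_quots by simp
qed

text \<open>
  Deleting an inner entry multiplies the two neighbouring quotients; this matches the terms of the
  two differentials.
\<close>

lemma quots_remove:
  assumes "set gs \<subseteq> carrier G" "Suc (Suc i) < length gs"
  shows "quots G (take (Suc i) gs @ drop (Suc (Suc i)) gs)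
    = take i (quots G gs) @ (quots G gs ! i \<otimes> quots G gs ! Suc i) # drop (i + 2) (quots G gs)"
  using assms
proof (induction i arbitrary: gs)
  case 0
  then obtain a b c cs where gs: "gs = a # b # c # cs"
    by (cases gs; cases "tl gs"; cases "tl (tl gs)") auto
  have "inv a \<otimes> b \<otimes> (inv b \<otimes> c) = inv a \<otimes> (b \<otimes> (inv b \<otimes> c))"
    using 0 gs by (simp add: m_assoc)
  also have "b \<otimes> (inv b \<otimes> c) = c"
    using 0 gs by (simp flip: m_assoc)
  finally show ?case
    by (simp add: gs)
next
  case (Suc i)
  then obtain a b cs where gs: "gs = a # b # cs"
    by (cases gs; cases "tl gs") auto
  have IH: "quots G (take (Suc i) (b # cs) @ drop (Suc (Suc i)) (b # cs))
    = take i (quots G (b # cs)) @ (quots G (b # cs) ! i \<otimes> quots G (b # cs) ! Suc i) # drop (i + 2) (quots G (b # cs))"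
    using Suc.prems gs by (intro Suc.IH) auto
  then show ?case
    by (simp add: gs)
qed

end

definition homog :: "('a, 'm) monoid_scheme \<Rightarrow> ('a list \<Rightarrow> int) \<Rightarrow> 'a list \<Rightarrow> int" where
  "homog G f gs = f (quots G gs)"

text \<open>
  Reduction modulo \<open>p\<close> and restriction to the tuples give the canonical representative, an element
  of the carrier of the cochain group.
\<close>

definition dehomog :: "('a, 'm) monoid_scheme \<Rightarrow> nat \<Rightarrow> nat \<Rightarrow> ('a list \<Rightarrow> int) \<Rightarrow> 'a list \<Rightarrow> int" where
  "dehomog G p n F = (\<lambda>xs\<in>tuples G n. F (prods G \<one>\<^bsub>G\<^esub> xs) mod int p)"

text \<open>
  The coboundaries in homogeneous form. The case \<open>n = 0\<close> is separate because the complex of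
  cochains is not augmented.
\<close>

definition null_class :: "int \<Rightarrow> ('a, 'm) monoid_scheme \<Rightarrow> nat \<Rightarrow> ('a list \<Rightarrow> int) \<Rightarrow> bool" where
  "null_class m G n F \<longleftrightarrow> (case n of
      0 \<Rightarrow> \<forall>gs\<in>tuples G 1. [F gs = 0] (mod m)
    | Suc k \<Rightarrow> \<exists>U. inv_cochain m G k U \<and> (\<forall>gs\<in>tuples G (Suc (Suc k)). [F gs = sd U gs] (mod m)))"

locale mod_p_cochains = group G for G :: "('a, 'm) monoid_scheme" (structure) +
  fixes p :: nat
  assumes prime_p: "prime p"
begin

abbreviation R where "R \<equiv> residue_ring (int p)"
abbreviation Cn where "Cn \<equiv> cochain_group G R"
abbreviation Zn where "Zn \<equiv> cocycles G R"
abbreviation Bn where "Bn \<equiv> coboundaries G R"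

lemma carrier_R: "carrier R = {0..int p - 1}"
  by (simp add: residue_ring_def)

lemma add_R: "x \<oplus>\<^bsub>R\<^esub> y = (x + y) mod int p"
  by (simp add: residue_ring_def)

lemma mult_R: "x \<otimes>\<^bsub>R\<^esub> y = (x * y) mod int p"
  by (simp add: residue_ring_def)

lemma zero_R: "\<zero>\<^bsub>R\<^esub> = 0" and one_R: "\<one>\<^bsub>R\<^esub> = 1"
  by (simp_all add: residue_ring_def)

lemma p_pos: "0 < int p"
  using prime_gt_0_nat[OF prime_p] by simp

lemma mod_in_R: "x mod int p \<in> carrier R"
  using p_pos by (simp add: carrier_R)

lemma R_eq_iff: "x \<in> carrier R \<Longrightarrow> y \<in> carrier R \<Longrightarrow> x = y \<longleftrightarrow> [x = y] (mod int p)"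
  by (auto simp: carrier_R cong_def)

lemma add_monoid_R: "comm_group (add_monoid R)"
proof -
  interpret residues_prime p R
    by unfold_locales (simp_all add: prime_p)
  show ?thesis
    by (rule a_comm_group)
qed

lemma coboundary_eq:
  assumes xs: "xs \<in> tuples G (Suc n)"
  shows "[coboundary G R n f xs = f (tl xs)
     + (\<Sum>i<n. (- 1) ^ Suc i * f (take i xs @ (xs ! i \<otimes> xs ! Suc i) # drop (i + 2) xs))
     + (- 1) ^ Suc n * f (butlast xs)] (mod int p)"
    and "coboundary G R n f xs \<in> carrier R"
proof -
  interpret RR: residues_prime p R
    by unfold_locales (simp_all add: prime_p)
  have t: "((\<ominus>\<^bsub>R\<^esub> \<one>\<^bsub>R\<^esub>) [^]\<^bsub>R\<^esub> k) \<otimes>\<^bsub>R\<^esub> x = ((- 1) ^ k * x) mod int p" for k :: nat and x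
  proof -
    have "\<ominus>\<^bsub>R\<^esub> \<one>\<^bsub>R\<^esub> = (- 1) mod int p"
      by (simp only: RR.res_neg_eq RR.res_one_eq)
    then show ?thesis
      by (simp only: RR.pow_cong mult_R mod_mult_left_eq)
  qed
  have e: "coboundary G R n f xs = (f (tl xs)
     + (\<Sum>i<n. (- 1) ^ Suc i * f (take i xs @ (xs ! i \<otimes> xs ! Suc i) # drop (i + 2) xs))
     + (- 1) ^ Suc n * f (butlast xs)) mod int p"
    using xs unfolding coboundary_def t
    by (simp only: restrict_apply' RR.sum_cong finite_lessThan add_R mod_simps)
  show "[coboundary G R n f xs = f (tl xs)
     + (\<Sum>i<n. (- 1) ^ Suc i * f (take i xs @ (xs ! i \<otimes> xs ! Suc i) # drop (i + 2) xs))
     + (- 1) ^ Suc n * f (butlast xs)] (mod int p)"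
    unfolding e by (simp add: cong_def)
  show "coboundary G R n f xs \<in> carrier R"
    unfolding e by (rule mod_in_R)
qed

lemma coboundary_quots:
  assumes gs: "gs \<in> tuples G (Suc (Suc n))"
  shows "[coboundary G R n f (quots G gs) = sd (homog G f) gs] (mod int p)"
proof -
  let ?q = "quots G gs"
  have q: "?q \<in> tuples G (Suc n)"
    using gs by (rule quots_closed)
  have lg: "length gs = Suc (Suc n)" "set gs \<subseteq> carrier G"
    using gs by (auto simp: tuples_def)
  have "sd (homog G f) gs = (\<Sum>i<Suc (Suc n). (- 1) ^ i * homog G f (take i gs @ drop (Suc i) gs))"
    unfolding sd_index lg ..
  also have "\<dots> = homog G f (tl gs)
      + (\<Sum>i<n. (- 1) ^ Suc i * homog G f (take (Suc i) gs @ drop (Suc (Suc i)) gs))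
      + (- 1) ^ Suc n * homog G f (take (Suc n) gs @ drop (Suc (Suc n)) gs)"
    unfolding sum.lessThan_Suc_shift[of _ "Suc n"] sum.lessThan_Suc[of _ n] by (simp add: drop_Suc)
  also have "homog G f (tl gs) = f (tl ?q)"
    by (simp add: homog_def quots_tl)
  also have "take (Suc n) gs @ drop (Suc (Suc n)) gs = butlast gs"
    using lg by (simp add: butlast_conv_take)
  also have "homog G f (butlast gs) = f (butlast ?q)"
    by (simp add: homog_def quots_butlast)
  also have "(\<Sum>i<n. (- 1) ^ Suc i * homog G f (take (Suc i) gs @ drop (Suc (Suc i)) gs))
      = (\<Sum>i<n. (- 1) ^ Suc i * f (take i ?q @ (?q ! i \<otimes> ?q ! Suc i) # drop (i + 2) ?q))"
    unfolding homog_def using lg by (intro sum.cong refl) (simp only: lessThan_iff quots_remove Suc_less_eq)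
  finally show ?thesis
    using coboundary_eq(1)[OF q, of f] by simp
qed

lemma quots_surj:
  assumes "xs \<in> tuples G n"
  shows "prods G \<one> xs \<in> tuples G (Suc n)" "quots G (prods G \<one> xs) = xs"
  using prods_closed[of \<one> xs n] quots_prods[of \<one> xs] assms by (auto simp: tuples_def)

lemma all_quots: "(\<forall>xs\<in>tuples G n. P xs) \<longleftrightarrow> (\<forall>gs\<in>tuples G (Suc n). P (quots G gs))"
  using quots_surj quots_closed by metis

lemma carrier_Cn: "f \<in> carrier (Cn n) \<longleftrightarrow> f \<in> extensional (tuples G n) \<and> (\<forall>xs\<in>tuples G n. f xs \<in> carrier R)"
  by (auto simp: cochain_group_def PiE_iff)

lemma mult_Cn: "f \<otimes>\<^bsub>Cn n\<^esub> h = (\<lambda>xs\<in>tuples G n. (f xs + h xs) mod int p)"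
  by (simp add: cochain_group_def add_R)

lemma one_Cn: "\<one>\<^bsub>Cn n\<^esub> = (\<lambda>xs\<in>tuples G n. 0)"
  by (simp add: cochain_group_def zero_R)

lemma group_Cn: "comm_group (Cn n)"
proof -
  interpret A: comm_group "add_monoid R"
    by (rule add_monoid_R)
  have "group (Cn n)"
    unfolding cochain_group_def by (rule product_group) (rule A.is_group)
  then show ?thesis
    by (rule group.group_comm_groupI) (simp add: mult_Cn add.commute)
qed

lemma Cn_eq_iff:
  assumes "f \<in> carrier (Cn n)" "h \<in> carrier (Cn n)"
  shows "f = h \<longleftrightarrow> (\<forall>gs\<in>tuples G (Suc n). [homog G f gs = homog G h gs] (mod int p))"
proof -
  have "f = h \<longleftrightarrow> (\<forall>xs\<in>tuples G n. [f xs = h xs] (mod int p))"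
    using assms R_eq_iff unfolding carrier_Cn by (metis extensionalityI)
  then show ?thesis
    unfolding homog_def all_quots[of n] .
qed

lemma homog_inv: "inv_cochain m G n (homog G f)"
  unfolding inv_cochain_def homog_def using quots_translate by (auto simp: tuples_def)

lemma homog_mult:
  assumes "gs \<in> tuples G (Suc n)"
  shows "[homog G (f \<otimes>\<^bsub>Cn n\<^esub> h) gs = homog G f gs + homog G h gs] (mod int p)"
  using quots_closed[OF assms] by (simp add: homog_def mult_Cn cong_def)

lemma homog_one: "gs \<in> tuples G (Suc n) \<Longrightarrow> homog G \<one>\<^bsub>Cn n\<^esub> gs = 0"
  using quots_closed by (simp add: homog_def one_Cn)

lemma coboundary_closed: "coboundary G R n f \<in> carrier (Cn (Suc n))"
  unfolding carrier_Cn using coboundary_eq(2) by (auto simp: coboundary_def)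

lemma homog_coboundary:
  assumes "gs \<in> tuples G (Suc (Suc n))"
  shows "[homog G (coboundary G R n f) gs = sd (homog G f) gs] (mod int p)"
  unfolding homog_def[of G "coboundary G R n f"] using assms by (rule coboundary_quots)

lemma mem_cocycles: "f \<in> Zn n \<longleftrightarrow> f \<in> carrier (Cn n) \<and> is_cocycle (int p) G n (homog G f)"
proof -
  have "coboundary G R n f = \<one>\<^bsub>Cn (Suc n)\<^esub> \<longleftrightarrow> (\<forall>gs\<in>tuples G (Suc (Suc n)). [sd (homog G f) gs = 0] (mod int p))"
  proof -
    have "coboundary G R n f = \<one>\<^bsub>Cn (Suc n)\<^esub> \<longleftrightarrow>
      (\<forall>gs\<in>tuples G (Suc (Suc n)). [homog G (coboundary G R n f) gs = homog G \<one>\<^bsub>Cn (Suc n)\<^esub> gs] (mod int p))"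
      using group.is_monoid[OF comm_group.axioms(2)[OF group_Cn]]
      by (intro Cn_eq_iff coboundary_closed monoid.one_closed)
    also have "\<dots> \<longleftrightarrow> (\<forall>gs\<in>tuples G (Suc (Suc n)). [sd (homog G f) gs = 0] (mod int p))"
    proof (intro ball_cong refl)
      fix gs assume gs: "gs \<in> tuples G (Suc (Suc n))"
      show "[homog G (coboundary G R n f) gs = homog G \<one>\<^bsub>Cn (Suc n)\<^esub> gs] (mod int p) \<longleftrightarrow>
          [sd (homog G f) gs = 0] (mod int p)"
        using homog_coboundary[OF gs, of f] homog_one[OF gs] by (simp add: cong_def)
    qed
    finally show ?thesis .
  qed
  then show ?thesis
    by (auto simp: cocycles_def kernel_def is_cocycle_def homog_inv)
qed

lemma dehomog_closed: "dehomog G p n F \<in> carrier (Cn n)"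
  unfolding carrier_Cn dehomog_def using mod_in_R by auto

lemma homog_dehomog:
  assumes F: "inv_cochain (int p) G n F" and gs: "gs \<in> tuples G (Suc n)"
  shows "[homog G (dehomog G p n F) gs = F gs] (mod int p)"
proof -
  have h: "inv (hd gs) \<in> carrier G"
    using gs by (cases gs) (auto simp: tuples_def)
  have "[homog G (dehomog G p n F) gs = F (map ((\<otimes>) (inv (hd gs))) gs)] (mod int p)"
    using quots_closed[OF gs] prods_one_quots[OF gs] by (simp add: homog_def dehomog_def)
  also have "[F (map ((\<otimes>) (inv (hd gs))) gs) = F gs] (mod int p)"
    using F h gs unfolding inv_cochain_def by blast
  finally show ?thesis .
qed

lemma mem_coboundaries: "f \<in> Bn n \<longleftrightarrow> f \<in> carrier (Cn n) \<and> null_class (int p) G n (homog G f)"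
proof (cases n)
  case 0
  have one: "\<one>\<^bsub>Cn 0\<^esub> \<in> carrier (Cn 0)"
    using group.is_monoid[OF comm_group.axioms(2)[OF group_Cn]] by (rule monoid.one_closed)
  have "f = \<one>\<^bsub>Cn 0\<^esub> \<longleftrightarrow> (\<forall>gs\<in>tuples G (Suc 0). [homog G f gs = 0] (mod int p))" if "f \<in> carrier (Cn 0)"
    using Cn_eq_iff[OF that one] homog_one[of _ 0] by simp
  then show ?thesis
    using one unfolding 0 by (auto simp: coboundaries_def null_class_def)
next
  case (Suc k)
  show ?thesis
  proof
    assume "f \<in> Bn n"
    then obtain u where u: "f = coboundary G R k u"
      by (auto simp: coboundaries_def Suc)
    have "inv_cochain (int p) G k (homog G u) \<and>
        (\<forall>gs\<in>tuples G (Suc (Suc k)). [homog G f gs = sd (homog G u) gs] (mod int p))"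
      using homog_inv homog_coboundary by (simp add: u)
    then have "null_class (int p) G n (homog G f)"
      unfolding Suc null_class_def nat.case by blast
    then show "f \<in> carrier (Cn n) \<and> null_class (int p) G n (homog G f)"
      using coboundary_closed by (simp add: Suc u)
  next
    assume f: "f \<in> carrier (Cn n) \<and> null_class (int p) G n (homog G f)"
    then obtain U where U: "inv_cochain (int p) G k U"
        "\<And>gs. gs \<in> tuples G (Suc (Suc k)) \<Longrightarrow> [homog G f gs = sd U gs] (mod int p)"
      by (auto simp: null_class_def Suc)
    have "f = coboundary G R k (dehomog G p k U)"
    proof (subst Cn_eq_iff[of _ n])
      show "\<forall>gs\<in>tuples G (Suc n). [homog G f gs = homog G (coboundary G R k (dehomog G p k U)) gs] (mod int p)"
      proof
        fix gs assume gs: "gs \<in> tuples G (Suc n)"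
        have "[homog G (coboundary G R k (dehomog G p k U)) gs = sd (homog G (dehomog G p k U)) gs] (mod int p)"
          using homog_coboundary gs Suc by simp
        also have "[sd (homog G (dehomog G p k U)) gs = sd U gs] (mod int p)"
          using gs Suc by (intro sd_cong_mod homog_dehomog[OF U(1)]) (auto simp: tuples_def)
        also have "[sd U gs = homog G f gs] (mod int p)"
          using U(2) gs Suc by (intro cong_sym[OF U(2)]) simp
        finally show "[homog G f gs = homog G (coboundary G R k (dehomog G p k U)) gs] (mod int p)"
          by (rule cong_sym)
      qed
    qed (use f coboundary_closed Suc in auto)
    then show "f \<in> Bn n"
      using dehomog_closed by (auto simp: coboundaries_def Suc)
  qed
qed

end

section \<open>The cohomology ring\<close>

lemma null_class_zero:
  "(\<And>gs. gs \<in> tuples G (Suc n) \<Longrightarrow> [F gs = 0] (mod m)) \<Longrightarrow> null_class m G n F"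
proof (cases n)
  case (Suc k)
  assume F: "\<And>gs. gs \<in> tuples G (Suc n) \<Longrightarrow> [F gs = 0] (mod m)"
  have "inv_cochain m G k (\<lambda>_. 0) \<and> (\<forall>gs\<in>tuples G (Suc (Suc k)). [F gs = sd (\<lambda>_. 0) gs] (mod m))"
    using F Suc by (simp add: inv_cochain_zero sd_zero)
  then show ?thesis
    unfolding Suc null_class_def nat.case by blast
qed (simp add: null_class_def)

context group
begin

lemma null_class_add:
  assumes "null_class m G n F" "null_class m G n F'"
    and "\<And>gs. gs \<in> tuples G (Suc n) \<Longrightarrow> [H gs = a * F gs + b * F' gs] (mod m)"
  shows "null_class m G n H"
proof (cases n)
  case 0
  have "[H gs = 0] (mod m)" if "gs \<in> tuples G 1" for gs
  proof -
    have "[a * F gs + b * F' gs = a * 0 + b * 0] (mod m)"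
      using assms(1,2) that 0 by (intro cong_add cong_scalar_left) (auto simp: null_class_def)
    then show ?thesis
      using assms(3)[of gs] that 0 cong_trans by simp blast
  qed
  then show ?thesis
    by (simp add: null_class_def 0)
next
  case (Suc k)
  obtain U U' where U: "inv_cochain m G k U" "\<And>gs. gs \<in> tuples G (Suc (Suc k)) \<Longrightarrow> [F gs = sd U gs] (mod m)"
    and U': "inv_cochain m G k U'" "\<And>gs. gs \<in> tuples G (Suc (Suc k)) \<Longrightarrow> [F' gs = sd U' gs] (mod m)"
    using assms(1,2) unfolding Suc null_class_def nat.case by blast
  let ?V = "\<lambda>gs. a * U gs + b * U' gs"
  have "inv_cochain m G k ?V"
    by (intro inv_cochain_add inv_cochain_mult U(1) U'(1))
  moreover have "[H gs = sd ?V gs] (mod m)" if gs: "gs \<in> tuples G (Suc (Suc k))" for gs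
  proof -
    have "[H gs = a * F gs + b * F' gs] (mod m)"
      using assms(3) gs Suc by simp
    also have "[a * F gs + b * F' gs = a * sd U gs + b * sd U' gs] (mod m)"
      using gs by (intro cong_add cong_scalar_left U U')
    finally show ?thesis
      by (simp add: sd_add sd_mult)
  qed
  ultimately show ?thesis
    unfolding Suc null_class_def nat.case by blast
qed

lemma null_class_cocycle:
  assumes "null_class m G n F" "inv_cochain m G n F"
  shows "is_cocycle m G n F"
proof -
  have "[sd F gs = 0] (mod m)" if gs: "gs \<in> tuples G (Suc (Suc n))" for gs
  proof (cases n)
    case 0
    then show ?thesis
      using assms(1) gs by (intro sd_cong_zero) (auto simp: null_class_def tuples_def)
  next
    case (Suc k)
    obtain U where U: "\<And>gs. gs \<in> tuples G (Suc (Suc k)) \<Longrightarrow> [F gs = sd U gs] (mod m)"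
      using assms(1) unfolding Suc null_class_def nat.case by blast
    have "[sd F gs = sd (\<lambda>ys. sd U ys) gs] (mod m)"
      using gs Suc by (intro sd_cong_mod U) (auto simp: tuples_def)
    then show ?thesis
      by (simp add: sd_sd)
  qed
  then show ?thesis
    using assms(2) by (simp add: is_cocycle_def)
qed

lemma gen1_null_class:
  assumes F: "gen1 m G n F" and N: "null_class m G n (\<lambda>gs. F' gs - F gs)"
  shows "gen1 m G n F'"
proof (cases n)
  case 0
  show ?thesis
    using F
  proof (rule gen1_cong)
    fix gs assume "gs \<in> tuples G (Suc n)"
    then show "[F' gs = F gs] (mod m)"
      using N 0 by (simp add: null_class_def cong_diff_iff_cong_0)
  qed
next
  case (Suc k)
  obtain U where U: "inv_cochain m G k U" "\<And>gs. gs \<in> tuples G (Suc (Suc k)) \<Longrightarrow> [F' gs - F gs = sd U gs] (mod m)"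
    using N unfolding Suc null_class_def nat.case by blast
  show ?thesis
    unfolding Suc
  proof (rule gen1.coh[OF F[unfolded Suc] U(1)])
    fix gs assume "gs \<in> tuples G (Suc (Suc k))"
    from U(2)[OF this] show "[F' gs = F gs + sd U gs] (mod m)"
      by (simp add: cong_iff_dvd_diff algebra_simps)
  qed
qed

lemma null_class_cupk_left:
  assumes F: "null_class m G k F" and H: "is_cocycle m G n H"
  shows "null_class m G (k + n) (cupk k F H)"
proof (cases k)
  case 0
  show ?thesis
  proof (rule null_class_zero)
    fix gs assume "gs \<in> tuples G (Suc (k + n))"
    then have "[F (take 1 gs) = 0] (mod m)"
      using F 0 tuples_take[of gs G "Suc n" 1] by (simp add: null_class_def)
    then show "[cupk k F H gs = 0] (mod m)"
      using 0 cong_scalar_right[of "F (take 1 gs)" 0 m] by (simp add: cupk_def)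
  qed
next
  case (Suc j)
  obtain U where U: "inv_cochain m G j U" "\<And>gs. gs \<in> tuples G (Suc (Suc j)) \<Longrightarrow> [F gs = sd U gs] (mod m)"
    using F unfolding Suc null_class_def nat.case by blast
  have "inv_cochain m G (j + n) (cupk j U H)"
    using U(1) H by (intro inv_cochain_cupk) (auto simp: is_cocycle_def)
  moreover have "[cupk (Suc j) F H gs = sd (cupk j U H) gs] (mod m)" if gs: "gs \<in> tuples G (Suc (Suc (j + n)))" for gs
  proof -
    have "[cupk (Suc j) F H gs = cupk (Suc j) (sd U) H gs] (mod m)"
      unfolding cupk_def using tuples_take[OF gs, of "Suc (Suc j)"] by (intro cong_scalar_right U(2)) simp
    then show ?thesis
      using cupk_coboundary[OF H gs] cong_trans by blast
  qed
  ultimately have "null_class m G (Suc (j + n)) (cupk (Suc j) F H)"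
    unfolding null_class_def nat.case by blast
  then show ?thesis
    by (simp add: Suc)
qed

lemma null_class_cupk_right:
  assumes F: "is_cocycle m G k F" and H: "null_class m G n H"
  shows "null_class m G (k + n) (cupk k F H)"
proof (cases n)
  case 0
  show ?thesis
  proof (rule null_class_zero)
    fix gs assume "gs \<in> tuples G (Suc (k + n))"
    then have "[H (drop k gs) = 0] (mod m)"
      using H 0 tuples_drop[of gs G "Suc k" k] by (simp add: null_class_def)
    then show "[cupk k F H gs = 0] (mod m)"
      using cong_scalar_left[of "H (drop k gs)" 0 m] by (simp add: cupk_def)
  qed
next
  case (Suc j)
  obtain U where U: "inv_cochain m G j U" "\<And>gs. gs \<in> tuples G (Suc (Suc j)) \<Longrightarrow> [H gs = sd U gs] (mod m)"
    using H unfolding Suc null_class_def nat.case by blast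
  have "inv_cochain m G (k + j) (cupk k F (\<lambda>ys. (- 1) ^ k * U ys))"
    using U(1) F by (intro inv_cochain_cupk inv_cochain_mult) (auto simp: is_cocycle_def)
  moreover have "[cupk k F H gs = sd (cupk k F (\<lambda>ys. (- 1) ^ k * U ys)) gs] (mod m)"
    if gs: "gs \<in> tuples G (Suc (Suc (k + j)))" for gs
  proof -
    have "[cupk k F H gs = cupk k F (sd U) gs] (mod m)"
      unfolding cupk_def using tuples_drop[OF gs, of k] by (intro cong_scalar_left U(2)) simp
    then show ?thesis
      using cupk_coboundary_right[OF F gs] cong_trans by blast
  qed
  ultimately have "null_class m G (Suc (k + j)) (cupk k F H)"
    unfolding null_class_def nat.case by blast
  then show ?thesis
    by (simp add: Suc)
qed

lemma is_cocycle_cong: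
  assumes F: "is_cocycle m G n F" and e: "\<And>gs. gs \<in> tuples G (Suc n) \<Longrightarrow> [F' gs = F gs] (mod m)"
  shows "is_cocycle m G n F'"
proof -
  have "inv_cochain m G n F'"
    using F e by (intro inv_cochain_cong[of m n F F']) (auto simp: is_cocycle_def)
  moreover have "[sd F' gs = 0] (mod m)" if gs: "gs \<in> tuples G (Suc (Suc n))" for gs
  proof -
    have "[sd F' gs = sd F gs] (mod m)"
      using gs by (intro sd_cong_mod e) (auto simp: tuples_def)
    then show ?thesis
      using F gs cong_trans unfolding is_cocycle_def by blast
  qed
  ultimately show ?thesis
    by (simp add: is_cocycle_def)
qed

lemma is_cocycle_comb:
  assumes "is_cocycle m G n F" "is_cocycle m G n F'"
  shows "is_cocycle m G n (\<lambda>gs. a * F gs + b * F' gs)"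
proof -
  have "[a * sd F gs + b * sd F' gs = a * 0 + b * 0] (mod m)" if "gs \<in> tuples G (Suc (Suc n))" for gs
    using assms that by (intro cong_add cong_scalar_left) (auto simp: is_cocycle_def)
  then show ?thesis
    using assms by (auto simp: is_cocycle_def sd_add sd_mult intro!: inv_cochain_add inv_cochain_mult)
qed

lemma is_cocycle_cupk:
  assumes F: "is_cocycle m G k F" and H: "is_cocycle m G n H"
  shows "is_cocycle m G (k + n) (cupk k F H)"
proof -
  have "[sd (cupk k F H) gs = 0] (mod m)" if gs: "gs \<in> tuples G (Suc (Suc (k + n)))" for gs
  proof -
    have "[sd F (take (Suc (Suc k)) gs) = 0] (mod m)" "[sd H (drop k gs) = 0] (mod m)"
      using tuples_take[OF gs, of "Suc (Suc k)"] tuples_drop[OF gs, of k] F H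
      by (auto simp: is_cocycle_def)
    then show ?thesis
      unfolding cupk_def[abs_def] using gs by (subst leibniz) (auto simp: tuples_def cong_0_iff)
  qed
  then show ?thesis
    using inv_cochain_cupk F H unfolding is_cocycle_def by blast
qed

end

context mod_p_cochains
begin

abbreviation Hn where "Hn \<equiv> cohomology G R"
abbreviation cls where "cls \<equiv> cohomology_class G R"
abbreviation Zg where "Zg n \<equiv> (Cn n)\<lparr>carrier := Zn n\<rparr>"
abbreviation hm where "hm \<equiv> homog G"
abbreviation null where "null \<equiv> null_class (int p) G"

lemma Cn_group: "group (Cn n)"
  using group_Cn comm_group.axioms(2) by blast

lemma homog_inv_Cn:
  assumes f: "f \<in> carrier (Cn n)" and gs: "gs \<in> tuples G (Suc n)"
  shows "[hm (inv\<^bsub>Cn n\<^esub> f) gs = - hm f gs] (mod int p)"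
proof -
  interpret C: group "Cn n"
    by (rule Cn_group)
  have "[hm (inv\<^bsub>Cn n\<^esub> f \<otimes>\<^bsub>Cn n\<^esub> f) gs = hm (inv\<^bsub>Cn n\<^esub> f) gs + hm f gs] (mod int p)"
    using gs by (rule homog_mult)
  then have "[hm (inv\<^bsub>Cn n\<^esub> f) gs + hm f gs = hm (inv\<^bsub>Cn n\<^esub> f \<otimes>\<^bsub>Cn n\<^esub> f) gs] (mod int p)"
    by (rule cong_sym)
  moreover have "hm (inv\<^bsub>Cn n\<^esub> f \<otimes>\<^bsub>Cn n\<^esub> f) gs = 0"
    unfolding C.l_inv[OF f] by (rule homog_one[OF gs])
  ultimately have "int p dvd hm (inv\<^bsub>Cn n\<^esub> f) gs + hm f gs"
    by (simp only: cong_0_iff)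
  then show ?thesis
    by (simp only: cong_iff_dvd_diff diff_minus_eq_add)
qed

lemma Zn_subgroup: "subgroup (Zn n) (Cn n)"
proof -
  interpret C: group "Cn n"
    by (rule Cn_group)
  show ?thesis
  proof (rule C.subgroupI)
    show "Zn n \<subseteq> carrier (Cn n)"
      by (auto simp: mem_cocycles)
    have "is_cocycle (int p) G n (hm \<one>\<^bsub>Cn n\<^esub>)"
      using homog_one null_class_zero[of G n "hm \<one>\<^bsub>Cn n\<^esub>" "int p"]
      by (intro null_class_cocycle homog_inv) auto
    then have "\<one>\<^bsub>Cn n\<^esub> \<in> Zn n"
      by (simp add: mem_cocycles)
    then show "Zn n \<noteq> {}"
      by blast
    show "inv\<^bsub>Cn n\<^esub> f \<in> Zn n" if f: "f \<in> Zn n" for f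
    proof -
      have "is_cocycle (int p) G n (\<lambda>gs. - 1 * hm f gs + 0 * hm f gs)"
        using f by (intro is_cocycle_comb) (auto simp: mem_cocycles)
      then have "is_cocycle (int p) G n (hm (inv\<^bsub>Cn n\<^esub> f))"
        using f homog_inv_Cn by (elim is_cocycle_cong) (simp add: mem_cocycles)
      then show ?thesis
        using f by (simp add: mem_cocycles)
    qed
    show "f \<otimes>\<^bsub>Cn n\<^esub> h \<in> Zn n" if f: "f \<in> Zn n" "h \<in> Zn n" for f h
    proof -
      have "is_cocycle (int p) G n (\<lambda>gs. 1 * hm f gs + 1 * hm h gs)"
        using f by (intro is_cocycle_comb) (auto simp: mem_cocycles)
      then have "is_cocycle (int p) G n (hm (f \<otimes>\<^bsub>Cn n\<^esub> h))"
        using homog_mult by (elim is_cocycle_cong) simp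
      then show ?thesis
        using f by (simp add: mem_cocycles)
    qed
  qed
qed

lemma Zg_group: "comm_group (Zg n)"
proof -
  interpret C: comm_group "Cn n"
    by (rule group_Cn)
  have "group (Zg n)"
    by (rule C.subgroup_imp_group[OF Zn_subgroup])
  then show ?thesis
    by (rule group.group_comm_groupI) (use C.m_comm mem_cocycles in auto)
qed

lemma Zn_carrier: "f \<in> Zn n \<Longrightarrow> f \<in> carrier (Cn n)"
  by (simp add: mem_cocycles)

lemma Bn_Zn: "Bn n \<subseteq> Zn n"
  using null_class_cocycle homog_inv by (auto simp: mem_cocycles mem_coboundaries)

lemma Bn_subgroup: "subgroup (Bn n) (Zg n)"
proof -
  interpret C: group "Cn n"
    by (rule Cn_group)
  have "subgroup (Bn n) (Cn n)"
  proof (rule C.subgroupI)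
    show "Bn n \<subseteq> carrier (Cn n)"
      by (auto simp: mem_coboundaries)
    have "\<one>\<^bsub>Cn n\<^esub> \<in> Bn n"
      using homog_one by (simp add: mem_coboundaries null_class_zero)
    then show "Bn n \<noteq> {}"
      by blast
    show "inv\<^bsub>Cn n\<^esub> f \<in> Bn n" if f: "f \<in> Bn n" for f
    proof -
      have fc: "f \<in> carrier (Cn n)" and N: "null n (hm f)"
        using f by (simp_all add: mem_coboundaries)
      have "null n (hm (inv\<^bsub>Cn n\<^esub> f))"
      proof (rule null_class_add[OF N N, of _ "- 1" 0])
        fix gs assume "gs \<in> tuples G (Suc n)"
        from homog_inv_Cn[OF fc this]
        show "[hm (inv\<^bsub>Cn n\<^esub> f) gs = - 1 * hm f gs + 0 * hm f gs] (mod int p)"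
          by simp
      qed
      then show ?thesis
        using f by (simp add: mem_coboundaries)
    qed
    show "f \<otimes>\<^bsub>Cn n\<^esub> h \<in> Bn n" if f: "f \<in> Bn n" "h \<in> Bn n" for f h
    proof -
      have N: "null n (hm f)" "null n (hm h)"
        using f by (simp_all add: mem_coboundaries)
      have "null n (hm (f \<otimes>\<^bsub>Cn n\<^esub> h))"
      proof (rule null_class_add[OF N, of _ 1 1])
        fix gs assume "gs \<in> tuples G (Suc n)"
        from homog_mult[OF this]
        show "[hm (f \<otimes>\<^bsub>Cn n\<^esub> h) gs = 1 * hm f gs + 1 * hm h gs] (mod int p)"
          by simp
      qed
      then show ?thesis
        using f by (simp add: mem_coboundaries)
    qed
  qed
  then show ?thesis
    using Zn_subgroup Bn_Zn by (intro C.subgroup_incl)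
qed

lemma Bn_normal: "Bn n \<lhd> Zg n"
  using Zg_group Bn_subgroup by (rule comm_group.subgroup_imp_normal)

lemma Hn_def: "Hn n = Zg n Mod Bn n"
  by (simp add: cohomology_def)

lemma cls_def: "cls n f = Bn n #>\<^bsub>Zg n\<^esub> f"
  by (simp add: cohomology_class_def r_coset_def)

lemma Hn_group: "comm_group (Hn n)"
  unfolding Hn_def by (rule comm_group.abelian_FactGroup[OF Zg_group Bn_subgroup])

lemma Hn_grp: "group (Hn n)"
  using Hn_group comm_group.axioms(2) by blast

lemma Hn_one [simp]: "\<one>\<^bsub>Hn n\<^esub> \<in> carrier (Hn n)"
  by (rule monoid.one_closed[OF group.is_monoid[OF Hn_grp]])

lemma Hn_l_one [simp]: "A \<in> carrier (Hn n) \<Longrightarrow> \<one>\<^bsub>Hn n\<^esub> \<otimes>\<^bsub>Hn n\<^esub> A = A"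
  by (rule monoid.l_one[OF group.is_monoid[OF Hn_grp]])

lemma Hn_r_one [simp]: "A \<in> carrier (Hn n) \<Longrightarrow> A \<otimes>\<^bsub>Hn n\<^esub> \<one>\<^bsub>Hn n\<^esub> = A"
  by (rule monoid.r_one[OF group.is_monoid[OF Hn_grp]])

lemma carrier_Hn: "carrier (Hn n) = cls n ` Zn n"
  unfolding Hn_def cls_def by (auto simp: FactGroup_def RCOSETS_def)

lemma cls_mult:
  assumes "f \<in> Zn n" "h \<in> Zn n"
  shows "cls n f \<otimes>\<^bsub>Hn n\<^esub> cls n h = cls n (f \<otimes>\<^bsub>Cn n\<^esub> h)"
  using normal.rcos_sum[OF Bn_normal, of f n h] assms by (simp add: Hn_def cls_def FactGroup_def set_mult_def)

lemma one_Zn: "\<one>\<^bsub>Cn n\<^esub> \<in> Zn n"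
  using subgroup.one_closed[OF Zn_subgroup] .

lemma cls_one: "cls n \<one>\<^bsub>Cn n\<^esub> = \<one>\<^bsub>Hn n\<^esub>"
proof -
  interpret B: subgroup "Bn n" "Zg n"
    by (rule Bn_subgroup)
  have "Bn n #>\<^bsub>Zg n\<^esub> \<one>\<^bsub>Zg n\<^esub> = Bn n"
    using B.one_closed by (intro B.rcos_const) (use Zg_group comm_group.axioms(2) in auto)
  then show ?thesis
    by (simp add: Hn_def cls_def FactGroup_def)
qed

lemma mem_cls:
  assumes f: "f \<in> Zn n"
  shows "h \<in> cls n f \<longleftrightarrow> h \<in> Zn n \<and> null n (\<lambda>gs. hm h gs - hm f gs)"
proof -
  interpret C: group "Cn n"
    by (rule Cn_group)
  interpret Z: subgroup "Zn n" "Cn n"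
    by (rule Zn_subgroup)
  show ?thesis
  proof
    assume "h \<in> cls n f"
    then obtain b where b: "b \<in> Bn n" "h = b \<otimes>\<^bsub>Cn n\<^esub> f"
      unfolding cls_def r_coset_def by auto
    have "null n (\<lambda>gs. hm h gs - hm f gs)"
    proof (rule null_class_add[of "int p" n "hm b" "hm b" _ 1 0])
      fix gs assume "gs \<in> tuples G (Suc n)"
      then show "[hm h gs - hm f gs = 1 * hm b gs + 0 * hm b gs] (mod int p)"
        using homog_mult[of gs n b f] by (simp add: b(2) cong_iff_dvd_diff algebra_simps)
    qed (use b in \<open>auto simp: mem_coboundaries\<close>)
    then show "h \<in> Zn n \<and> null n (\<lambda>gs. hm h gs - hm f gs)"
      using b f Bn_Zn by auto
  next
    assume h: "h \<in> Zn n \<and> null n (\<lambda>gs. hm h gs - hm f gs)"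
    define b where "b = h \<otimes>\<^bsub>Cn n\<^esub> inv\<^bsub>Cn n\<^esub> f"
    have bc: "b \<in> carrier (Cn n)"
      using h f by (simp add: b_def)
    have "null n (hm b)"
    proof (rule null_class_add[of "int p" n "\<lambda>gs. hm h gs - hm f gs" "\<lambda>gs. hm h gs - hm f gs" _ 1 0])
      fix gs assume gs: "gs \<in> tuples G (Suc n)"
      have "[hm b gs = hm h gs + hm (inv\<^bsub>Cn n\<^esub> f) gs] (mod int p)"
        unfolding b_def using gs by (rule homog_mult)
      also have "[hm h gs + hm (inv\<^bsub>Cn n\<^esub> f) gs = hm h gs + - hm f gs] (mod int p)"
        using f gs by (intro cong_add homog_inv_Cn) auto
      finally show "[hm b gs = 1 * (hm h gs - hm f gs) + 0 * (hm h gs - hm f gs)] (mod int p)"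
        by simp
    qed (use h in auto)
    then have "b \<in> Bn n"
      using bc by (simp add: mem_coboundaries)
    moreover have "h = b \<otimes>\<^bsub>Cn n\<^esub> f"
      using h f by (simp add: b_def C.m_assoc)
    ultimately show "h \<in> cls n f"
      unfolding cls_def r_coset_def by auto
  qed
qed

lemma cls_eqI:
  assumes "f \<in> Zn n" "h \<in> Zn n" "null n (\<lambda>gs. hm h gs - hm f gs)"
  shows "cls n f = cls n h"
proof -
  have "h \<in> Bn n #>\<^bsub>Zg n\<^esub> f"
    using mem_cls assms unfolding cls_def by blast
  then show ?thesis
    unfolding cls_def using assms(1) Bn_subgroup Zg_group
    by (intro group.repr_independence) (auto simp: comm_group.axioms(2))
qed

lemma cls_eqI_cong:
  assumes "f \<in> Zn n" "h \<in> Zn n" "\<And>gs. gs \<in> tuples G (Suc n) \<Longrightarrow> [hm h gs = hm f gs] (mod int p)"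
  shows "cls n f = cls n h"
  using assms by (intro cls_eqI null_class_zero) (auto simp: cong_diff_iff_cong_0)

lemma cls_self: "f \<in> Zn n \<Longrightarrow> f \<in> cls n f"
  by (simp add: mem_cls null_class_zero)

lemma mem_carrier_Hn:
  assumes "A \<in> carrier (Hn n)" "f \<in> A"
  shows "f \<in> Zn n" "A = cls n f"
proof -
  obtain f' where f': "f' \<in> Zn n" "A = cls n f'"
    using assms(1) by (auto simp: carrier_Hn)
  then have "f \<in> Zn n \<and> null n (\<lambda>gs. hm f gs - hm f' gs)"
    using assms(2) mem_cls by blast
  then show "f \<in> Zn n" "A = cls n f"
    using f' cls_eqI by auto
qed

lemma cochain_cup_homog:
  assumes "gs \<in> tuples G (Suc (k + n))"
  shows "hm (cochain_cup G R k n f h) gs = (cupk k (hm f) (hm h) gs) mod int p"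
  using quots_closed[OF assms] by (simp add: homog_def cochain_cup_def cupk_def mult_R quots_take quots_drop)

lemma cochain_cup_Zn:
  assumes f: "f \<in> Zn k" and h: "h \<in> Zn n"
  shows "cochain_cup G R k n f h \<in> Zn (k + n)"
proof -
  have "cochain_cup G R k n f h \<in> carrier (Cn (k + n))"
    unfolding carrier_Cn by (auto simp: cochain_cup_def mult_R mod_in_R)
  moreover have "is_cocycle (int p) G (k + n) (hm (cochain_cup G R k n f h))"
  proof (rule is_cocycle_cong[OF is_cocycle_cupk])
    show "is_cocycle (int p) G k (hm f)" "is_cocycle (int p) G n (hm h)"
      using f h by (auto simp: mem_cocycles)
  qed (simp add: cochain_cup_homog cong_def)
  ultimately show ?thesis
    by (simp add: mem_cocycles)
qed

text \<open>
  The union in the definition of the product collapses: changing a factor by a coboundary changes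
  the product by a coboundary, by the Leibniz rule.
\<close>

lemma cup_cls:
  assumes f: "f \<in> Zn k" and h: "h \<in> Zn n"
  shows "cup G R k n (cls k f) (cls n h) = cls (k + n) (cochain_cup G R k n f h)"
proof -
  have "cls (k + n) (cochain_cup G R k n f' h') = cls (k + n) (cochain_cup G R k n f h)"
    if f': "f' \<in> cls k f" and h': "h' \<in> cls n h" for f' h'
  proof -
    have 1: "f' \<in> Zn k" "null k (\<lambda>gs. hm f' gs - hm f gs)"
      using f' mem_cls[OF f] by auto
    have 2: "h' \<in> Zn n" "null n (\<lambda>gs. hm h' gs - hm h gs)"
      using h' mem_cls[OF h] by auto
    have "null (k + n) (\<lambda>gs. hm (cochain_cup G R k n f' h') gs - hm (cochain_cup G R k n f h) gs)"
    proof (rule null_class_add)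
      show "null (k + n) (cupk k (\<lambda>gs. hm f' gs - hm f gs) (hm h'))"
        using 1(2) 2(1) by (intro null_class_cupk_left) (simp_all add: mem_cocycles)
      show "null (k + n) (cupk k (hm f) (\<lambda>gs. hm h' gs - hm h gs))"
        using f 2(2) by (intro null_class_cupk_right) (simp_all add: mem_cocycles)
      fix gs assume gs: "gs \<in> tuples G (Suc (k + n))"
      have "[hm (cochain_cup G R k n f' h') gs - hm (cochain_cup G R k n f h) gs
          = cupk k (hm f') (hm h') gs - cupk k (hm f) (hm h) gs] (mod int p)"
        unfolding cochain_cup_homog[OF gs] by (intro cong_diff) (simp_all add: cong_def)
      then show "[hm (cochain_cup G R k n f' h') gs - hm (cochain_cup G R k n f h) gs
          = 1 * cupk k (\<lambda>gs. hm f' gs - hm f gs) (hm h') gs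
            + 1 * cupk k (hm f) (\<lambda>gs. hm h' gs - hm h gs) gs] (mod int p)"
        by (simp add: cupk_def algebra_simps)
    qed
    then show ?thesis
      using cochain_cup_Zn f h 1(1) 2(1) by (intro cls_eqI[symmetric]) auto
  qed
  moreover have "f \<in> cls k f" "h \<in> cls n h"
    using f h by (auto intro: cls_self)
  ultimately show ?thesis
    unfolding cup_def by blast
qed

lemma cup_closed:
  assumes "A \<in> carrier (Hn k)" "B \<in> carrier (Hn n)"
  shows "cup G R k n A B \<in> carrier (Hn (k + n))"
  using assms cochain_cup_Zn by (auto simp: carrier_Hn cup_cls)

lemma cup_one:
  assumes "A \<in> carrier (Hn k)" "B \<in> carrier (Hn n)" "A = \<one>\<^bsub>Hn k\<^esub> \<or> B = \<one>\<^bsub>Hn n\<^esub>"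
  shows "cup G R k n A B = \<one>\<^bsub>Hn (k + n)\<^esub>"
proof -
  have nul: "cls (k + n) (cochain_cup G R k n f h) = \<one>\<^bsub>Hn (k + n)\<^esub>"
    if fh: "f \<in> Zn k" "h \<in> Zn n" and N: "null (k + n) (cupk k (hm f) (hm h))" for f h
  proof -
    have "cls (k + n) \<one>\<^bsub>Cn (k + n)\<^esub> = cls (k + n) (cochain_cup G R k n f h)"
    proof (rule cls_eqI[OF one_Zn cochain_cup_Zn[OF fh]])
      show "null (k + n) (\<lambda>gs. hm (cochain_cup G R k n f h) gs - hm \<one>\<^bsub>Cn (k + n)\<^esub> gs)"
        by (rule null_class_add[OF N N, of _ 1 0]) (simp add: cochain_cup_homog homog_one cong_def)
    qed
    then show ?thesis
      by (simp add: cls_one)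
  qed
  have z: "null j (hm \<one>\<^bsub>Cn j\<^esub>)" for j
    by (rule null_class_zero) (simp add: homog_one)
  obtain f h where fh: "f \<in> Zn k" "A = cls k f" "h \<in> Zn n" "B = cls n h"
    using assms(1,2) by (auto simp: carrier_Hn)
  from assms(3) show ?thesis
  proof
    assume "A = \<one>\<^bsub>Hn k\<^esub>"
    then have "cup G R k n A B = cls (k + n) (cochain_cup G R k n \<one>\<^bsub>Cn k\<^esub> h)"
      using fh cup_cls[OF one_Zn fh(3)] by (simp add: cls_one)
    also have "\<dots> = \<one>\<^bsub>Hn (k + n)\<^esub>"
      using fh z by (intro nul one_Zn null_class_cupk_left) (auto simp: mem_cocycles)
    finally show ?thesis .
  next
    assume "B = \<one>\<^bsub>Hn n\<^esub>"
    then have "cup G R k n A B = cls (k + n) (cochain_cup G R k n f \<one>\<^bsub>Cn n\<^esub>)"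
      using fh cup_cls[OF fh(1) one_Zn] by (simp add: cls_one)
    also have "\<dots> = \<one>\<^bsub>Hn (k + n)\<^esub>"
      using fh z by (intro nul one_Zn null_class_cupk_right) (auto simp: mem_cocycles)
    finally show ?thesis .
  qed
qed

abbreviation Ring where "Ring \<equiv> cohomology_ring G R"

lemma carrier_Ring: "x \<in> carrier Ring \<longleftrightarrow> (\<forall>n. x n \<in> carrier (Hn n)) \<and> finite {n. x n \<noteq> \<one>\<^bsub>Hn n\<^esub>}"
  using carrier_sum_group[of UNIV Hn] Hn_grp by (auto simp: cohomology_ring_def PiE_UNIV_domain)

lemma mult_Ring: "(x \<otimes>\<^bsub>Ring\<^esub> y) n = finprod (Hn n) (\<lambda>i. cup G R i (n - i) (x i) (y (n - i))) {..n}"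
  by (simp add: cohomology_ring_def)

lemma add_Ring: "(x \<oplus>\<^bsub>Ring\<^esub> y) n = x n \<otimes>\<^bsub>Hn n\<^esub> y n"
  by (simp add: cohomology_ring_def)

lemma one_Ring: "\<one>\<^bsub>Ring\<^esub> = scalar G R 1"
  by (simp add: cohomology_ring_def one_R)

lemma a_inv_Ring:
  assumes "x \<in> carrier Ring"
  shows "\<ominus>\<^bsub>Ring\<^esub> x = (\<lambda>n. inv\<^bsub>Hn n\<^esub> x n)"
proof -
  have "add_monoid Ring = sum_group UNIV Hn"
    by (simp add: cohomology_ring_def)
  then have "\<ominus>\<^bsub>Ring\<^esub> x = inv\<^bsub>sum_group UNIV Hn\<^esub> x"
    by (simp add: a_inv_def)
  also have "\<dots> = (\<lambda>n. inv\<^bsub>Hn n\<^esub> x n)"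
    using assms Hn_grp by (simp add: inv_sum_group cohomology_ring_def restrict_UNIV)
  finally show ?thesis .
qed

lemma cup_closed':
  "i \<le> n \<Longrightarrow> A \<in> carrier (Hn i) \<Longrightarrow> B \<in> carrier (Hn (n - i)) \<Longrightarrow> cup G R i (n - i) A B \<in> carrier (Hn n)"
  using cup_closed[of A i B "n - i"] by simp

lemma homogeneous_closed:
  assumes "A \<in> carrier (Hn n)"
  shows "homogeneous G R n A \<in> carrier Ring"
proof -
  have "{m. homogeneous G R n A m \<noteq> \<one>\<^bsub>Hn m\<^esub>} \<subseteq> {n}"
    by (auto simp: homogeneous_def)
  then show ?thesis
    unfolding carrier_Ring using assms finite_subset by (auto simp: homogeneous_def)
qed

lemma scalar_cochain: "a \<in> carrier R \<Longrightarrow> (\<lambda>xs\<in>tuples G 0. a) \<in> Zn 0"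
proof -
  assume a: "a \<in> carrier R"
  have "(\<lambda>xs\<in>tuples G 0. a) \<in> carrier (Cn 0)"
    using a by (auto simp: carrier_Cn)
  moreover have "gen1 (int p) G 0 (hm (\<lambda>xs\<in>tuples G 0. a))"
  proof (rule gen1.const)
    fix gs assume "gs \<in> tuples G 1"
    then show "[hm (\<lambda>xs\<in>tuples G 0. a) gs = a] (mod int p)"
      using quots_closed[of gs 0] by (simp add: homog_def)
  qed
  ultimately show ?thesis
    by (simp add: mem_cocycles gen1_cocycle)
qed

lemma homogeneous_mult:
  assumes f: "f \<in> Zn k" and h: "h \<in> Zn n"
  shows "homogeneous G R k (cls k f) \<otimes>\<^bsub>Ring\<^esub> homogeneous G R n (cls n h)
    = homogeneous G R (k + n) (cls (k + n) (cochain_cup G R k n f h))"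
proof
  fix m
  interpret H: comm_group "Hn m"
    by (rule Hn_group)
  let ?x = "homogeneous G R k (cls k f)" and ?y = "homogeneous G R n (cls n h)"
  have cl: "?x i \<in> carrier (Hn i)" "?y i \<in> carrier (Hn i)" for i
    using homogeneous_closed f h by (auto simp: carrier_Ring carrier_Hn)
  have one: "cup G R i (m - i) (?x i) (?y (m - i)) = \<one>\<^bsub>Hn m\<^esub>" if "i \<le> m" "i \<noteq> k \<or> m - i \<noteq> n" for i
  proof -
    have "?x i = \<one>\<^bsub>Hn i\<^esub> \<or> ?y (m - i) = \<one>\<^bsub>Hn (m - i)\<^esub>"
      using that by (auto simp: homogeneous_def)
    then show ?thesis
      using cup_one[OF cl] that by simp
  qed
  show "(?x \<otimes>\<^bsub>Ring\<^esub> ?y) m = homogeneous G R (k + n) (cls (k + n) (cochain_cup G R k n f h)) m"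
  proof (cases "m = k + n")
    case True
    have C: "cls (k + n) (cochain_cup G R k n f h) \<in> carrier (Hn m)"
      using cochain_cup_Zn[OF f h] True by (simp add: carrier_Hn)
    have "(?x \<otimes>\<^bsub>Ring\<^esub> ?y) m = finprod (Hn m) (\<lambda>i. if k = i then cls (k + n) (cochain_cup G R k n f h) else \<one>\<^bsub>Hn m\<^esub>) {..m}"
      unfolding mult_Ring
    proof (rule H.finprod_cong')
      fix i assume i: "i \<in> {..m}"
      show "cup G R i (m - i) (?x i) (?y (m - i)) = (if k = i then cls (k + n) (cochain_cup G R k n f h) else \<one>\<^bsub>Hn m\<^esub>)"
      proof (cases "i = k")
        case True
        then show ?thesis
          using \<open>m = k + n\<close> cup_cls[OF f h] by (simp add: homogeneous_def)
      next
        case False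
        then show ?thesis
          using one i by simp
      qed
    qed (use C in auto)
    also have "\<dots> = cls (k + n) (cochain_cup G R k n f h)"
      using H.finprod_singleton[of k "{..m}" "\<lambda>_. cls (k + n) (cochain_cup G R k n f h)"]
        C True by simp
    finally show ?thesis
      using True by (simp add: homogeneous_def)
  next
    case False
    have "(?x \<otimes>\<^bsub>Ring\<^esub> ?y) m = \<one>\<^bsub>Hn m\<^esub>"
      unfolding mult_Ring by (rule H.finprod_one_eqI, rule one) (use False in auto)
    then show ?thesis
      using False by (simp add: homogeneous_def)
  qed
qed

lemma mult_closed:
  assumes x: "x \<in> carrier Ring" and y: "y \<in> carrier Ring"
  shows "x \<otimes>\<^bsub>Ring\<^esub> y \<in> carrier Ring"
proof -
  have xc: "x i \<in> carrier (Hn i)" "y i \<in> carrier (Hn i)" for i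
    using x y by (auto simp: carrier_Ring)
  have "(x \<otimes>\<^bsub>Ring\<^esub> y) n \<in> carrier (Hn n)" for n
  proof -
    interpret H: comm_group "Hn n"
      by (rule Hn_group)
    show ?thesis
      unfolding mult_Ring using xc cup_closed' by (intro H.finprod_closed) auto
  qed
  moreover have "finite {n. (x \<otimes>\<^bsub>Ring\<^esub> y) n \<noteq> \<one>\<^bsub>Hn n\<^esub>}"
  proof -
    let ?A = "{n. x n \<noteq> \<one>\<^bsub>Hn n\<^esub>}" and ?B = "{n. y n \<noteq> \<one>\<^bsub>Hn n\<^esub>}"
    have "(x \<otimes>\<^bsub>Ring\<^esub> y) n = \<one>\<^bsub>Hn n\<^esub>" if n: "n \<notin> (\<lambda>(i, j). i + j) ` (?A \<times> ?B)" for n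
    proof -
      interpret H: comm_group "Hn n"
        by (rule Hn_group)
      have "cup G R i (n - i) (x i) (y (n - i)) = \<one>\<^bsub>Hn n\<^esub>" if i: "i \<le> n" for i
      proof -
        have "\<not> (i \<in> ?A \<and> n - i \<in> ?B)"
          using n i by (metis (mono_tags, lifting) SigmaI case_prod_conv image_eqI le_add_diff_inverse)
        then show ?thesis
          using cup_one[OF xc(1)[of i] xc(2)[of "n - i"]] i by auto
      qed
      then show ?thesis
        unfolding mult_Ring by (intro H.finprod_one_eqI) simp
    qed
    then have "{n. (x \<otimes>\<^bsub>Ring\<^esub> y) n \<noteq> \<one>\<^bsub>Hn n\<^esub>} \<subseteq> (\<lambda>(i, j). i + j) ` (?A \<times> ?B)"
      by blast
    moreover have "finite (?A \<times> ?B)"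
      using x y by (simp add: carrier_Ring)
    ultimately show ?thesis
      using finite_subset by blast
  qed
  ultimately show ?thesis
    by (simp add: carrier_Ring)
qed

abbreviation gens where
  "gens \<equiv> scalar G R ` carrier R \<union> homogeneous G R 1 ` carrier (Hn 1)"

lemma scalar_closed: "a \<in> carrier R \<Longrightarrow> scalar G R a \<in> carrier Ring"
  unfolding scalar_def using scalar_cochain by (intro homogeneous_closed) (auto simp: carrier_Hn)

lemma one_in_R: "1 \<in> carrier R"
  using prime_ge_2_nat[OF prime_p] by (simp add: carrier_R)

lemma generate_closed: "x \<in> generate_ring Ring gens \<Longrightarrow> x \<in> carrier Ring"
proof (induction rule: generate_ring.induct)
  case one
  then show ?case
    unfolding one_Ring by (intro scalar_closed one_in_R)
next
  case (incl h)
  then show ?case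
    using scalar_closed homogeneous_closed by auto
next
  case (a_inv h)
  have hc: "h n \<in> carrier (Hn n)" for n
    using a_inv.IH by (simp add: carrier_Ring)
  have "inv\<^bsub>Hn n\<^esub> h n \<in> carrier (Hn n)" for n
    by (rule group.inv_closed[OF Hn_grp hc])
  moreover have "inv\<^bsub>Hn n\<^esub> h n \<noteq> \<one>\<^bsub>Hn n\<^esub> \<longleftrightarrow> h n \<noteq> \<one>\<^bsub>Hn n\<^esub>" for n
    using group.inv_eq_1_iff[OF Hn_grp hc] by simp
  ultimately show ?case
    using a_inv.IH by (simp add: a_inv_Ring carrier_Ring)
next
  case (eng_add x y)
  have xy: "x n \<in> carrier (Hn n)" "y n \<in> carrier (Hn n)" for n
    using eng_add.IH by (simp_all add: carrier_Ring)
  have "x n \<otimes>\<^bsub>Hn n\<^esub> y n \<in> carrier (Hn n)" for n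
    by (rule monoid.m_closed[OF group.is_monoid[OF Hn_grp] xy])
  moreover have "finite {n. x n \<otimes>\<^bsub>Hn n\<^esub> y n \<noteq> \<one>\<^bsub>Hn n\<^esub>}"
  proof (rule finite_subset)
    have "x n \<otimes>\<^bsub>Hn n\<^esub> y n = \<one>\<^bsub>Hn n\<^esub>" if "x n = \<one>\<^bsub>Hn n\<^esub>" "y n = \<one>\<^bsub>Hn n\<^esub>" for n
      using monoid.l_one[OF group.is_monoid[OF Hn_grp] xy(2)[of n]] that by simp
    then show "{n. x n \<otimes>\<^bsub>Hn n\<^esub> y n \<noteq> \<one>\<^bsub>Hn n\<^esub>} \<subseteq> {n. x n \<noteq> \<one>\<^bsub>Hn n\<^esub>} \<union> {n. y n \<noteq> \<one>\<^bsub>Hn n\<^esub>}"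
      by blast
    show "finite ({n. x n \<noteq> \<one>\<^bsub>Hn n\<^esub>} \<union> {n. y n \<noteq> \<one>\<^bsub>Hn n\<^esub>})"
      using eng_add.IH by (simp add: carrier_Ring)
  qed
  ultimately show ?case
    by (simp add: carrier_Ring add_Ring)
next
  case (eng_mult x y)
  then show ?case
    by (intro mult_closed)
qed

text \<open>
  Since \<open>gen1\<close> is closed under changes by coboundaries, one representative in \<open>gen1\<close> already
  yields all of them (see \<open>generated_cls\<close>).
\<close>

definition generated :: "nat \<Rightarrow> ('a list \<Rightarrow> int) set \<Rightarrow> bool" where
  "generated n A \<longleftrightarrow> A \<in> carrier (Hn n) \<and> (\<forall>f\<in>A. gen1 (int p) G n (hm f))"

lemma generated_cls:
  assumes f: "f \<in> Zn n" "gen1 (int p) G n (hm f)"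
  shows "generated n (cls n f)"
  unfolding generated_def using f(1) gen1_null_class[OF f(2)] mem_cls[OF f(1)] by (auto simp: carrier_Hn)

lemma generatedE:
  assumes "generated n A"
  obtains f where "f \<in> Zn n" "A = cls n f" "gen1 (int p) G n (hm f)"
  using assms cls_self unfolding generated_def carrier_Hn by blast

lemma generated_one: "generated n \<one>\<^bsub>Hn n\<^esub>"
  unfolding cls_one[symmetric]
  by (rule generated_cls[OF one_Zn]) (rule gen1_cong[OF gen1_zero], simp add: homog_one)

lemma generated_mult: "generated n A \<Longrightarrow> generated n B \<Longrightarrow> generated n (A \<otimes>\<^bsub>Hn n\<^esub> B)"
proof (elim generatedE)
  fix f h assume f: "f \<in> Zn n" "A = cls n f" "gen1 (int p) G n (hm f)"
    and h: "h \<in> Zn n" "B = cls n h" "gen1 (int p) G n (hm h)"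
  have "gen1 (int p) G n (hm (f \<otimes>\<^bsub>Cn n\<^esub> h))"
    by (rule gen1_cong[OF gen1.add[OF f(3) h(3)] homog_mult])
  then show "generated n (A \<otimes>\<^bsub>Hn n\<^esub> B)"
    using f h subgroup.m_closed[OF Zn_subgroup] by (simp add: cls_mult generated_cls)
qed

lemma generated_inv:
  assumes "generated n A"
  shows "generated n (inv\<^bsub>Hn n\<^esub> A)"
proof -
  interpret C: group "Cn n"
    by (rule Cn_group)
  obtain f where f: "f \<in> Zn n" "A = cls n f" "gen1 (int p) G n (hm f)"
    using generatedE[OF assms] .
  have fi: "inv\<^bsub>Cn n\<^esub> f \<in> Zn n"
    using subgroup.m_inv_closed[OF Zn_subgroup f(1)] .
  have "cls n (inv\<^bsub>Cn n\<^esub> f) \<otimes>\<^bsub>Hn n\<^esub> A = \<one>\<^bsub>Hn n\<^esub>"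
    using f(1) Zn_carrier unfolding f(2) by (simp add: cls_mult[OF fi f(1)] cls_one)
  then have "inv\<^bsub>Hn n\<^esub> A = cls n (inv\<^bsub>Cn n\<^esub> f)"
    using f fi Hn_grp by (intro group.inv_equality) (auto simp: carrier_Hn)
  moreover have "gen1 (int p) G n (hm (inv\<^bsub>Cn n\<^esub> f))"
  proof (rule gen1_cong[OF gen1_mult[OF f(3), of "- 1"]])
    fix gs assume "gs \<in> tuples G (Suc n)"
    then show "[hm (inv\<^bsub>Cn n\<^esub> f) gs = - 1 * hm f gs] (mod int p)"
      using homog_inv_Cn f(1) Zn_carrier by simp
  qed
  ultimately show ?thesis
    using generated_cls[OF fi] by simp
qed

lemma generated_cup:
  assumes "generated k A" "generated n B"
  shows "generated (k + n) (cup G R k n A B)"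
proof -
  obtain f where f: "f \<in> Zn k" "A = cls k f" "gen1 (int p) G k (hm f)"
    using generatedE[OF assms(1)] .
  obtain h where h: "h \<in> Zn n" "B = cls n h" "gen1 (int p) G n (hm h)"
    using generatedE[OF assms(2)] .
  have "gen1 (int p) G (k + n) (hm (cochain_cup G R k n f h))"
    by (rule gen1_cong[OF gen1_cupk[OF f(3) h(3)]]) (simp add: cochain_cup_homog cong_def)
  then show ?thesis
    using f h cochain_cup_Zn by (simp add: cup_cls generated_cls)
qed

lemma generated_finprod:
  assumes "finite I" "\<And>i. i \<in> I \<Longrightarrow> generated n (\<phi> i)"
  shows "generated n (finprod (Hn n) \<phi> I)"
  using assms
proof (induction I rule: finite_induct)
  case empty
  interpret H: comm_group "Hn n"
    by (rule Hn_group)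
  show ?case
    by (simp add: generated_one)
next
  case (insert i I)
  interpret H: comm_group "Hn n"
    by (rule Hn_group)
  have "finprod (Hn n) \<phi> (insert i I) = \<phi> i \<otimes>\<^bsub>Hn n\<^esub> finprod (Hn n) \<phi> I"
    using insert by (intro H.finprod_insert) (auto simp: generated_def)
  then show ?case
    using insert by (simp add: generated_mult)
qed

lemma generated_homogeneous: "generated n A \<Longrightarrow> generated m (homogeneous G R n A m)"
  by (simp add: homogeneous_def generated_one)

lemma generated_scalar:
  assumes a: "a \<in> carrier R"
  shows "generated m (scalar G R a m)"
  unfolding scalar_def
proof (rule generated_homogeneous[OF generated_cls[OF scalar_cochain[OF a]]])
  show "gen1 (int p) G 0 (hm (\<lambda>xs\<in>tuples G 0. a))"
    using scalar_cochain[OF a] by (intro gen1_degree_zero) (simp add: mem_cocycles)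
qed

lemma gen1_degree_one:
  assumes F: "is_cocycle m G 1 F"
  shows "gen1 m G 1 F"
proof -
  have "gen1 m G 0 (\<lambda>_. 1)"
    by (rule gen1.const[of _ _ 1]) simp
  from gen1.cup[OF this hom_mod_of_cocycle(1)[OF F]]
  have "gen1 m G 1 (cup1 (\<lambda>g. F [\<one>, g]) (\<lambda>_. 1))"
    by simp
  then show ?thesis
  proof (rule gen1_cong)
    fix gs assume "gs \<in> tuples G (Suc 1)"
    then obtain x y where "gs = [x, y]" "x \<in> carrier G" "y \<in> carrier G"
      by (auto simp: tuples_def length_Suc_conv)
    then show "[F gs = cup1 (\<lambda>g. F [\<one>, g]) (\<lambda>_. 1) gs] (mod m)"
      using hom_mod_of_cocycle(2)[OF F] by (simp add: cup1_def)
  qed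
qed

text \<open>
  The property of being generated is stated for the homogeneous components of a ring element and is
  preserved by all ring operations, in particular by products, via \<open>gen1_cupk\<close>.
\<close>

lemma generate_ring_generated:
  "x \<in> generate_ring Ring gens \<Longrightarrow> generated n (x n)"
proof (induction arbitrary: n rule: generate_ring.induct)
  case one
  then show ?case
    unfolding one_Ring by (intro generated_scalar one_in_R)
next
  case (incl h)
  then consider a where "a \<in> carrier R" "h = scalar G R a"
    | A where "A \<in> carrier (Hn 1)" "h = homogeneous G R 1 A"
    by blast
  then show ?case
  proof cases
    case 1
    then show ?thesis
      by (simp add: generated_scalar)
  next
    case 2
    have "generated 1 A"
      using 2(1) gen1_degree_one mem_carrier_Hn(1)[OF 2(1)] by (auto simp: generated_def mem_cocycles)
    then show ?thesis
      using 2(2) generated_homogeneous by simp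
  qed
next
  case (a_inv h)
  then show ?case
    using generate_closed[OF a_inv.hyps] by (simp add: a_inv_Ring generated_inv)
next
  case (eng_add x y)
  then show ?case
    by (simp add: add_Ring generated_mult)
next
  case (eng_mult x y)
  have "generated n (cup G R i (n - i) (x i) (y (n - i)))" if "i \<le> n" for i
    using generated_cup[OF eng_mult.IH(1)[of i] eng_mult.IH(2)[of "n - i"]] that by simp
  then show ?case
    unfolding mult_Ring by (intro generated_finprod) auto
qed

lemma dehomog_Zn: "is_cocycle (int p) G n F \<Longrightarrow> dehomog G p n F \<in> Zn n"
  using homog_dehomog is_cocycle_cong by (simp add: mem_cocycles dehomog_closed) (metis is_cocycle_def)

text \<open>
  The induction is over \<open>gen1\<close>; an arbitrary inhomogeneous representative \<open>f\<close> is kept, so that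
  changing a cocycle by a coboundary leaves the class in the statement unchanged.
\<close>

lemma gen1_in_generate:
  "gen1 (int p) G n F \<Longrightarrow> f \<in> Zn n \<Longrightarrow> (\<And>gs. gs \<in> tuples G (Suc n) \<Longrightarrow> [hm f gs = F gs] (mod int p)) \<Longrightarrow>
    homogeneous G R n (cls n f) \<in> generate_ring Ring gens"
proof (induction arbitrary: f rule: gen1.induct)
  case (const F a)
  have amod: "a mod int p \<in> carrier R"
    by (rule mod_in_R)
  have "cls 0 f = cls 0 (\<lambda>xs\<in>tuples G 0. a mod int p)"
  proof (rule cls_eqI_cong[OF const.prems(1) scalar_cochain[OF amod]])
    fix gs assume gs: "gs \<in> tuples G (Suc 0)"
    have "[hm f gs = a] (mod int p)"
      using const.prems(2)[OF gs] const.hyps gs cong_trans by fastforce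
    then show "[hm (\<lambda>xs\<in>tuples G 0. a mod int p) gs = hm f gs] (mod int p)"
      using quots_closed[OF gs] by (simp add: homog_def cong_def)
  qed
  then have "homogeneous G R 0 (cls 0 f) = scalar G R (a mod int p)"
    by (simp add: scalar_def)
  then show ?case
    using amod by (auto intro: generate_ring.incl)
next
  case (cup n F \<alpha>)
  define \<alpha>1 where "\<alpha>1 = (\<lambda>gs. \<alpha> (gs ! 1) - \<alpha> (gs ! 0))"
  have "gen1 (int p) G 0 (\<lambda>_. 1)"
    by (rule gen1.const[of _ _ 1]) simp
  from gen1.cup[OF this cup.hyps(2)] have "gen1 (int p) G 1 (cup1 \<alpha> (\<lambda>_. 1))"
    by simp
  then have "is_cocycle (int p) G 1 (cup1 \<alpha> (\<lambda>_. 1))"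
    by (rule gen1_cocycle)
  then have \<alpha>1: "is_cocycle (int p) G 1 \<alpha>1"
    by (simp add: \<alpha>1_def cup1_def[abs_def])
  have Fc: "is_cocycle (int p) G n F"
    using cup.hyps(1) by (rule gen1_cocycle)
  let ?a = "dehomog G p 1 \<alpha>1" and ?h = "dehomog G p n F"
  have Z: "?a \<in> Zn 1" "?h \<in> Zn n"
    using \<alpha>1 Fc dehomog_Zn by auto
  have inv: "inv_cochain (int p) G 1 \<alpha>1" "inv_cochain (int p) G n F"
    using \<alpha>1 Fc by (auto simp: is_cocycle_def)
  have "homogeneous G R n (cls n ?h) \<in> generate_ring Ring gens"
    using Z(2) by (rule cup.IH) (rule homog_dehomog[OF inv(2)])
  moreover have "homogeneous G R 1 (cls 1 ?a) \<in> generate_ring Ring gens"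
    using Z(1) by (intro generate_ring.incl) (auto simp: carrier_Hn)
  ultimately have "homogeneous G R 1 (cls 1 ?a) \<otimes>\<^bsub>Ring\<^esub> homogeneous G R n (cls n ?h) \<in> generate_ring Ring gens"
    by (intro generate_ring.eng_mult)
  moreover have "cls (1 + n) (cochain_cup G R 1 n ?a ?h) = cls (1 + n) f"
  proof (rule cls_eqI_cong[OF cochain_cup_Zn[OF Z]])
    show "f \<in> Zn (1 + n)"
      using cup.prems(1) by simp
    fix gs assume gs: "gs \<in> tuples G (Suc (1 + n))"
    have t: "take (Suc 1) gs \<in> tuples G (Suc 1)" "drop 1 gs \<in> tuples G (Suc n)"
      using tuples_take[OF gs, of "Suc 1"] tuples_drop[OF gs, of 1] by auto
    have "[hm (cochain_cup G R 1 n ?a ?h) gs = hm ?a (take (Suc 1) gs) * hm ?h (drop 1 gs)] (mod int p)"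
      unfolding cochain_cup_homog[OF gs] by (simp add: cupk_def cong_def)
    also have "[hm ?a (take (Suc 1) gs) * hm ?h (drop 1 gs) = \<alpha>1 (take (Suc 1) gs) * F (drop 1 gs)] (mod int p)"
      using homog_dehomog[OF inv(1) t(1)] homog_dehomog[OF inv(2) t(2)] by (rule cong_mult)
    also have "\<alpha>1 (take (Suc 1) gs) * F (drop 1 gs) = cup1 \<alpha> F gs"
      by (simp add: \<alpha>1_def cup1_def drop_Suc)
    also have "[cup1 \<alpha> F gs = hm f gs] (mod int p)"
      using cup.prems(2)[of gs] gs by (simp add: cong_sym_eq)
    finally show "[hm f gs = hm (cochain_cup G R 1 n ?a ?h) gs] (mod int p)"
      by (rule cong_sym)
  qed
  ultimately have "homogeneous G R (1 + n) (cls (1 + n) f) \<in> generate_ring Ring gens"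
    by (simp only: homogeneous_mult[OF Z])
  then show ?case
    by simp
next
  case (add n F F')
  let ?f = "dehomog G p n F" and ?h = "dehomog G p n F'"
  have c: "is_cocycle (int p) G n F" "is_cocycle (int p) G n F'"
    using add.hyps gen1_cocycle by auto
  have Z: "?f \<in> Zn n" "?h \<in> Zn n"
    using c dehomog_Zn by auto
  have inv: "inv_cochain (int p) G n F" "inv_cochain (int p) G n F'"
    using c by (auto simp: is_cocycle_def)
  have "homogeneous G R n (cls n ?f) \<in> generate_ring Ring gens"
    using Z(1) by (rule add.IH(1)) (rule homog_dehomog[OF inv(1)])
  moreover have "homogeneous G R n (cls n ?h) \<in> generate_ring Ring gens"
    using Z(2) by (rule add.IH(2)) (rule homog_dehomog[OF inv(2)])
  ultimately have "homogeneous G R n (cls n ?f) \<oplus>\<^bsub>Ring\<^esub> homogeneous G R n (cls n ?h) \<in> generate_ring Ring gens"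
    by (intro generate_ring.eng_add)
  moreover have "homogeneous G R n (cls n ?f) \<oplus>\<^bsub>Ring\<^esub> homogeneous G R n (cls n ?h)
      = homogeneous G R n (cls n (?f \<otimes>\<^bsub>Cn n\<^esub> ?h))"
  proof (rule ext)
    fix m
    show "(homogeneous G R n (cls n ?f) \<oplus>\<^bsub>Ring\<^esub> homogeneous G R n (cls n ?h)) m
        = homogeneous G R n (cls n (?f \<otimes>\<^bsub>Cn n\<^esub> ?h)) m"
      unfolding add_Ring homogeneous_def using cls_mult[OF Z] by simp
  qed
  moreover have "cls n (?f \<otimes>\<^bsub>Cn n\<^esub> ?h) = cls n f"
  proof (rule cls_eqI_cong[OF subgroup.m_closed[OF Zn_subgroup Z] add.prems(1)])
    fix gs assume gs: "gs \<in> tuples G (Suc n)"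
    have "[hm (?f \<otimes>\<^bsub>Cn n\<^esub> ?h) gs = hm ?f gs + hm ?h gs] (mod int p)"
      using gs by (rule homog_mult)
    also have "[hm ?f gs + hm ?h gs = F gs + F' gs] (mod int p)"
      using homog_dehomog[OF inv(1) gs] homog_dehomog[OF inv(2) gs] by (rule cong_add)
    finally show "[hm f gs = hm (?f \<otimes>\<^bsub>Cn n\<^esub> ?h) gs] (mod int p)"
      using add.prems(2)[OF gs] cong_sym cong_trans by blast
  qed
  ultimately show ?case
    by simp
next
  case (coh n F U F')
  let ?h = "dehomog G p (Suc n) F"
  have c: "is_cocycle (int p) G (Suc n) F"
    using coh.hyps(1) by (rule gen1_cocycle)
  then have inv: "inv_cochain (int p) G (Suc n) F"
    by (simp add: is_cocycle_def)
  have Z: "?h \<in> Zn (Suc n)"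
    using c by (rule dehomog_Zn)
  have "homogeneous G R (Suc n) (cls (Suc n) ?h) \<in> generate_ring Ring gens"
    using Z by (rule coh.IH) (rule homog_dehomog[OF inv])
  moreover have "cls (Suc n) ?h = cls (Suc n) f"
  proof (rule cls_eqI[OF Z coh.prems(1)])
    have "[hm f gs - hm ?h gs = sd U gs] (mod int p)" if gs: "gs \<in> tuples G (Suc (Suc n))" for gs
    proof -
      have "[hm f gs = F gs + sd U gs] (mod int p)"
        using coh.prems(2)[OF gs] coh.hyps(3)[OF gs] by (rule cong_trans)
      then have "[hm f gs - hm ?h gs = (F gs + sd U gs) - F gs] (mod int p)"
        using homog_dehomog[OF inv gs] by (rule cong_diff)
      then show ?thesis
        by simp
    qed
    then show "null (Suc n) (\<lambda>gs. hm f gs - hm ?h gs)"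
      using coh.hyps(2) unfolding null_class_def nat.case by blast
  qed
  ultimately show ?case
    by simp
qed

text \<open>
  A ring element is a finite sum of homogeneous ones, so membership of all homogeneous elements in
  the generated subring suffices.
\<close>

theorem generated_in_degree_one_iff:
  "generated_in_degree_one G R \<longleftrightarrow> (\<forall>n F. is_cocycle (int p) G n F \<longrightarrow> gen1 (int p) G n F)"
proof
  assume "generated_in_degree_one G R"
  then have eq: "generate_ring Ring gens = carrier Ring"
    by (simp add: generated_in_degree_one_def)
  show "\<forall>n F. is_cocycle (int p) G n F \<longrightarrow> gen1 (int p) G n F"
  proof (intro allI impI)
    fix n F assume F: "is_cocycle (int p) G n F"
    let ?f = "dehomog G p n F"
    have Z: "?f \<in> Zn n"
      using F by (rule dehomog_Zn)
    then have "homogeneous G R n (cls n ?f) \<in> generate_ring Ring gens"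
      unfolding eq by (intro homogeneous_closed) (auto simp: carrier_Hn)
    then have "generated n (homogeneous G R n (cls n ?f) n)"
      by (rule generate_ring_generated)
    then have "gen1 (int p) G n (hm ?f)"
      using cls_self[OF Z] by (simp add: generated_def homogeneous_def)
    then show "gen1 (int p) G n F"
      by (rule gen1_cong) (rule cong_sym[OF homog_dehomog], use F in \<open>auto simp: is_cocycle_def\<close>)
  qed
next
  assume gen: "\<forall>n F. is_cocycle (int p) G n F \<longrightarrow> gen1 (int p) G n F"
  have hom: "homogeneous G R n A \<in> generate_ring Ring gens" if A: "A \<in> carrier (Hn n)" for n A
  proof -
    obtain f where f: "f \<in> Zn n" "A = cls n f"
      using A by (auto simp: carrier_Hn)
    then have "gen1 (int p) G n (hm f)"
      using gen by (simp add: mem_cocycles)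
    then show ?thesis
      using gen1_in_generate[OF _ f(1)] f(2) by simp
  qed
  have fin: "x \<in> generate_ring Ring gens" if "finite I" "x \<in> carrier Ring" "{n. x n \<noteq> \<one>\<^bsub>Hn n\<^esub>} \<subseteq> I" for I x
    using that
  proof (induction I arbitrary: x rule: finite_induct)
    case empty
    have "x = homogeneous G R 0 \<one>\<^bsub>Hn 0\<^esub>"
      using empty by (auto simp: homogeneous_def fun_eq_iff)
    then show ?case
      using hom[OF Hn_one] by simp
  next
    case (insert n I)
    define y where "y = (\<lambda>m. if m = n then \<one>\<^bsub>Hn m\<^esub> else x m)"
    have xc: "x m \<in> carrier (Hn m)" for m
      using insert.prems(1) by (simp add: carrier_Ring)
    have "finite {m. y m \<noteq> \<one>\<^bsub>Hn m\<^esub>}" "{m. y m \<noteq> \<one>\<^bsub>Hn m\<^esub>} \<subseteq> I"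
      using insert.prems insert.hyps(1) finite_subset by (auto simp: y_def intro: finite_subset[of _ I])
    then have "y \<in> generate_ring Ring gens"
      using xc by (intro insert.IH) (auto simp: carrier_Ring y_def)
    then have "homogeneous G R n (x n) \<oplus>\<^bsub>Ring\<^esub> y \<in> generate_ring Ring gens"
      using hom[OF xc] by (intro generate_ring.eng_add)
    moreover have "homogeneous G R n (x n) \<oplus>\<^bsub>Ring\<^esub> y = x"
    proof (rule ext)
      fix m
      show "(homogeneous G R n (x n) \<oplus>\<^bsub>Ring\<^esub> y) m = x m"
        unfolding add_Ring homogeneous_def y_def using xc[of m] by (cases "m = n") simp_all
    qed
    ultimately show ?case
      by simp
  qed
  have "carrier Ring \<subseteq> generate_ring Ring gens"
    using fin by (auto simp: carrier_Ring)
  then show "generated_in_degree_one G R"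
    using generate_closed by (auto simp: generated_in_degree_one_def)
qed

end

theorem theorem1p1:
  fixes G :: "('a, 'm) monoid_scheme" and p :: nat and S :: "'a set"
  assumes "group G" and "finite (carrier G)"
    and "prime p" and "p dvd order G"
    and "sylow_subgroup 2 S G"
  shows "generated_in_degree_one G (residue_ring (int p)) \<longleftrightarrow>
    p = 2 \<and> S \<noteq> {\<one>\<^bsub>G\<^esub>} \<and> elementary_2_abelian (G\<lparr>carrier := S\<rparr>)
      \<and> (\<exists>N. normal_complement N S G)"
proof -
  interpret mod_p_cochains G p
    by (rule mod_p_cochains.intro[OF assms(1) mod_p_cochains_axioms.intro[OF assms(3)]])
  show ?thesis
    unfolding generated_in_degree_one_iff by (rule gen1_all_iff[OF assms(2-5)])
qed

end
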